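(* Each $(\boldsymbol\omega,\mathbf{A})\in\mathcal{P}_5$ has exactly $N-2$ eigenvalues, each $(\boldsymbol\omega,\mathbf{A})\in\mathcal{P}_{2,3}\setminus\mathcal{P}_5$ has exactly $N-1$ eigenvalues, and each $(\boldsymbol\omega,\mathbf{A})\in(\Omega_N^{\mathbb{R},+}\times\mathcal{O}_{2,3}^{\mathbb{C}})\setminus\mathcal{P}_{2,3}$ has exactly $N$ eigenvalues $\lambda_n=\lambda_n(\boldsymbol\omega,\mathbf{A})$, $0\le n\le N-1$, which satisfy the following, where $p=(\boldsymbol\omega,\mathbf{A})$ and $p_0=(\boldsymbol\omega_0,\mathbf{A}_0)$: (i) the $\lambda_n$ are continuous in $(\Omega_N^{\mathbb{R},+}\times\mathcal{O}_{2,3}^{\mathbb{C}})\setminus\mathcal{P}_{2,3}$; (ii) the $\lambda_n$, $0\le n\le N-1$, are not continuous at each point of $\mathcal{P}_{2,3}$ and have the following asymptotic behaviors. Near any given $p_0\in\mathcal{P}_{2,3r}$: $$\lim_{\mathcal{P}_{2,3}^-\cup\mathcal{P}_{2,3r}\ni p\to p_0}\lambda_n(p)=\lambda_n(p_0),\ 0\le n\le N-2,\quad \lim_{\mathcal{P}_{2,3}^-\ni p\to p_0}\lambda_{N-1}(p)=+\infty,$$ $$\lim_{\mathcal{P}_{2,3r}^+\ni p\to p_0}\lambda_0(p)=-\infty,\quad \lim_{\mathcal{P}_{2,3r}^+\ni p\to p_0}\lambda_n(p)=\lambda_{n-1}(p_0),\ 1\le n\le N-1.$$ Near any given $p_0\in\mathcal{P}_{2,3l}$: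 $$\lim_{\mathcal{P}_{2,3}^-\ni p\to p_0}\lambda_0(p)=-\infty,\quad \lim_{\mathcal{P}_{2,3}^-\ni p\to p_0}\lambda_n(p)=\lambda_{n-1}(p_0),\ 1\le n\le N-1,$$ $$\lim_{\mathcal{P}_{2,3l}^+\cup\mathcal{P}_{2,3l}\ni p\to p_0}\lambda_n(p)=\lambda_n(p_0),\ 0\le n\le N-2,\quad \lim_{\mathcal{P}_{2,3l}^+\ni p\to p_0}\lambda_{N-1}(p)=+\infty.$$ Near any given $p_0\in\mathcal{P}_5$: $$\lim_{\mathcal{P}_{2,3r}^+\cup\mathcal{P}_{2,3r}\cup\mathcal{P}_{2,3}^-\ni p\to p_0}\lambda_0(p)=-\infty,\quad \lim_{\mathcal{P}_{2,3r}^+\ni p\to p_0}\lambda_1(p)=-\infty,$$ $$\lim_{\mathcal{P}_{2,3l}^+\cup\mathcal{P}_{2,3l}\cup\mathcal{P}_5\ni p\to p_0}\lambda_n(p)=\lambda_n(p_0),\ 0\le n\le N-3,$$ $$\lim_{\mathcal{P}_{2,3r}\cup\mathcal{P}_{2,3}^-\ni p\to p_0}\lambda_n(p)=\lambda_{n-1}(p_0),\ 1\le n\le N-2,$$ $$\lim_{\mathcal{P}_{2,3r}^+\ni p\to p_0}\lambda_n(p)=\lambda_{n-2}(p_0),\ 2\le n\le N-1,$$ $$\lim_{\mathcal{P}_{2,3l}^+\cup\mathcal{P}_{2,3l}\ni p\to p_0}\lambda_{N-2}(p)=+\infty,\quad \lim_{\mathcal{P}_{2,3l}^+\cup\mathcal{P}_{2,3}^-\ni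 p\to p_0}\lambda_{N-1}(p)=+\infty.$$ Consequently, $\lambda_n$ restricted in $\mathcal{P}_{2,3}^-\cup\mathcal{P}_{2,3r}$ and in $\mathcal{P}_{2,3l}^+\cup\mathcal{P}_{2,3l}\cup\mathcal{P}_5$ is continuous for each $0\le n\le N-3$, and $\lambda_{N-2}$ restricted in $\mathcal{P}_{2,3}^-\cup\mathcal{P}_{2,3r}$ and in $\mathcal{P}_{2,3l}^+\cup\mathcal{P}_{2,3l}$ is continuous.
   Context: Fix an integer $N\ge 2$. A self-adjoint discrete Sturm–Liouville problem is a pair $(\boldsymbol\omega,\mathbf{A})$. Here $\boldsymbol\omega=(1/f,q,w)$ with real sequences $f=\{f_n\}_{n=0}^N$, $q=\{q_n\}_{n=1}^N$, $w=\{w_n\}_{n=1}^N$, $f_n\ne0$, $w_n>0$, encodes the equation $-\nabla(f_n\Delta y_n)+q_ny_n=\lambda w_ny_n$, $1\le n\le N$, for $y=(y_0,\dots,y_{N+1})$, with $\Delta y_n=y_{n+1}-y_n$, $\nabla y_n=y_n-y_{n-1}$; the set $\Omega_N^{\mathbb{R},+}$ of all such $(1/f,q,w)$ has the topology of a subset of $\mathbb{R}^{3N+1}$. $\mathbf{A}=[A\,|\,B]$ encodes the boundary condition $A\begin{pmatrix}y_0\\ f_0\Delta y_0\end{pmatrix}+B\begin{pmatrix}y_N\\ f_N\Delta y_N\end{pmatrix}=0$, where $A,B$ are complex $2\times2$ matrices with $\mathrm{rank}(A,B)=2$ and $AJA^*=BJB^*$, $J=\begin{pmatrix}0&1\\-1&0\end{pmatrix}$;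 $[A\,|\,B]$ is the class of the $2\times4$ matrix $(A,B)$ modulo left multiplication by $GL(2,\mathbb{C})$, and $\mathcal{B}^{\mathbb{C}}$ is the set of all such classes, topologized as a subspace of the quotient of the rank-2 complex $2\times4$ matrices by $GL(2,\mathbb{C})$. $\Omega_N^{\mathbb{R},+}\times\mathcal{B}^{\mathbb{C}}$ has the product topology. An eigenvalue of $(\boldsymbol\omega,\mathbf{A})$ is a $\lambda$ for which a nonzero $y$ solves the equation and the boundary condition. Eigenvalues are real and finite in number; they are counted with multiplicity (the dimension of the solution space) and listed as $\lambda_0\le\lambda_1\le\cdots$; $\lambda_n$ is defined at a problem only if it has more than $n$ eigenvalues, and $\lambda_n$ is regarded as not continuous at a point where it is not defined. Assertions over empty ranges of $n$ are vacuous. $\mathcal{O}_{2,3}^{\mathbb{C}}=\left\{\left[\begin{array}{cccc}a_{11}&-1&0&\bar z\\ z&0&-1&b_{22}\end{array}\right]:a_{11},b_{22}\in\mathbb{R},\ z\in\mathbb{C}\right\}$, an open subset of $\mathcal{B}^{\mathbb{C}}$. For $(\boldsymbol\omega,\mathbf{A})\in\Omega_N^{\mathbb{R},+}\times\mathcal{O}_{2,3}^{\mathbb{C}}$ put $d=(a_{11}+f_0)b_{22}-|z|^2$. $\mathcal{P}_5$ is the set of $(\boldsymbol\omega,\mathbf{A})\in\Omega_N^{\mathbb{R},+}\times\mathcal{B}^{\mathbb{C}}$ with $\mathbf{A}=\left[\begin{array}{cccc}1&1/f_0&0&0\\0&0&1&0\end{array}\right]$. As subsets of $\Omega_N^{\mathbb{R},+}\times\mathcal{O}_{2,3}^{\mathbb{C}}$: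 $\mathcal{P}_{2,3}=\{d=0\}$; $\mathcal{P}_{2,3}^-=\{d<0\}$; $\mathcal{P}_{2,3r}=\{d=0,\ a_{11}+f_0\ge0,\ b_{22}\ge0\}\setminus\mathcal{P}_5$; $\mathcal{P}_{2,3l}=\{d=0,\ a_{11}+f_0\le0,\ b_{22}\le0\}\setminus\mathcal{P}_5$; $\mathcal{P}_{2,3r}^+=\{d>0,\ a_{11}+f_0\ge0,\ b_{22}\ge0\}$; $\mathcal{P}_{2,3l}^+=\{d>0,\ a_{11}+f_0\le0,\ b_{22}\le0\}$.
   Formalization: In (ii), non-continuity of λ_n at a point of P_{2,3} is claimed except when n≥1, λ_n is defined there and λ_{n-1}=λ_n at that point; there λ_n is continuous by the displayed limits (e.g. N=3, f=w=1, q=0, a_11=-2, z=1, b_22=-1, n=1). *)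

theory Defs
  imports "HOL-Analysis.Analysis" "HOL-Library.Function_Algebras"
begin

section \<open>Equations\<close>

text \<open>
  An equation is a triple \<open>(g, q, w)\<close> with \<open>g = 1/f\<close>. Finite sequences are functions on
  \<open>nat\<close> that are \<open>0\<close> outside the index range. Under the product topology of \<open>nat \<Rightarrow> real\<close> the set
  \<open>Omega N\<close> is then homeomorphic to the corresponding subset of Euclidean space of dimension
  \<open>3N + 1\<close>.
\<close>

type_synonym equation = "(nat \<Rightarrow> real) \<times> (nat \<Rightarrow> real) \<times> (nat \<Rightarrow> real)"

definition Omega :: "nat \<Rightarrow> equation set" where
  "Omega N = {(g, q, w).
     (\<forall>n\<le>N. g n \<noteq> 0) \<and> (\<forall>n>N. g n = 0) \<and>
     (\<forall>n\<in>{1..N}. w n > 0) \<and> (\<forall>n. n \<notin> {1..N} \<longrightarrow> q n = 0 \<and> w n = 0)}"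

definition f_of :: "equation \<Rightarrow> nat \<Rightarrow> real" where
  "f_of \<omega> n = 1 / fst \<omega> n"

definition q_of :: "equation \<Rightarrow> nat \<Rightarrow> real" where
  "q_of \<omega> = fst (snd \<omega>)"

definition w_of :: "equation \<Rightarrow> nat \<Rightarrow> real" where
  "w_of \<omega> = snd (snd \<omega>)"

definition fdiff :: "(nat \<Rightarrow> complex) \<Rightarrow> nat \<Rightarrow> complex" where
  "fdiff y n = y (n + 1) - y n"

text \<open>Only used for \<open>n \<ge> 1\<close>.\<close>

definition bdiff :: "(nat \<Rightarrow> complex) \<Rightarrow> nat \<Rightarrow> complex" where
  "bdiff y n = y n - y (n - 1)"


section \<open>Boundary conditions\<close>

definition Ablock :: "complex^4^2 \<Rightarrow> complex^2^2" where
  "Ablock M = (\<chi> i. vector [M $ i $ 1, M $ i $ 2])"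

definition Bblock :: "complex^4^2 \<Rightarrow> complex^2^2" where
  "Bblock M = (\<chi> i. vector [M $ i $ 3, M $ i $ 4])"

definition Jmat :: "complex^2^2" where
  "Jmat = vector [vector [0, 1], vector [-1, 0]]"

definition ctranspose :: "complex^2^2 \<Rightarrow> complex^2^2" where
  "ctranspose A = map_matrix cnj (transpose A)"

definition bc_class :: "complex^4^2 \<Rightarrow> (complex^4^2) set" where
  "bc_class M = {T ** M |T. invertible T}"

definition rank2 :: "(complex^4^2) set" where
  "rank2 = {M. rank M = 2}"

definition BC :: "(complex^4^2) set set" where
  "BC = {bc_class M |M. M \<in> rank2 \<and>
     Ablock M ** Jmat ** ctranspose (Ablock M) = Bblock M ** Jmat ** ctranspose (Bblock M)}"

text \<open>The quotient topology on the set of classes of all rank 2 matrices.\<close>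

definition quot_top :: "(complex^4^2) set topology" where
  "quot_top = topology (\<lambda>U. U \<subseteq> bc_class ` rank2 \<and>
     openin (top_of_set rank2) {M \<in> rank2. bc_class M \<in> U})"

definition bc_top :: "(complex^4^2) set topology" where
  "bc_top = subtopology quot_top BC"

lemma openin_quot_top:
  "openin quot_top U \<longleftrightarrow> U \<subseteq> bc_class ` rank2 \<and>
     openin (top_of_set rank2) {M \<in> rank2. bc_class M \<in> U}"
proof -
  let ?L = "\<lambda>U. U \<subseteq> bc_class ` rank2 \<and>
     openin (top_of_set rank2) {M \<in> rank2. bc_class M \<in> U}"
  have "istopology ?L"
    unfolding istopology_def
  proof (intro conjI allI impI)
    fix S T assume S: "?L S" and T: "?L T"
    have "{M \<in> rank2. bc_class M \<in> S \<inter> T} =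
      {M \<in> rank2. bc_class M \<in> S} \<inter> {M \<in> rank2. bc_class M \<in> T}" by auto
    then show "openin (top_of_set rank2) {M \<in> rank2. bc_class M \<in> S \<inter> T}"
      using S T by (simp only: openin_Int)
    show "S \<inter> T \<subseteq> bc_class ` rank2" using S by blast
  next
    fix \<K> assume K: "\<forall>K\<in>\<K>. ?L K"
    have "{M \<in> rank2. bc_class M \<in> \<Union>\<K>} = (\<Union>K\<in>\<K>. {M \<in> rank2. bc_class M \<in> K})" by auto
    then show "openin (top_of_set rank2) {M \<in> rank2. bc_class M \<in> \<Union>\<K>}"
      using K by (simp only:) (rule openin_Union, blast)
    show "\<Union>\<K> \<subseteq> bc_class ` rank2" using K by blast
  qed
  then show ?thesis by (simp add: quot_top_def)
qed

lemma topspace_quot_top [simp]: "topspace quot_top = bc_class ` rank2"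
proof
  show "topspace quot_top \<subseteq> bc_class ` rank2"
    using openin_topspace[of quot_top] unfolding openin_quot_top by (rule conjunct1)
  have "{M \<in> rank2. bc_class M \<in> bc_class ` rank2} = rank2" by auto
  then have "openin quot_top (bc_class ` rank2)"
    by (simp add: openin_quot_top)
  then show "bc_class ` rank2 \<subseteq> topspace quot_top"
    by (rule openin_subset)
qed

lemma quotient_map_bc_class: "quotient_map (top_of_set rank2) quot_top bc_class"
  unfolding quotient_map_def topspace_quot_top openin_quot_top topspace_euclidean_subtopology
  by blast

lemma topspace_bc_top [simp]: "topspace bc_top = BC"
proof -
  have "BC \<subseteq> bc_class ` rank2" unfolding BC_def by blast
  then show ?thesis unfolding bc_top_def topspace_subtopology topspace_quot_top by blast
qed


section \<open>Problems and their eigenvalues\<close>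

type_synonym problem = "equation \<times> (complex^4^2) set"

definition prob_top :: "nat \<Rightarrow> problem topology" where
  "prob_top N = prod_topology (top_of_set (Omega N)) bc_top"

lemma topspace_prob_top [simp]: "topspace (prob_top N) = Omega N \<times> BC"
  unfolding prob_top_def topspace_prod_topology topspace_bc_top topspace_euclidean_subtopology ..

definition satisfies_eqn :: "nat \<Rightarrow> equation \<Rightarrow> complex \<Rightarrow> (nat \<Rightarrow> complex) \<Rightarrow> bool" where
  "satisfies_eqn N \<omega> \<mu> y \<longleftrightarrow>
     (\<forall>n\<in>{1..N}. - bdiff (\<lambda>k. of_real (f_of \<omega> k) * fdiff y k) n + of_real (q_of \<omega> n) * y n
        = \<mu> * of_real (w_of \<omega> n) * y n)"

text \<open>The condition does not depend on the representative \<open>M\<close> of the class.\<close>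

definition satisfies_bc ::
  "nat \<Rightarrow> equation \<Rightarrow> (complex^4^2) set \<Rightarrow> (nat \<Rightarrow> complex) \<Rightarrow> bool" where
  "satisfies_bc N \<omega> \<A> y \<longleftrightarrow>
     (\<forall>M\<in>\<A>. Ablock M *v vector [y 0, of_real (f_of \<omega> 0) * fdiff y 0] +
            Bblock M *v vector [y N, of_real (f_of \<omega> N) * fdiff y N] = 0)"

text \<open>The vector \<open>(y\<^sub>0, \<dots>, y\<^bsub>N+1\<^esub>)\<close> is a function that vanishes beyond \<open>N + 1\<close>.\<close>

definition sol_space :: "nat \<Rightarrow> problem \<Rightarrow> complex \<Rightarrow> (nat \<Rightarrow> complex) set" where
  "sol_space N p \<mu> = {y. (\<forall>k>N+1. y k = 0) \<and>
     satisfies_eqn N (fst p) \<mu> y \<and> satisfies_bc N (fst p) (snd p) y}"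

definition eigenvalues :: "nat \<Rightarrow> problem \<Rightarrow> complex set" where
  "eigenvalues N p = {\<mu>. \<exists>y\<in>sol_space N p \<mu>. y \<noteq> 0}"

global_interpretation cseq: vector_space "\<lambda>(c::complex) (y::nat \<Rightarrow> complex). (\<lambda>k. c * y k)"
  by unfold_locales (simp_all add: fun_eq_iff algebra_simps)

definition multiplicity_of :: "nat \<Rightarrow> problem \<Rightarrow> complex \<Rightarrow> nat" where
  "multiplicity_of N p \<mu> = cseq.dim (sol_space N p \<mu>)"

text \<open>
  The eigenvalues repeated according to multiplicity, in nondecreasing order. They are
  defined as complex numbers but are in fact all real, so that taking the real part loses nothing.
\<close>

definition eig_list :: "nat \<Rightarrow> problem \<Rightarrow> real list" where
  "eig_list N p = sorted_list_of_multiset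
     (\<Sum>\<mu>\<in>eigenvalues N p. replicate_mset (multiplicity_of N p \<mu>) (Re \<mu>))"

definition num_eigs :: "nat \<Rightarrow> problem \<Rightarrow> nat" where
  "num_eigs N p = length (eig_list N p)"

text \<open>Finiteness is required separately because a sum over an infinite set is \<open>0\<close>.\<close>

definition has_exactly_eigs :: "nat \<Rightarrow> problem \<Rightarrow> nat \<Rightarrow> bool" where
  "has_exactly_eigs N p k \<longleftrightarrow> finite (eigenvalues N p) \<and> num_eigs N p = k"

text \<open>Only meaningful for \<open>n < num_eigs N p\<close>.\<close>

definition lam :: "nat \<Rightarrow> nat \<Rightarrow> problem \<Rightarrow> real" where
  "lam N n p = eig_list N p ! n"

text \<open>
  Continuity at \<open>p\<close> of the partial function \<open>\<lambda>\<^sub>n\<close> restricted to \<open>S\<close>. It fails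
  by definition where \<open>\<lambda>\<^sub>n\<close> is undefined.
\<close>

definition lam_continuous_at :: "nat \<Rightarrow> nat \<Rightarrow> problem set \<Rightarrow> problem \<Rightarrow> bool" where
  "lam_continuous_at N n S p \<longleftrightarrow> p \<in> S \<and> n < num_eigs N p \<and>
     (lam N n \<longlongrightarrow> lam N n p) (atin_within (prob_top N) p {p' \<in> S. n < num_eigs N p'})"

definition lam_continuous_on :: "nat \<Rightarrow> nat \<Rightarrow> problem set \<Rightarrow> bool" where
  "lam_continuous_on N n S \<longleftrightarrow> (\<forall>p\<in>S. lam_continuous_at N n S p)"

text \<open>
  \<open>\<lambda>\<^sub>n\<close> repeats the preceding entry of the list, i.e. \<open>\<lambda>\<^bsub>n-1\<^esub>(p) = \<lambda>\<^sub>n(p)\<close> is a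
  multiple eigenvalue. At such a point of \<open>d = 0\<close> the jump from \<open>\<lambda>\<^sub>n\<close> to \<open>\<lambda>\<^bsub>n-1\<^esub>\<close> has size \<open>0\<close> and
  \<open>\<lambda>\<^sub>n\<close> is continuous. Example with \<open>N = 3\<close>, \<open>f = w = 1\<close>, \<open>q = 0\<close>, \<open>a\<^sub>1\<^sub>1 = -2\<close>, \<open>z = 1\<close>,
  \<open>b\<^sub>2\<^sub>2 = -1\<close>: the conditions read \<open>y\<^sub>4 = y\<^sub>0\<close>, \<open>y\<^sub>3 = - y\<^sub>1\<close>, the only eigenvalue is \<open>2\<close>, and it is
  double.
\<close>

definition repeats_preceding :: "nat \<Rightarrow> nat \<Rightarrow> problem \<Rightarrow> bool" where
  "repeats_preceding N n p \<longleftrightarrow>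
     1 \<le> n \<and> n < num_eigs N p \<and> lam N (n - 1) p = lam N n p"


section \<open>The chart and its strata\<close>

definition chart_mat :: "real \<Rightarrow> complex \<Rightarrow> real \<Rightarrow> complex^4^2" where
  "chart_mat a z b = vector [vector [of_real a, -1, 0, cnj z], vector [z, 0, -1, of_real b]]"

definition O23 :: "(complex^4^2) set set" where
  "O23 = {bc_class (chart_mat a z b) |a z b. True}"

text \<open>
  \<open>stratum N Q\<close> consists of the problems over the chart for which \<open>Q\<close> holds of the triple
  \<open>a\<^sub>1\<^sub>1 + f\<^sub>0\<close>, \<open>b\<^sub>2\<^sub>2\<close>, \<open>d\<close>. The parameters \<open>a, z, b\<close> are determined by the class, since the second and
  third column of \<open>chart_mat a z b\<close> form the negative of the identity matrix.
\<close>

definition stratum :: "nat \<Rightarrow> (real \<Rightarrow> real \<Rightarrow> real \<Rightarrow> bool) \<Rightarrow> problem set" where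
  "stratum N Q = {(\<omega>, bc_class (chart_mat a z b)) |\<omega> a z b.
     \<omega> \<in> Omega N \<and> Q (a + f_of \<omega> 0) b ((a + f_of \<omega> 0) * b - (cmod z)\<^sup>2)}"

definition P5 :: "nat \<Rightarrow> problem set" where
  "P5 N = {(\<omega>, \<A>) \<in> Omega N \<times> BC.
     \<A> = bc_class (vector [vector [1, of_real (1 / f_of \<omega> 0), 0, 0], vector [0, 0, 1, 0]])}"

definition P23 :: "nat \<Rightarrow> problem set" where
  "P23 N = stratum N (\<lambda>s b d. d = 0)"

definition P23_minus :: "nat \<Rightarrow> problem set" where
  "P23_minus N = stratum N (\<lambda>s b d. d < 0)"

definition P23r :: "nat \<Rightarrow> problem set" where
  "P23r N = stratum N (\<lambda>s b d. d = 0 \<and> s \<ge> 0 \<and> b \<ge> 0) - P5 N"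

definition P23l :: "nat \<Rightarrow> problem set" where
  "P23l N = stratum N (\<lambda>s b d. d = 0 \<and> s \<le> 0 \<and> b \<le> 0) - P5 N"

definition P23r_plus :: "nat \<Rightarrow> problem set" where
  "P23r_plus N = stratum N (\<lambda>s b d. d > 0 \<and> s \<ge> 0 \<and> b \<ge> 0)"

definition P23l_plus :: "nat \<Rightarrow> problem set" where
  "P23l_plus N = stratum N (\<lambda>s b d. d > 0 \<and> s \<le> 0 \<and> b \<le> 0)"

end

theory Submission
  imports Defs
begin

text \<open>
  Put \<open>s = a + f\<^sub>0\<close>. A problem in the chart is the kernel problem of a Hermitian pencil \<open>B - \<lambda> G\<close> on the
  sequences \<open>(y\<^sub>0, \<dots>, y\<^bsub>N+1\<^esub>)\<close>: the form \<open>G\<close> is given by the weights and vanishes exactly on a plane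
  parametrized by \<open>y\<^sub>0\<close> and \<open>f\<^sub>N (y\<^bsub>N+1\<^esub> - y\<^sub>N)\<close>, on which \<open>B\<close> has the matrix with rows \<open>(s, cnj z)\<close> and
  \<open>(z, b)\<close> and determinant \<open>d\<close>. There are \<open>N\<close> minus the nullity of that matrix eigenvalues, and for \<open>\<lambda>\<close> not an
  eigenvalue the number of eigenvalues below \<open>\<lambda>\<close> is the negative index of \<open>B - \<lambda> G\<close> minus the number of
  nonpositive eigenvalues of the matrix. The negative index of a nondegenerate form is locally constant, so
  near a given problem the eigenvalue counts differ exactly by the change of the latter number, which is
  constant on each stratum. All limits, and the jumps responsible for the discontinuities, follow.
\<close>

section \<open>Hermitian forms\<close>

text \<open>\<open>gform\<close> is only semidefinite and the eigenvectors span at most N of the N +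
  2 dimensions, so the spectral theorem does not apply directly. The index formula comes from three
  inequalities. Eigenvectors with eigenvalue at most \<tau>, together with a nonpositive subspace of
  the kernel plane of \<open>gform\<close>, span a space that meets every positive space of
  \<open>kform\<close> only in 0; reversing the sign gives a second bound. A null vector of the 2 x
  2 matrix is admissible on both sides, so the sum of the two bounds reads (number of eigenvalues) +
  nullity <= N. The reverse bound is a completeness statement for the eigenvectors, and it forces
  equality everywhere. No eigenvalue or eigenvector is followed under perturbation. One positive and
  one negative subspace, of total dimension N + 2, are kept fixed while the problem varies. Since
  \<lambda>_n < t means that more than n eigenvalues lie below t, every limit becomes arithmetic:
  position n at p corresponds to position m at p0 when index(p) + n = index(p0) + m.\<close>

locale complex_vector_space = vector_space scale
  for scale :: "complex \<Rightarrow> 'b::ab_group_add \<Rightarrow> 'b" (infixr \<open>*s\<close> 75)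
begin

definition hermitian :: "('b \<Rightarrow> 'b \<Rightarrow> complex) \<Rightarrow> bool" where
  "hermitian K \<longleftrightarrow> (\<forall>x y z. K (x + y) z = K x z + K y z) \<and> (\<forall>c x z. K (c *s x) z = c * K x z)
     \<and> (\<forall>x y. K y x = cnj (K x y))"

definition orthog :: "('b \<Rightarrow> 'b \<Rightarrow> complex) \<Rightarrow> 'b set \<Rightarrow> bool" where
  "orthog K A \<longleftrightarrow> (\<forall>a\<in>A. \<forall>b\<in>A. a \<noteq> b \<longrightarrow> K a b = 0)"

context
  fixes K assumes K: "hermitian K"
begin

lemma herm_add: "K (x + y) z = K x z + K y z"
  and herm_scale: "K (c *s x) z = c * K x z"
  and herm_cnj: "cnj (K x y) = K y x"
  using K unfolding hermitian_def by metis+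

lemma herm_add_right: "K z (x + y) = K z x + K z y"
  by (metis herm_add herm_cnj complex_cnj_add)

lemma herm_scale_right: "K z (c *s x) = cnj c * K z x"
  by (metis herm_scale herm_cnj complex_cnj_mult)

lemma herm_zero [simp]: "K 0 x = 0" "K x 0 = 0"
  using herm_scale[of 0 0 x] herm_scale_right[of x 0 0] by simp_all

lemma herm_uminus: "K (- x) z = - K x z"
  by (metis add.right_inverse eq_neg_iff_add_eq_0 herm_add herm_zero(1) add.commute)

lemma herm_diff: "K (x - y) z = K x z - K y z"
  by (metis herm_add herm_uminus diff_conv_add_uminus)

lemma herm_eq_0_commute: "K x y = 0 \<longleftrightarrow> K y x = 0"
  by (metis herm_cnj complex_cnj_zero)

lemma herm_self_real: "K x x = of_real (Re (K x x))"
  by (metis herm_cnj Reals_cnj_iff of_real_Re)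

lemma herm_sum: "K (\<Sum>i\<in>I. c i *s v i) x = (\<Sum>i\<in>I. c i * K (v i) x)"
  by (induction I rule: infinite_finite_induct) (simp_all add: herm_add herm_scale)

lemma herm_sum_right: "K x (\<Sum>i\<in>I. c i *s v i) = (\<Sum>i\<in>I. cnj (c i) * K x (v i))"
  by (induction I rule: infinite_finite_induct) (simp_all add: herm_add_right herm_scale_right)

lemma herm_span_zero: "K x z = 0" if "\<And>a. a \<in> A \<Longrightarrow> K a z = 0" "x \<in> span A"
  using that(2) by (induction rule: span_induct_alt) (simp_all add: that herm_add herm_scale)

lemma orthog_coeff:
  assumes "finite A" "orthog K A" "a \<in> A"
  shows "K (\<Sum>i\<in>A. c i *s i) a = c a * K a a"
proof -
  have "K (\<Sum>i\<in>A. c i *s i) a = (\<Sum>i\<in>A. if i = a then c a * K a a else 0)"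
    unfolding herm_sum using assms by (intro sum.cong) (auto simp: orthog_def)
  then show ?thesis using assms by simp
qed

lemma orthog_square:
  assumes "finite A" "orthog K A"
  shows "Re (K (\<Sum>i\<in>A. c i *s i) (\<Sum>i\<in>A. c i *s i)) = (\<Sum>i\<in>A. (cmod (c i))\<^sup>2 * Re (K i i))"
proof -
  have "K (\<Sum>i\<in>A. c i *s i) (\<Sum>i\<in>A. c i *s i) = (\<Sum>i\<in>A. of_real ((cmod (c i))\<^sup>2) * K i i)"
    unfolding herm_sum_right[of "\<Sum>i\<in>A. c i *s i"]
    by (intro sum.cong refl) (simp add: orthog_coeff[OF assms] complex_norm_square mult_ac del: of_real_power)
  then show ?thesis by simp
qed

text \<open>One Gram-Schmidt step. Each coefficient divides by \<open>K i i\<close>, so for an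
  indefinite form it suffices that no member of \<open>A\<close> is isotropic.\<close>

lemma orthog_project:
  assumes A: "finite A" "orthog K A" "\<And>a. a \<in> A \<Longrightarrow> K a a \<noteq> 0"
  obtains u where "u \<in> span A" "\<And>a. a \<in> A \<Longrightarrow> K (v - u) a = 0"
proof
  let ?u = "\<Sum>i\<in>A. (K v i / K i i) *s i"
  show "?u \<in> span A" by (intro span_sum span_scale span_base)
  show "K (v - ?u) a = 0" if "a \<in> A" for a
    using orthog_coeff[OF A(1,2) that, of "\<lambda>i. K v i / K i i"] A(3)[OF that] by (simp add: herm_diff)
qed

lemma orthog_span_eq_0:
  assumes A: "finite A" "orthog K A" "\<And>a. a \<in> A \<Longrightarrow> K a a \<noteq> 0"
    and u: "u \<in> span A" "\<And>a. a \<in> A \<Longrightarrow> K u a = 0"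
  shows "u = 0"
proof -
  obtain c where c: "u = (\<Sum>i\<in>A. c i *s i)" using u(1) span_finite[OF A(1)] by auto
  have "c a = 0" if "a \<in> A" for a
    using orthog_coeff[OF A(1,2) that, of c] u(2)[OF that] A(3)[OF that] c by simp
  then show ?thesis unfolding c by (intro sum.neutral) simp
qed

end

lemma hermitian_diff_scale:
  assumes K: "hermitian K" and H: "hermitian H"
  shows "hermitian (\<lambda>x y. K x y - complex_of_real r * H x y)"
  unfolding hermitian_def
proof (intro conjI allI)
  fix x y z c
  show "K (x + y) z - of_real r * H (x + y) z = K x z - of_real r * H x z + (K y z - of_real r * H y z)"
    by (simp add: herm_add[OF K] herm_add[OF H] algebra_simps)
  show "K (c *s x) z - of_real r * H (c *s x) z = c * (K x z - of_real r * H x z)"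
    by (simp add: herm_scale[OF K] herm_scale[OF H] algebra_simps)
  show "K y x - of_real r * H y x = cnj (K x y - of_real r * H x y)"
    by (simp add: herm_cnj[OF K] herm_cnj[OF H])
qed

lemma hermitian_uminus:
  assumes K: "hermitian K"
  shows "hermitian (\<lambda>x y. - K x y)"
  unfolding hermitian_def
  by (simp add: herm_add[OF K] herm_scale[OF K] herm_cnj[OF K])

lemma independent_Un_disjoint_span:
  assumes "finite A" "finite D" "independent A" "independent D" "span A \<inter> span D \<subseteq> {0}"
  shows "independent (A \<union> D)" "A \<inter> D = {}"
proof -
  have "x = 0" if "x \<in> A" "x \<in> D" for x
    using assms(5) that span_base[of x] by blast
  then show dj: "A \<inter> D = {}"
    using assms(3) dependent_zero by blast
  show "independent (A \<union> D)"
  proof (rule independent_if_scalars_zero)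
    show "finite (A \<union> D)" using assms by simp
    fix f x assume f: "(\<Sum>x\<in>A \<union> D. f x *s x) = 0" and x: "x \<in> A \<union> D"
    have 0: "(\<Sum>x\<in>A. f x *s x) + (\<Sum>x\<in>D. f x *s x) = 0"
      using f dj assms(1,2) by (simp add: sum.union_disjoint)
    have "(\<Sum>x\<in>A. f x *s x) = - (\<Sum>x\<in>D. f x *s x)" using 0 by (simp add: eq_neg_iff_add_eq_0)
    moreover have "(\<Sum>x\<in>A. f x *s x) \<in> span A" by (intro span_sum span_scale span_base)
    moreover have "- (\<Sum>x\<in>D. f x *s x) \<in> span D" by (intro span_neg span_sum span_scale span_base)
    ultimately have "(\<Sum>x\<in>A. f x *s x) = 0" using assms(5) by auto
    with 0 have "(\<Sum>x\<in>A. f x *s x) = 0" "(\<Sum>x\<in>D. f x *s x) = 0" by simp_all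
    then show "f x = 0"
      using x assms(1-4) independentD by blast
  qed
qed

text \<open>\<open>D\<close> may consist of isotropic vectors, for instance of vectors in the kernel
  of the weight form when \<open>A\<close> is a set of eigenvectors. A vector in both spans is
  orthogonal to all of \<open>A\<close>, hence 0.\<close>

lemma orthog_independent_Un:
  assumes K: "hermitian K"
    and A: "finite A" "orthog K A" "\<And>a. a \<in> A \<Longrightarrow> K a a \<noteq> 0"
    and D: "finite D" "independent D" "\<And>a d. a \<in> A \<Longrightarrow> d \<in> D \<Longrightarrow> K d a = 0"
  shows "independent (A \<union> D)" "A \<inter> D = {}"
proof -
  have "independent A"
  proof (rule independent_if_scalars_zero[OF A(1)])
    fix f x assume "(\<Sum>x\<in>A. f x *s x) = 0" "x \<in> A"
    then show "f x = 0" using orthog_coeff[OF K A(1,2), of x f] A(3) K by (simp add: herm_zero)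
  qed
  moreover have "span A \<inter> span D \<subseteq> {0}"
    using orthog_span_eq_0[OF K A] herm_span_zero[OF K D(3)] by blast
  ultimately show "independent (A \<union> D)" "A \<inter> D = {}"
    using independent_Un_disjoint_span[OF A(1) D(1)] D(2) by blast+
qed

lemmas orthog_independent =
  orthog_independent_Un(1)[where D = "{}", simplified independent_empty finite.emptyI Un_empty_right, simplified]

text \<open>The vector \<open>x + y\<close> shows that \<open>K x y + K y x\<close> vanishes, and
  \<open>x + \<i> *s y\<close> that the two summands are equal.\<close>

lemma isotropic_polarization:
  assumes K: "hermitian K" and V: "subspace V" and 0: "\<And>v. v \<in> V \<Longrightarrow> K v v = 0"
    and xy: "x \<in> V" "y \<in> V"
  shows "K x y = 0"
proof -
  have "K (x + y) (x + y) = 0" "K (x + \<i> *s y) (x + \<i> *s y) = 0"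
    using V xy by (auto intro!: 0 simp: subspace_def)
  then have "K x y + K y x = 0" "\<i> * K y x - \<i> * K x y = 0"
    using 0 xy by (simp_all add: herm_add[OF K] herm_add_right[OF K] herm_scale[OF K] herm_scale_right[OF K])
  then show ?thesis by (simp add: algebra_simps)
qed

text \<open>Take an orthogonal set of non-isotropic vectors of maximal size: the form vanishes
  identically on its orthogonal complement.\<close>

lemma orthogonal_decomposition:
  assumes K: "hermitian K" and V: "subspace V" "finite T" "V \<subseteq> span T"
  obtains A C where "finite A" "finite C" "V = span (A \<union> C)" "independent (A \<union> C)" "A \<inter> C = {}"
    "orthog K A" "\<forall>a\<in>A. K a a \<noteq> 0" "\<forall>c\<in>C. \<forall>v\<in>V. K c v = 0"
proof -
  let ?P = "\<lambda>A. finite A \<and> A \<subseteq> V \<and> orthog K A \<and> (\<forall>a\<in>A. K a a \<noteq> 0)"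
  have bound: "card A \<le> card T" if "?P A" for A
    using independent_span_bound[OF V(2), of A] orthog_independent[OF K, of A] V(3) that by auto
  have "?P {}" by (simp add: orthog_def)
  then obtain A where A: "?P A" and max: "\<And>A'. ?P A' \<Longrightarrow> card A' \<le> card A"
    using ex_has_greatest_nat[of ?P "{}" card "Suc (card T)"] bound
    by (auto simp: le_imp_less_Suc)
  define V' where "V' = {v \<in> V. \<forall>a\<in>A. K v a = 0}"
  have V': "subspace V'"
    using V(1) unfolding V'_def subspace_def
    by (auto simp: herm_zero[OF K] herm_add[OF K] herm_scale[OF K])
  \<comment> \<open>A non-isotropic vector orthogonal to \<open>A\<close> could be added to
    \<open>A\<close>, against maximality.\<close>
  have iso: "K v v = 0" if "v \<in> V'" for v
  proof (rule ccontr)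
    assume nz: "K v v \<noteq> 0"
    have v: "v \<in> V" "\<And>a. a \<in> A \<Longrightarrow> K v a = 0" using that by (auto simp: V'_def)
    then have "v \<notin> A" using nz by blast
    moreover have "?P (insert v A)"
      using A v nz herm_eq_0_commute[OF K] by (auto simp: orthog_def)
    ultimately show False using max[of "insert v A"] A by simp
  qed
  obtain C where C: "C \<subseteq> V'" "independent C" "V' \<subseteq> span C"
    using basis_exists by metis
  have finC: "finite C" using independent_span_bound[OF V(2) C(2)] C(1) V(3) by (auto simp: V'_def)
  have indep: "independent (A \<union> C)" "A \<inter> C = {}"
    using orthog_independent_Un[OF K _ _ _ finC C(2), of A] A C(1) by (auto simp: V'_def)
  have decomp: "\<exists>u v'. v = u + v' \<and> u \<in> span A \<and> v' \<in> V'" if v: "v \<in> V" for v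
  proof -
    obtain u where u: "u \<in> span A" "\<And>a. a \<in> A \<Longrightarrow> K (v - u) a = 0"
      using orthog_project[OF K, of A v] A by auto
    have "u \<in> V" using u(1) A V(1) span_minimal by blast
    then have "v - u \<in> V'" using u v V(1) by (auto simp: V'_def subspace_diff)
    then show ?thesis using u(1) by (intro exI[of _ u] exI[of _ "v - u"]) auto
  qed
  have "V = span (A \<union> C)"
  proof
    show "span (A \<union> C) \<subseteq> V" using A C(1) V(1) by (intro span_minimal) (auto simp: V'_def)
    show "V \<subseteq> span (A \<union> C)"
    proof
      fix v assume "v \<in> V"
      then obtain u v' where "v = u + v'" "u \<in> span A" "v' \<in> V'" using decomp by blast
      then show "v \<in> span (A \<union> C)"
        using C(3) span_mono[of A "A \<union> C"] span_mono[of C "A \<union> C"] by (auto intro: span_add)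
    qed
  qed
  moreover have "K c v = 0" if "c \<in> C" "v \<in> V" for c v
  proof -
    obtain u v' where uv: "v = u + v'" "u \<in> span A" "v' \<in> V'" using decomp \<open>v \<in> V\<close> by blast
    have "K a c = 0" if "a \<in> A" for a
      using \<open>c \<in> C\<close> that C(1) herm_eq_0_commute[OF K, of a c] by (auto simp: V'_def)
    then have "K u c = 0" by (rule herm_span_zero[OF K _ uv(2)])
    moreover have "K c v' = 0"
      using isotropic_polarization[OF K V' iso] C(1) that(1) uv(3) by blast
    ultimately show ?thesis using uv(1) herm_add_right[OF K] herm_eq_0_commute[OF K] by simp
  qed
  ultimately show ?thesis using that[of A C] A indep finC by auto
qed

text \<open>Under nondegeneracy the radical part \<open>C\<close> of the decomposition could contain
  only 0, which independence forbids.\<close>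

lemma orthogonal_basis:
  assumes K: "hermitian K" and V: "subspace V" "finite T" "V \<subseteq> span T"
    and nondeg: "\<And>v. v \<in> V \<Longrightarrow> (\<And>x. x \<in> V \<Longrightarrow> K v x = 0) \<Longrightarrow> v = 0"
  obtains A where "finite A" "V = span A" "independent A" "orthog K A" "\<forall>a\<in>A. K a a \<noteq> 0"
proof -
  obtain A C where AC: "finite A" "finite C" "V = span (A \<union> C)" "independent (A \<union> C)"
    "orthog K A" "\<And>a. a \<in> A \<Longrightarrow> K a a \<noteq> 0" "\<And>c v. c \<in> C \<Longrightarrow> v \<in> V \<Longrightarrow> K c v = 0"
    using orthogonal_decomposition[OF K V] by metis
  have "c = 0" if "c \<in> C" for c
    using nondeg[of c] AC(3,7) that by (auto intro: span_base)
  then have "C = {}" using AC(4) dependent_zero by blast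
  then show ?thesis using AC that by simp
qed

text \<open>The dimension count of Sylvester's law of inertia: a nonpositive and a positive definite
  subspace meet only in 0.\<close>

lemma definite_disjoint_card:
  assumes "finite A" "independent A" "\<And>v. v \<in> span A \<Longrightarrow> Re (K v v) \<le> 0"
    and "finite P" "independent P" "\<And>v. v \<in> span P \<Longrightarrow> v \<noteq> 0 \<Longrightarrow> Re (K v v) > 0"
    and "finite T" "A \<subseteq> span T" "P \<subseteq> span T"
  shows "card A + card P \<le> card T"
proof -
  have "span A \<inter> span P \<subseteq> {0}" using assms(3,6) by force
  from independent_Un_disjoint_span[OF assms(1,4,2,5) this]
  have "independent (A \<union> P)" "A \<inter> P = {}" .
  then show ?thesis
    using independent_span_bound[OF assms(7), of "A \<union> P"] assms by (simp add: card_Un_disjoint)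
qed

text \<open>The constant \<open>\<kappa>\<close> depends on \<open>K\<close> and \<open>A\<close>
  alone, and \<open>H\<close> enters only through its finitely many entries on \<open>A\<close>.
  Small entries thus make \<open>H\<close> small against \<open>K\<close>, uniformly on the
  span.\<close>

lemma definite_dominates:
  assumes K: "hermitian K" and A: "finite A" "orthog K A" "\<And>a. a \<in> A \<Longrightarrow> Re (K a a) > 0"
  obtains \<kappa> where "\<kappa> > 0"
    "\<And>H v. hermitian H \<Longrightarrow> v \<in> span A \<Longrightarrow>
       \<kappa> * cmod (H v v) \<le> (\<Sum>i\<in>A. \<Sum>j\<in>A. cmod (H i j)) * Re (K v v)"
proof -
  \<comment> \<open>Inserting 1 keeps the minimum defined and positive when \<open>A\<close> is
    empty.\<close>
  define \<kappa> where "\<kappa> = Min (insert 1 ((\<lambda>a. Re (K a a)) ` A))"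
  have \<kappa>: "\<kappa> > 0" "\<And>a. a \<in> A \<Longrightarrow> \<kappa> \<le> Re (K a a)" using A unfolding \<kappa>_def by auto
  have "\<kappa> * cmod (H v v) \<le> (\<Sum>i\<in>A. \<Sum>j\<in>A. cmod (H i j)) * Re (K v v)"
    if H: "hermitian H" and v: "v \<in> span A" for H v
  proof -
    obtain c where c: "v = (\<Sum>i\<in>A. c i *s i)" using v span_finite[OF A(1)] by auto
    define s where "s = (\<Sum>i\<in>A. (cmod (c i))\<^sup>2)"
    have le: "cmod (c i) * cmod (c j) \<le> s" if "i \<in> A" "j \<in> A" for i j
    proof -
      have "(cmod (c k))\<^sup>2 \<le> s" if "k \<in> A" for k
        unfolding s_def using A(1) that by (intro member_le_sum) auto
      then have "(cmod (c i))\<^sup>2 \<le> s" "(cmod (c j))\<^sup>2 \<le> s" using that by auto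
      moreover have "2 * (cmod (c i) * cmod (c j)) \<le> (cmod (c i))\<^sup>2 + (cmod (c j))\<^sup>2"
        using sum_squares_bound[of "cmod (c i)" "cmod (c j)"] by simp
      ultimately show ?thesis by simp
    qed
    have "H v v = (\<Sum>i\<in>A. \<Sum>j\<in>A. c i * cnj (c j) * H i j)"
      unfolding c by (subst herm_sum[OF H]) (simp add: herm_sum_right[OF H] sum_distrib_left mult_ac)
    then have "cmod (H v v) \<le> (\<Sum>i\<in>A. \<Sum>j\<in>A. cmod (c i) * cmod (c j) * cmod (H i j))"
      by (simp only:) (intro order_trans[OF norm_sum] sum_mono, simp add: norm_mult)
    also have "\<dots> \<le> (\<Sum>i\<in>A. \<Sum>j\<in>A. s * cmod (H i j))"
      using le by (intro sum_mono mult_right_mono) auto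
    finally have "\<kappa> * cmod (H v v) \<le> (\<Sum>i\<in>A. \<Sum>j\<in>A. cmod (H i j)) * (\<kappa> * s)"
      using \<kappa>(1) by (simp add: sum_distrib_left[symmetric] mult_ac)
    moreover have "\<kappa> * s \<le> Re (K v v)"
      unfolding c orthog_square[OF K A(1,2)] s_def sum_distrib_left
      using \<kappa>(2) by (intro sum_mono) (metis mult.commute mult_left_mono zero_le_power2)
    ultimately show ?thesis
      by (meson mult_left_mono norm_ge_zero order_trans sum_nonneg)
  qed
  then show ?thesis using that \<kappa>(1) by blast
qed

lemma orthog_pos_span:
  assumes K: "hermitian K" and A: "finite A" "orthog K A" "\<And>a. a \<in> A \<Longrightarrow> Re (K a a) > 0"
    and v: "v \<in> span A" "v \<noteq> 0"
  shows "Re (K v v) > 0"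
proof -
  obtain c where c: "v = (\<Sum>i\<in>A. c i *s i)" using v span_finite[OF A(1)] by auto
  then obtain i where i: "i \<in> A" "c i \<noteq> 0" using v(2) by (force intro: sum.neutral)
  show ?thesis unfolding c orthog_square[OF K A(1,2)]
    using i A(1,3) by (intro sum_pos2[of _ i]) (auto simp: less_imp_le)
qed

text \<open>Positive definiteness on a fixed span is an open condition: entrywise convergence makes
  the difference of the forms eventually smaller than the domination constant. \<open>A\<close> need
  not be orthogonal for the perturbed forms.\<close>

lemma positive_definite_stable:
  assumes K: "hermitian K0" and A: "finite A" "orthog K0 A" "\<And>a. a \<in> A \<Longrightarrow> Re (K0 a a) > 0"
    and herm: "\<And>t. hermitian (K t)"
    and lim: "\<And>x y. x \<in> A \<Longrightarrow> y \<in> A \<Longrightarrow> ((\<lambda>t. K t x y) \<longlongrightarrow> K0 x y) F"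
  shows "\<forall>\<^sub>F t in F. \<forall>v\<in>span A. v \<noteq> 0 \<longrightarrow> Re (K t v v) > 0"
proof -
  obtain \<kappa> where \<kappa>: "\<kappa> > 0" "\<And>H v. hermitian H \<Longrightarrow> v \<in> span A \<Longrightarrow>
       \<kappa> * cmod (H v v) \<le> (\<Sum>i\<in>A. \<Sum>j\<in>A. cmod (H i j)) * Re (K0 v v)"
    using definite_dominates[OF K A] by metis
  define D where "D t x y = K t x y - K0 x y" for t x y
  have hD: "hermitian (D t)" for t
    using hermitian_diff_scale[OF herm[of t] K, of 1] by (simp add: D_def[abs_def])
  have "((\<lambda>t. \<Sum>i\<in>A. \<Sum>j\<in>A. cmod (D t i j)) \<longlongrightarrow> (\<Sum>i\<in>A. \<Sum>j\<in>A. 0)) F"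
    unfolding D_def by (intro tendsto_sum tendsto_norm_zero LIM_zero lim)
  then have "\<forall>\<^sub>F t in F. (\<Sum>i\<in>A. \<Sum>j\<in>A. cmod (D t i j)) < \<kappa>"
    using order_tendstoD(2)[OF _ \<kappa>(1)] by simp
  then show ?thesis
  proof eventually_elim
    fix t assume small: "(\<Sum>i\<in>A. \<Sum>j\<in>A. cmod (D t i j)) < \<kappa>"
    show "\<forall>v\<in>span A. v \<noteq> 0 \<longrightarrow> Re (K t v v) > 0"
    proof (intro ballI impI)
      fix v assume v: "v \<in> span A" "v \<noteq> 0"
      have pos: "Re (K0 v v) > 0" using orthog_pos_span[OF K A v] .
      have "\<kappa> * cmod (D t v v) \<le> (\<Sum>i\<in>A. \<Sum>j\<in>A. cmod (D t i j)) * Re (K0 v v)"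
        using \<kappa>(2)[OF hD v(1)] .
      also have "\<dots> < \<kappa> * Re (K0 v v)" using small pos by simp
      finally have "cmod (D t v v) < Re (K0 v v)" using \<kappa>(1) by simp
      then show "Re (K t v v) > 0"
        using abs_Re_le_cmod[of "D t v v"] by (simp add: D_def)
    qed
  qed
qed

text \<open>The infimum of the Rayleigh quotient \<open>B v v / G v v\<close> is attained: otherwise \<open>B - \<mu> G\<close>
  would be positive definite at the infimum \<open>\<mu>\<close> and hence dominate \<open>G\<close>.\<close>

lemma rayleigh_minimizer:
  assumes B: "hermitian B" and G: "hermitian G"
    and A: "finite A" "orthog G A" "\<And>a. a \<in> A \<Longrightarrow> Re (G a a) > 0" "A \<noteq> {}"
  obtains y \<mu> where "y \<in> span A" "y \<noteq> 0" "\<And>x. x \<in> span A \<Longrightarrow> B y x = complex_of_real \<mu> * G y x"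
proof -
  have pos: "Re (G v v) > 0" if "v \<in> span A" "v \<noteq> 0" for v
    using orthog_pos_span[OF G A(1-3) that] .
  have A0: "0 \<notin> A" using A(3) herm_zero[OF G] by force
  define R where "R = {Re (B v v) / Re (G v v) |v. v \<in> span A \<and> v \<noteq> 0}"
  have R0: "R \<noteq> {}" using A(4) A0 by (auto simp: R_def intro: span_base)
  obtain \<kappa> where \<kappa>: "\<kappa> > 0" "\<And>H v. hermitian H \<Longrightarrow> v \<in> span A \<Longrightarrow>
       \<kappa> * cmod (H v v) \<le> (\<Sum>i\<in>A. \<Sum>j\<in>A. cmod (H i j)) * Re (G v v)"
    using definite_dominates[OF G A(1-3)] by metis
  \<comment> \<open>A lower bound for all Rayleigh quotients, from the domination of
    \<open>B\<close> by \<open>G\<close>; it makes the infimum meaningful.\<close>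
  define L where "L = - (\<Sum>i\<in>A. \<Sum>j\<in>A. cmod (B i j)) / \<kappa>"
  have "L \<le> r" if r: "r \<in> R" for r
  proof -
    obtain v where v: "v \<in> span A" "v \<noteq> 0" "r = Re (B v v) / Re (G v v)"
      using r unfolding R_def by blast
    have "\<kappa> * (- Re (B v v)) \<le> \<kappa> * cmod (B v v)"
      using \<kappa>(1) abs_Re_le_cmod[of "B v v"] by (intro mult_left_mono) auto
    also have "\<dots> \<le> (\<Sum>i\<in>A. \<Sum>j\<in>A. cmod (B i j)) * Re (G v v)" using \<kappa>(2)[OF B v(1)] .
    finally show ?thesis using pos[OF v(1,2)] \<kappa>(1) unfolding v(3) L_def by (simp add: field_simps)
  qed
  then have bdd: "bdd_below R" by (rule bdd_belowI)
  define \<mu> where "\<mu> = Inf R"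
  define K where "K x y = B x y - complex_of_real \<mu> * G x y" for x y
  have K: "hermitian K" using hermitian_diff_scale[OF B G] by (simp add: K_def[abs_def])
  have psd: "Re (K v v) \<ge> 0" if "v \<in> span A" for v
  proof (cases "v = 0")
    case False
    then have "\<mu> \<le> Re (B v v) / Re (G v v)" unfolding \<mu>_def using that bdd
      by (intro cInf_lower) (auto simp: R_def)
    then show ?thesis using pos[OF that False] by (simp add: K_def field_simps)
  qed (simp add: herm_zero[OF K])
  obtain A' C where AC: "finite A'" "finite C" "span A = span (A' \<union> C)" "independent (A' \<union> C)"
    "orthog K A'" "\<And>a. a \<in> A' \<Longrightarrow> K a a \<noteq> 0" "\<And>c v. c \<in> C \<Longrightarrow> v \<in> span A \<Longrightarrow> K c v = 0"
    using orthogonal_decomposition[OF K subspace_span A(1) order_refl] by metis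
  \<comment> \<open>\<open>C\<close> spans the radical of \<open>K\<close>. Were it empty,
    \<open>K\<close> would be definite and dominate \<open>G\<close> in turn, and all quotients
    would stay above \<open>\<mu>\<close> by at least \<open>\<kappa> / s\<close>.\<close>
  have "C \<noteq> {}"
  proof
    assume "C = {}"
    then have sp: "span A = span A'" using AC(3) by simp
    have A': "Re (K a a) > 0" if "a \<in> A'" for a
      using psd[of a] AC(6)[OF that] herm_self_real[OF K, of a] that sp
      by (metis less_eq_real_def of_real_0 span_base)
    obtain \<kappa> where \<kappa>: "\<kappa> > 0" "\<And>H v. hermitian H \<Longrightarrow> v \<in> span A' \<Longrightarrow>
       \<kappa> * cmod (H v v) \<le> (\<Sum>i\<in>A'. \<Sum>j\<in>A'. cmod (H i j)) * Re (K v v)"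
      using definite_dominates[OF K AC(1,5) A'] by metis
    \<comment> \<open>Adding 1 makes \<open>s\<close> positive without any knowledge of the entries
      of \<open>G\<close>.\<close>
    define s where "s = (\<Sum>i\<in>A'. \<Sum>j\<in>A'. cmod (G i j)) + 1"
    have s: "s > 0" unfolding s_def by (intro add_nonneg_pos sum_nonneg) auto
    have "\<mu> + \<kappa> / s \<le> r" if r: "r \<in> R" for r
    proof -
      obtain v where v: "v \<in> span A" "v \<noteq> 0" "r = Re (B v v) / Re (G v v)"
      using r unfolding R_def by blast
      have "\<kappa> * Re (G v v) \<le> \<kappa> * cmod (G v v)" using \<kappa>(1) by (simp add: complex_Re_le_cmod)
      also have "\<dots> \<le> (\<Sum>i\<in>A'. \<Sum>j\<in>A'. cmod (G i j)) * Re (K v v)" using \<kappa>(2)[OF G] v(1) sp by simp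
      also have "\<dots> \<le> s * Re (K v v)" using psd[OF v(1)] unfolding s_def by (intro mult_right_mono) auto
      finally have "\<kappa> * Re (G v v) \<le> s * Re (B v v) - s * \<mu> * Re (G v v)" by (simp add: K_def algebra_simps)
      then show ?thesis using s pos[OF v(1,2)] unfolding v(3) by (simp add: field_simps)
    qed
    then have "\<mu> + \<kappa> / s \<le> \<mu>" unfolding \<mu>_def using R0 by (intro cInf_greatest)
    then show False using divide_pos_pos[OF \<kappa>(1) s] by simp
  qed
  then obtain y where y: "y \<in> C" by blast
  have "y \<noteq> 0" using y AC(4) dependent_zero by blast
  moreover have "y \<in> span A" using y AC(3) by (simp add: span_base)
  moreover have "B y x = of_real \<mu> * G y x" if "x \<in> span A" for x
    using AC(7)[OF y that] by (simp add: K_def)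
  ultimately show ?thesis using that by blast
qed

end


section \<open>The Hermitian pencil of a problem\<close>

global_interpretation seq: complex_vector_space "\<lambda>(c::complex) (y::nat \<Rightarrow> complex). (\<lambda>k. c * y k)"
  by unfold_locales

definition tail_flux :: "nat \<Rightarrow> equation \<Rightarrow> (nat \<Rightarrow> complex) \<Rightarrow> complex" where
  "tail_flux N \<omega> y = of_real (f_of \<omega> N) * fdiff y N"

definition residual :: "equation \<Rightarrow> complex \<Rightarrow> (nat \<Rightarrow> complex) \<Rightarrow> nat \<Rightarrow> complex" where
  "residual \<omega> \<mu> y n = - bdiff (\<lambda>k. of_real (f_of \<omega> k) * fdiff y k) n + of_real (q_of \<omega> n) * y n
     - \<mu> * of_real (w_of \<omega> n) * y n"

definition bc_row1 :: "nat \<Rightarrow> equation \<Rightarrow> real \<Rightarrow> complex \<Rightarrow> (nat \<Rightarrow> complex) \<Rightarrow> complex" where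
  "bc_row1 N \<omega> a z y = of_real a * y 0 - of_real (f_of \<omega> 0) * fdiff y 0 + cnj z * tail_flux N \<omega> y"

definition bc_row2 :: "nat \<Rightarrow> equation \<Rightarrow> complex \<Rightarrow> real \<Rightarrow> (nat \<Rightarrow> complex) \<Rightarrow> complex" where
  "bc_row2 N \<omega> z b y = z * y 0 - y N + of_real b * tail_flux N \<omega> y"

text \<open>Pair the equation with \<open>cnj x\<close>, sum by parts, and trade the end terms for
  the rows of the boundary matrix. Test sequences are unconstrained, so both boundary rows arise as
  natural conditions. The summand n = 0 contributes the f_0 in s = a + f_0.\<close>

definition bform ::
  "nat \<Rightarrow> equation \<Rightarrow> real \<Rightarrow> complex \<Rightarrow> real \<Rightarrow> (nat \<Rightarrow> complex) \<Rightarrow> (nat \<Rightarrow> complex) \<Rightarrow> complex" where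
  "bform N \<omega> a z b y x =
     (\<Sum>n<N. of_real (f_of \<omega> n) * fdiff y n * cnj (fdiff x n))
     + (\<Sum>n=1..N. of_real (q_of \<omega> n) * y n * cnj (x n))
     + of_real a * y 0 * cnj (x 0) + of_real b * tail_flux N \<omega> y * cnj (tail_flux N \<omega> x)
     + cnj z * tail_flux N \<omega> y * cnj (x 0) + z * y 0 * cnj (tail_flux N \<omega> x)
     - tail_flux N \<omega> y * cnj (x N) - y N * cnj (tail_flux N \<omega> x)"

definition gform :: "nat \<Rightarrow> equation \<Rightarrow> (nat \<Rightarrow> complex) \<Rightarrow> (nat \<Rightarrow> complex) \<Rightarrow> complex" where
  "gform N \<omega> y x = (\<Sum>n=1..N. of_real (w_of \<omega> n) * y n * cnj (x n))"

definition seqs :: "nat \<Rightarrow> (nat \<Rightarrow> complex) set" where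
  "seqs N = {y. \<forall>k>N+1. y k = 0}"

lemma fdiff_add [simp]: "fdiff (x + y) n = fdiff x n + fdiff y n"
  and fdiff_scale [simp]: "fdiff (\<lambda>k. c * x k) n = c * fdiff x n"
  by (simp_all add: fdiff_def algebra_simps)

lemma tail_flux_add [simp]: "tail_flux N \<omega> (x + y) = tail_flux N \<omega> x + tail_flux N \<omega> y"
  and tail_flux_scale [simp]: "tail_flux N \<omega> (\<lambda>k. c * x k) = c * tail_flux N \<omega> x"
  by (simp_all add: tail_flux_def algebra_simps)

lemma residual_add: "residual \<omega> \<mu> (x + y) n = residual \<omega> \<mu> x n + residual \<omega> \<mu> y n"
  by (simp add: residual_def bdiff_def algebra_simps)

lemma bc_row_add:
  "bc_row1 N \<omega> a z (x + y) = bc_row1 N \<omega> a z x + bc_row1 N \<omega> a z y"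
  "bc_row2 N \<omega> z b (x + y) = bc_row2 N \<omega> z b x + bc_row2 N \<omega> z b y"
  by (simp_all add: bc_row1_def bc_row2_def algebra_simps)

lemma bc_row_scale:
  "bc_row1 N \<omega> a z (\<lambda>k. c * x k) = c * bc_row1 N \<omega> a z x"
  "bc_row2 N \<omega> z b (\<lambda>k. c * x k) = c * bc_row2 N \<omega> z b x"
  by (simp_all add: bc_row1_def bc_row2_def algebra_simps)

lemma bform_hermitian: "seq.hermitian (bform N \<omega> a z b)"
  unfolding seq.hermitian_def
proof (intro conjI allI)
  fix x y t :: "nat \<Rightarrow> complex" and c :: complex
  show "bform N \<omega> a z b (x + y) t = bform N \<omega> a z b x t + bform N \<omega> a z b y t"
    by (simp add: bform_def algebra_simps sum.distrib)
  show "bform N \<omega> a z b (\<lambda>k. c * x k) t = c * bform N \<omega> a z b x t"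
    by (simp add: bform_def algebra_simps sum_distrib_left)
  show "bform N \<omega> a z b y x = cnj (bform N \<omega> a z b x y)"
    by (simp add: bform_def algebra_simps)
qed

lemma gform_hermitian: "seq.hermitian (gform N \<omega>)"
  unfolding seq.hermitian_def
proof (intro conjI allI)
  fix x y t :: "nat \<Rightarrow> complex" and c :: complex
  show "gform N \<omega> (x + y) t = gform N \<omega> x t + gform N \<omega> y t"
    by (simp add: gform_def algebra_simps sum.distrib)
  show "gform N \<omega> (\<lambda>k. c * x k) t = c * gform N \<omega> x t"
    by (simp add: gform_def algebra_simps sum_distrib_left)
  show "gform N \<omega> y x = cnj (gform N \<omega> x y)"
    by (simp add: gform_def algebra_simps)
qed

lemma gform_zero:
  assumes "\<And>n. n \<in> {1..N} \<Longrightarrow> y n = 0"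
  shows "gform N \<omega> y x = 0" "gform N \<omega> x y = 0"
  using assms by (simp_all add: gform_def)

lemma summation_by_parts:
  fixes F x :: "nat \<Rightarrow> complex"
  shows "(\<Sum>n=1..N. - bdiff F n * cnj (x n))
    = (\<Sum>n<N. F n * cnj (fdiff x n)) + F 0 * cnj (x 0) - F N * cnj (x N)"
  by (induction N) (simp_all add: bdiff_def fdiff_def algebra_simps)

text \<open>For an admissible equation the entries \<open>x 0\<close>, ..., \<open>x N\<close> and
  the flux of \<open>x\<close> can be prescribed independently. Vanishing for all \<open>x\<close>
  therefore splits into the equation and the two boundary rows.\<close>

lemma green_identity:
  "bform N \<omega> a z b y x - \<mu> * gform N \<omega> y x
    = (\<Sum>n=1..N. residual \<omega> \<mu> y n * cnj (x n))
      + bc_row1 N \<omega> a z y * cnj (x 0) + bc_row2 N \<omega> z b y * cnj (tail_flux N \<omega> x)"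
proof -
  let ?F = "\<lambda>k. of_real (f_of \<omega> k) * fdiff y k"
  have "(\<Sum>n=1..N. residual \<omega> \<mu> y n * cnj (x n))
      = (\<Sum>n=1..N. - bdiff ?F n * cnj (x n)) + (\<Sum>n=1..N. of_real (q_of \<omega> n) * y n * cnj (x n))
        - \<mu> * gform N \<omega> y x"
    unfolding residual_def gform_def sum_distrib_left sum.distrib[symmetric] sum_subtractf[symmetric]
    by (intro sum.cong refl) (simp add: algebra_simps)
  then show ?thesis
    unfolding summation_by_parts
    by (simp add: bform_def bc_row1_def bc_row2_def tail_flux_def algebra_simps)
qed

section \<open>The boundary condition on the chart, and a basis of the sequences\<close>

lemma bc_class_self: "M \<in> bc_class M"
  unfolding bc_class_def by (auto intro!: exI[of _ "mat 1"] simp: invertible_def)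

lemma block_mult:
  "Ablock (T ** M) = T ** Ablock M" "Bblock (T ** M) = T ** Bblock M"
  by (simp_all add: Ablock_def Bblock_def vec_eq_iff matrix_matrix_mult_def forall_2)

lemma satisfies_bc_class:
  "satisfies_bc N \<omega> (bc_class M) y \<longleftrightarrow>
     Ablock M *v vector [y 0, of_real (f_of \<omega> 0) * fdiff y 0] +
     Bblock M *v vector [y N, of_real (f_of \<omega> N) * fdiff y N] = 0" (is "_ \<longleftrightarrow> ?L M = 0")
proof -
  have "?L (T ** M) = T *v ?L M" for T
    by (simp add: block_mult matrix_vector_mul_assoc[symmetric] matrix_vector_right_distrib)
  then have "?L M' = 0" if "?L M = 0" "M' \<in> bc_class M" for M'
    using that by (auto simp: bc_class_def)
  then show ?thesis
    unfolding satisfies_bc_def using bc_class_self by blast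
qed

lemma chart_mat_nth [simp]:
  "chart_mat a z b $ 1 $ 1 = of_real a" "chart_mat a z b $ 1 $ 2 = -1"
  "chart_mat a z b $ 1 $ 3 = 0" "chart_mat a z b $ 1 $ 4 = cnj z"
  "chart_mat a z b $ 2 $ 1 = z" "chart_mat a z b $ 2 $ 2 = 0"
  "chart_mat a z b $ 2 $ 3 = -1" "chart_mat a z b $ 2 $ 4 = of_real b"
  by (simp_all add: chart_mat_def vector_def)

lemma sol_space_chart:
  "y \<in> sol_space N (\<omega>, bc_class (chart_mat a z b)) \<mu> \<longleftrightarrow>
     y \<in> seqs N \<and> (\<forall>n\<in>{1..N}. residual \<omega> \<mu> y n = 0) \<and> bc_row1 N \<omega> a z y = 0 \<and> bc_row2 N \<omega> z b y = 0"
proof -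
  have "satisfies_bc N \<omega> (bc_class (chart_mat a z b)) y \<longleftrightarrow>
    bc_row1 N \<omega> a z y = 0 \<and> bc_row2 N \<omega> z b y = 0"
    unfolding satisfies_bc_class bc_row1_def bc_row2_def tail_flux_def
    by (simp add: vec_eq_iff forall_2 matrix_vector_mult_def sum_2 Ablock_def Bblock_def vector_2 algebra_simps)
  then show ?thesis
    by (auto simp: sol_space_def seqs_def satisfies_eqn_def residual_def)
qed

definition unit_seq :: "nat \<Rightarrow> nat \<Rightarrow> complex" where
  "unit_seq k = (\<lambda>j. if j = k then 1 else 0)"

lemma subspace_seqs: "cseq.subspace (seqs N)"
  by (auto simp: cseq.subspace_def seqs_def)

lemma sum_seq_apply: "(\<Sum>i\<in>I. g i) j = (\<Sum>i\<in>I. g i j)" for g :: "_ \<Rightarrow> nat \<Rightarrow> complex"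
  by (induction I rule: infinite_finite_induct) auto

lemma unit_seq_expansion: "y \<in> seqs N \<Longrightarrow> y = (\<Sum>k\<le>N+1. (\<lambda>j. y k * unit_seq k j))"
  by (auto simp: fun_eq_iff seqs_def unit_seq_def sum_seq_apply if_distrib not_le simp del: sum.atMost_Suc cong: if_cong)

lemma inj_unit_seq: "inj unit_seq"
  by (auto simp: inj_def unit_seq_def fun_eq_iff split: if_splits)

lemma unit_seqs_basis:
  shows "seqs N = cseq.span (unit_seq ` {..N+1})" "cseq.independent (unit_seq ` {..N+1})"
    "card (unit_seq ` {..N+1}) = N + 2"
proof -
  show "card (unit_seq ` {..N+1}) = N + 2"
    using card_image[OF inj_on_subset[OF inj_unit_seq subset_UNIV], of "{..N+1}"] by simp
  show "seqs N = cseq.span (unit_seq ` {..N+1})"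
  proof
    show "seqs N \<subseteq> cseq.span (unit_seq ` {..N+1})"
    proof
      fix y assume "y \<in> seqs N"
      then show "y \<in> cseq.span (unit_seq ` {..N+1})"
        by (subst unit_seq_expansion, assumption)
          (intro cseq.span_sum cseq.span_scale cseq.span_base imageI)
    qed
    show "cseq.span (unit_seq ` {..N+1}) \<subseteq> seqs N"
      by (rule cseq.span_minimal[OF _ subspace_seqs]) (auto simp: seqs_def unit_seq_def)
  qed
  show "cseq.independent (unit_seq ` {..N+1})"
  proof (rule cseq.independent_if_scalars_zero)
    fix f x assume s: "(\<Sum>x\<in>unit_seq ` {..N+1}. (\<lambda>k. f x * x k)) = 0" and x: "x \<in> unit_seq ` {..N+1}"
    then obtain k where k: "k \<le> N+1" "x = unit_seq k" by auto
    have "0 = (\<Sum>i\<le>N+1. (\<lambda>k. f (unit_seq i) * unit_seq i k)) k"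
      using s by (subst (asm) sum.reindex) (auto intro: inj_on_subset[OF inj_unit_seq])
    also have "\<dots> = f x" using k by (simp add: sum_seq_apply unit_seq_def if_distrib del: sum.atMost_Suc cong: if_cong)
    finally show "f x = 0" by simp
  qed simp
qed

section \<open>Eigenvalues and eigenvectors of a single problem\<close>

locale sl_problem =
  fixes N :: nat and \<omega> :: equation and a :: real and z :: complex and b :: real
  assumes N: "2 \<le> N" and \<omega>: "\<omega> \<in> Omega N"
begin

abbreviation "B \<equiv> bform N \<omega> a z b"
abbreviation "G \<equiv> gform N \<omega>"
abbreviation "prob \<equiv> (\<omega>, bc_class (chart_mat a z b))"

lemma f_nonzero: "n \<le> N \<Longrightarrow> f_of \<omega> n \<noteq> 0"
  using \<omega> by (auto simp: Omega_def f_of_def)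

lemma w_pos: "n \<in> {1..N} \<Longrightarrow> w_of \<omega> n > 0"
  using \<omega> by (auto simp: Omega_def w_of_def)

lemma gform_self: "Re (G y y) = (\<Sum>n=1..N. w_of \<omega> n * (cmod (y n))\<^sup>2)"
proof -
  have "G y y = (\<Sum>n=1..N. of_real (w_of \<omega> n * (cmod (y n))\<^sup>2))"
    unfolding gform_def
    by (intro sum.cong refl) (simp add: complex_norm_square mult.assoc del: of_real_power)
  then show ?thesis by simp
qed

lemma gform_nonneg: "Re (G y y) \<ge> 0"
  unfolding gform_self using w_pos by (intro sum_nonneg mult_nonneg_nonneg) (auto simp: less_imp_le)

lemma gform_zeroD: "G y y = 0 \<Longrightarrow> n \<in> {1..N} \<Longrightarrow> y n = 0"
proof -
  assume "G y y = 0" and n: "n \<in> {1..N}"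
  then have "(\<Sum>n=1..N. w_of \<omega> n * (cmod (y n))\<^sup>2) = 0" using gform_self[of y] by simp
  then have "w_of \<omega> n * (cmod (y n))\<^sup>2 = 0" using n w_pos
    by (subst (asm) sum_nonneg_eq_0_iff) (auto simp: less_imp_le)
  then show "y n = 0" using w_pos[OF n] by simp
qed

lemma gform_pos: "G y y \<noteq> 0 \<Longrightarrow> Re (G y y) > 0"
  using gform_nonneg[of y] seq.herm_self_real[OF gform_hermitian, of N \<omega> y]
  by (metis less_eq_real_def of_real_0)

lemma sol_spaceI:
  assumes y: "y \<in> seqs N" "\<And>x. x \<in> seqs N \<Longrightarrow> B y x = \<mu> * G y x"
  shows "y \<in> sol_space N prob \<mu>"
proof -
  have eq: "(\<Sum>n=1..N. residual \<omega> \<mu> y n * cnj (x n))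
      + bc_row1 N \<omega> a z y * cnj (x 0) + bc_row2 N \<omega> z b y * cnj (tail_flux N \<omega> x) = 0" if "x \<in> seqs N" for x
    using y(2)[OF that] green_identity[of N \<omega> a z b y x \<mu>] by simp
  have unit: "unit_seq k \<in> seqs N" if "k \<le> N + 1" for k
    using that by (auto simp: seqs_def unit_seq_def)
  \<comment> \<open>The unit sequence at N + 1 vanishes at 0, ..., N, so only the flux term
    survives. This row comes first because the unit sequence at N has a nonzero flux as
    well.\<close>
  have row2: "bc_row2 N \<omega> z b y = 0"
    using eq[OF unit[of "N+1"]] f_nonzero[of N] by (simp add: unit_seq_def tail_flux_def fdiff_def)
  have "bc_row1 N \<omega> a z y = 0"
    using eq[OF unit[of 0]] row2 by (simp add: unit_seq_def)
  moreover have "residual \<omega> \<mu> y n = 0" if "n \<in> {1..N}" for n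
    using eq[OF unit[of n]] row2 that
    by (simp add: unit_seq_def if_distrib cong: if_cong)
  ultimately show ?thesis using y row2 by (simp add: sol_space_chart)
qed

lemma sol_space_form: "y \<in> sol_space N prob \<mu> \<longleftrightarrow> y \<in> seqs N \<and> (\<forall>x. B y x = \<mu> * G y x)"
  using sol_spaceI[of y \<mu>] green_identity[of N \<omega> a z b y _ \<mu>] by (auto simp: sol_space_chart)

lemma subspace_sol_space: "cseq.subspace (sol_space N prob \<mu>)"
  unfolding cseq.subspace_def
  using subspace_seqs[of N]
  by (auto simp: sol_space_form cseq.subspace_def algebra_simps
      seq.herm_zero[OF bform_hermitian] seq.herm_zero[OF gform_hermitian]
      seq.herm_add[OF bform_hermitian] seq.herm_add[OF gform_hermitian]
      seq.herm_scale[OF bform_hermitian] seq.herm_scale[OF gform_hermitian])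

text \<open>Replaces definiteness of the weight form; reality of the eigenvalues rests on it. For a
  sequence that vanishes on 1, ..., N the equations at 1 and at N force the two end values to
  vanish. N >= 2 keeps these equations apart; for N = 1 a single equation would link both end
  values.\<close>

lemma eigenvector_gform:
  assumes y: "y \<in> sol_space N prob \<mu>" "y \<noteq> 0"
  shows "G y y \<noteq> 0"
proof
  assume "G y y = 0"
  then have 0: "y n = 0" if "n \<in> {1..N}" for n using gform_zeroD that by blast
  have y0: "y \<in> seqs N" "\<And>n. n \<in> {1..N} \<Longrightarrow> residual \<omega> \<mu> y n = 0"
    using y(1) by (auto simp: sol_space_chart)
  have y1: "y (Suc 0) = 0" "y (Suc (Suc 0)) = 0" "y N = 0" "y (N - 1) = 0" using 0 N by auto
  have "y 0 = 0"
    using y0(2)[of 1] y1 N f_nonzero[of 0] by (auto simp: residual_def bdiff_def fdiff_def)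
  moreover have "y (N + 1) = 0"
    using y0(2)[of N] y1 N f_nonzero[of N] by (auto simp: residual_def bdiff_def fdiff_def)
  ultimately have "y k = 0" for k
    using 0[of k] y0(1) by (cases "k = 0 \<or> k = N + 1 \<or> k > N + 1") (auto simp: seqs_def)
  then show False using y(2) by auto
qed

lemma eigenvalue_real:
  assumes y: "y \<in> sol_space N prob \<mu>" "y \<noteq> 0"
  shows "\<mu> = of_real (Re \<mu>)"
proof -
  have "B y y = \<mu> * G y y" using y by (simp add: sol_space_form)
  then have "\<mu> = of_real (Re (B y y)) / of_real (Re (G y y))"
    using seq.herm_self_real[OF bform_hermitian] seq.herm_self_real[OF gform_hermitian]
      eigenvector_gform[OF y] by (metis nonzero_eq_divide_eq)
  then show ?thesis by (metis Re_complex_of_real of_real_divide)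
qed

lemma eigenvectors_orthogonal:
  assumes x: "x \<in> sol_space N prob \<mu>" "x \<noteq> 0" and y: "y \<in> sol_space N prob \<nu>" "y \<noteq> 0" and ne: "\<mu> \<noteq> \<nu>"
  shows "G x y = 0"
proof -
  have "cnj \<nu> = \<nu>" using eigenvalue_real[OF y] by (metis complex_cnj_complex_of_real)
  then have "B x y = \<nu> * G x y"
    using y(1) seq.herm_cnj[OF bform_hermitian] seq.herm_cnj[OF gform_hermitian] sol_space_form
    by (metis complex_cnj_mult)
  moreover have "B x y = \<mu> * G x y" using x by (simp add: sol_space_form)
  ultimately show ?thesis using ne by simp
qed

lemma sol_space_orthogonal_basis:
  obtains S where "finite S" "sol_space N prob \<mu> = cseq.span S" "cseq.independent S" "seq.orthog G S"
    "\<And>x. x \<in> S \<Longrightarrow> G x x \<noteq> 0"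
proof (rule seq.orthogonal_basis[OF gform_hermitian subspace_sol_space])
  show "finite (unit_seq ` {..N+1})" by simp
  show "sol_space N prob \<mu> \<subseteq> cseq.span (unit_seq ` {..N+1})"
    unfolding unit_seqs_basis(1)[symmetric] by (auto simp: sol_space_chart)
  show "v = 0" if "v \<in> sol_space N prob \<mu>" "\<And>x. x \<in> sol_space N prob \<mu> \<Longrightarrow> G v x = 0" for v
    using eigenvector_gform that by blast
qed (use that in blast)

lemma orthogonal_card_bound:
  assumes "finite S" "S \<subseteq> seqs N" "seq.orthog G S" "\<And>x. x \<in> S \<Longrightarrow> G x x \<noteq> 0"
  shows "card S \<le> N + 2"
  using cseq.independent_span_bound[of "unit_seq ` {..N+1}" S]
    seq.orthog_independent[OF gform_hermitian assms(1,3,4)] assms(2)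
  unfolding unit_seqs_basis(1)[symmetric] unit_seqs_basis(3) by simp

text \<open>Choosing one eigenvector per eigenvalue is injective with orthogonal image, so any
  finite set of eigenvalues has at most N + 2 members. The exact number needs the inertia
  count.\<close>

lemma finite_eigenvalues: "finite (eigenvalues N prob)"
proof -
  define g where "g \<mu> = (SOME y. y \<in> sol_space N prob \<mu> \<and> y \<noteq> 0)" for \<mu>
  have g: "g \<mu> \<in> sol_space N prob \<mu> \<and> g \<mu> \<noteq> 0" if "\<mu> \<in> eigenvalues N prob" for \<mu>
    using someI_ex[of "\<lambda>y. y \<in> sol_space N prob \<mu> \<and> y \<noteq> 0"] that
    unfolding g_def eigenvalues_def by blast
  have orth: "G (g \<mu>) (g \<nu>) = 0" if "\<mu> \<in> eigenvalues N prob" "\<nu> \<in> eigenvalues N prob" "\<mu> \<noteq> \<nu>" for \<mu> \<nu>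
    using eigenvectors_orthogonal g that by blast
  have inj: "inj_on g (eigenvalues N prob)"
  proof (rule inj_onI, rule ccontr)
    fix \<mu> \<nu> assume h: "\<mu> \<in> eigenvalues N prob" "\<nu> \<in> eigenvalues N prob" "g \<mu> = g \<nu>" "\<mu> \<noteq> \<nu>"
    then have "G (g \<nu>) (g \<nu>) = 0" using orth[of \<mu> \<nu>] by simp
    then show False using eigenvector_gform g h(2) by blast
  qed
  have "card F \<le> N + 2" if F: "F \<subseteq> eigenvalues N prob" "finite F" for F
  proof -
    have "card (g ` F) \<le> N + 2"
    proof (rule orthogonal_card_bound)
      show "g ` F \<subseteq> seqs N" using g F by (auto simp: sol_space_chart)
      show "seq.orthog G (g ` F)" using orth F by (auto simp: seq.orthog_def)
      show "G x x \<noteq> 0" if "x \<in> g ` F" for x using that g eigenvector_gform F by blast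
    qed (use F in auto)
    then show ?thesis using inj_on_subset[OF inj F(1)] by (simp add: card_image)
  qed
  then show ?thesis using finite_if_finite_subsets_card_bdd by blast
qed

text \<open>Recovers the eigenvalue from an eigenvector, so that the eigenvalue list becomes the
  image of a set of vectors.\<close>

definition rayleigh :: "(nat \<Rightarrow> complex) \<Rightarrow> real" where
  "rayleigh y = Re (B y y) / Re (G y y)"

lemma rayleigh_eq:
  assumes "y \<in> sol_space N prob \<mu>" "y \<noteq> 0"
  shows "\<mu> = of_real (rayleigh y)"
proof -
  have "B y y = of_real (Re \<mu>) * G y y" using assms eigenvalue_real[OF assms] by (simp add: sol_space_form)
  then have "rayleigh y = Re \<mu>" using gform_pos[OF eigenvector_gform[OF assms]] by (simp add: rayleigh_def)
  then show ?thesis using eigenvalue_real[OF assms] by simp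
qed

text \<open>Orthogonal bases of the eigenspaces, united over all eigenvalues. Through the multiset
  equation, counting eigenvalues with multiplicity is counting members of \<open>S\<close>.\<close>

lemma eigenbasis:
  obtains S where "finite S" "S \<subseteq> seqs N" "seq.orthog G S" "\<And>y. y \<in> S \<Longrightarrow> Re (G y y) > 0"
    "\<And>y x. y \<in> S \<Longrightarrow> B y x = of_real (rayleigh y) * G y x"
    "\<And>\<mu>. sol_space N prob \<mu> \<subseteq> cseq.span S"
    "mset (eig_list N prob) = image_mset rayleigh (mset_set S)"
proof -
  let ?E = "eigenvalues N prob"
  have "\<forall>\<mu>. \<exists>S. finite S \<and> sol_space N prob \<mu> = cseq.span S \<and> cseq.independent S \<and> seq.orthog G S
    \<and> (\<forall>x\<in>S. G x x \<noteq> 0)"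
    using sol_space_orthogonal_basis by metis
  then obtain S where S: "\<And>\<mu>. finite (S \<mu>)" "\<And>\<mu>. sol_space N prob \<mu> = cseq.span (S \<mu>)"
      "\<And>\<mu>. cseq.independent (S \<mu>)" "\<And>\<mu>. seq.orthog G (S \<mu>)" "\<And>\<mu> x. x \<in> S \<mu> \<Longrightarrow> G x x \<noteq> 0"
    by metis
  have Ssol: "x \<in> sol_space N prob \<mu>" "x \<noteq> 0" if "x \<in> S \<mu>" for x \<mu>
    using that S(2)[of \<mu>] S(5)[OF that] cseq.span_base[OF that]
    by (auto simp: seq.herm_zero[OF gform_hermitian])
  have disj: "S \<mu> \<inter> S \<nu> = {}" if "\<mu> \<noteq> \<nu>" for \<mu> \<nu>
    using rayleigh_eq Ssol that by blast
  let ?S = "\<Union>\<mu>\<in>?E. S \<mu>"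
  have mset: "image_mset rayleigh (mset_set (\<Union>\<mu>\<in>F. S \<mu>))
      = (\<Sum>\<mu>\<in>F. replicate_mset (multiplicity_of N prob \<mu>) (Re \<mu>))" if "finite F" for F
    using that
  proof (induction F rule: finite_induct)
    case (insert \<nu> F)
    have "image_mset rayleigh (mset_set (S \<nu>)) = image_mset (\<lambda>_. Re \<nu>) (mset_set (S \<nu>))"
      using S(1) rayleigh_eq Ssol by (intro image_mset_cong) (metis Re_complex_of_real elem_mset_set)
    also have "\<dots> = replicate_mset (multiplicity_of N prob \<nu>) (Re \<nu>)"
      using S(1,2,3) by (simp add: image_mset_const_eq multiplicity_of_def cseq.dim_eq_card_independent)
    finally have "image_mset rayleigh (mset_set (S \<nu>)) = replicate_mset (multiplicity_of N prob \<nu>) (Re \<nu>)" .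
    moreover have "S \<nu> \<inter> S \<mu> = {}" if "\<mu> \<in> F" for \<mu>
      using disj[of \<nu> \<mu>] insert.hyps(2) that by metis
    then have "S \<nu> \<inter> (\<Union>\<mu>\<in>F. S \<mu>) = {}" by (simp add: Int_UN_distrib)
    ultimately show ?case
      using insert.hyps(1,2) insert.IH mset_set_Union[of "S \<nu>" "\<Union>\<mu>\<in>F. S \<mu>"] S(1) by simp
  qed simp
  have sub: "sol_space N prob \<mu> \<subseteq> cseq.span ?S" for \<mu>
  proof (cases "\<mu> \<in> ?E")
    case True
    then show ?thesis unfolding S(2) by (intro cseq.span_mono) blast
  next
    case False
    then show ?thesis by (auto simp: eigenvalues_def cseq.span_zero)
  qed
  have orth: "seq.orthog G ?S" unfolding seq.orthog_def
  proof (intro ballI impI)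
    fix x y assume "x \<in> ?S" "y \<in> ?S" and ne: "x \<noteq> y"
    then obtain \<mu> \<nu> where xy: "x \<in> S \<mu>" "y \<in> S \<nu>" by blast
    show "G x y = 0"
    proof (cases "\<mu> = \<nu>")
      case True
      then show ?thesis using S(4)[of \<mu>] xy ne by (auto simp: seq.orthog_def)
    next
      case False
      then show ?thesis using eigenvectors_orthogonal Ssol xy by blast
    qed
  qed
  show ?thesis
  proof (rule that[OF _ _ orth _ _ sub])
    show "finite ?S" using finite_eigenvalues S(1) by blast
    show "?S \<subseteq> seqs N" using Ssol by (auto simp: sol_space_chart)
    show "Re (G y y) > 0" if "y \<in> ?S" for y using that S(5) gform_pos by blast
    show "B y x = of_real (rayleigh y) * G y x" if "y \<in> ?S" for y x
      using that Ssol rayleigh_eq by (metis UN_E sol_space_form)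
    show "mset (eig_list N prob) = image_mset rayleigh (mset_set ?S)"
      by (simp add: eig_list_def mset[OF finite_eigenvalues])
  qed
qed

end

section \<open>The kernel plane of the weight form, and completeness of the eigenvectors\<close>

context sl_problem
begin

text \<open>The sequences on which \<open>G\<close> vanishes, parametrized by \<open>y 0\<close> and the flux at the end. There
  the form \<open>B\<close> has the matrix with rows \<open>(a + f\<^sub>0, cnj z)\<close> and \<open>(z, b)\<close>.\<close>

definition end_seq :: "complex \<Rightarrow> complex \<Rightarrow> nat \<Rightarrow> complex" where
  "end_seq x v = (\<lambda>k. if k = 0 then x else if k = N + 1 then v / of_real (f_of \<omega> N) else 0)"

lemma end_seq_simps [simp]:
  "end_seq x v 0 = x" "n \<in> {1..N} \<Longrightarrow> end_seq x v n = 0" "end_seq x v \<in> seqs N"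
  "tail_flux N \<omega> (end_seq x v) = v"
  using N f_nonzero[of N] by (auto simp: end_seq_def tail_flux_def fdiff_def seqs_def)

lemma end_seq_nonzero: "end_seq x v = 0 \<longleftrightarrow> x = 0 \<and> v = 0"
  using f_nonzero[of N] by (auto simp: end_seq_def fun_eq_iff)

lemma end_seq_zero: "end_seq 0 0 = 0"
  by (simp only: end_seq_nonzero)

lemma end_seq_lincomb:
  "end_seq (c * x) (c * v) = (\<lambda>k. c * end_seq x v k)"
  "end_seq (x + x') (v + v') = end_seq x v + end_seq x' v'"
  by (auto simp: end_seq_def fun_eq_iff add_divide_distrib)

lemma gform_kernel_eq:
  assumes "y \<in> seqs N" "\<And>n. n \<in> {1..N} \<Longrightarrow> y n = 0"
  shows "y = end_seq (y 0) (tail_flux N \<omega> y)"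
proof
  fix k
  show "y k = end_seq (y 0) (tail_flux N \<omega> y) k"
    using assms f_nonzero[of N] N
    by (cases "k = 0 \<or> k = N + 1 \<or> k > N + 1") (auto simp: end_seq_def tail_flux_def fdiff_def seqs_def)
qed

lemma bc_row_end_seq:
  "bc_row1 N \<omega> a z (end_seq x v) = of_real (a + f_of \<omega> 0) * x + cnj z * v"
  "bc_row2 N \<omega> z b (end_seq x v) = z * x + of_real b * v"
  using N by (simp_all add: bc_row1_def bc_row2_def fdiff_def algebra_simps)

text \<open>Against the kernel plane of \<open>gform\<close> only the boundary rows of
  \<open>y\<close> survive. Every \<open>y\<close> that meets the boundary condition is thus
  \<open>bform\<close>-orthogonal to this plane.\<close>

lemma bform_end_seq_right:
  "bform N \<omega> a z b y (end_seq x v) = bc_row1 N \<omega> a z y * cnj x + bc_row2 N \<omega> z b y * cnj v"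
  using green_identity[of N \<omega> a z b y "end_seq x v" 0] by simp

lemma independent_pair: "cseq.independent {end_seq 1 0, end_seq 0 1}" "end_seq 1 0 \<noteq> end_seq 0 1"
proof -
  show ne: "end_seq 1 0 \<noteq> end_seq 0 1"
    using end_seq_simps(1) by (metis zero_neq_one)
  have "end_seq 1 0 \<notin> cseq.span {end_seq 0 1}"
  proof
    assume "end_seq 1 0 \<in> cseq.span {end_seq 0 1}"
    then obtain k where "end_seq 1 0 = (\<lambda>j. k * end_seq 0 1 j)" by (auto simp: cseq.span_singleton)
    then have "end_seq 1 0 0 = k * end_seq 0 1 0" by metis
    then show False by simp
  qed
  then show "cseq.independent {end_seq 1 0, end_seq 0 1}"
    using ne by (simp add: cseq.independent_insert end_seq_nonzero)
qed

lemma end_seq_span: "end_seq x v \<in> cseq.span {end_seq 1 0, end_seq 0 1}"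
proof -
  have "end_seq x v = (\<lambda>k. x * end_seq 1 0 k) + (\<lambda>k. v * end_seq 0 1 k)"
    using end_seq_lincomb(1)[of x 1 0] end_seq_lincomb(1)[of v 0 1] end_seq_lincomb(2)[of x 0 0 v] by simp
  also have "\<dots> \<in> cseq.span {end_seq 1 0, end_seq 0 1}"
    by (intro cseq.span_add cseq.span_scale cseq.span_base) auto
  finally show ?thesis .
qed

lemma subspace_end_seqs: "cseq.subspace {y. \<exists>x v. y = end_seq x v}"
proof (rule cseq.subspaceI)
  show "0 \<in> {y. \<exists>x v. y = end_seq x v}" using end_seq_zero[symmetric] by blast
  fix y y' and c assume "y \<in> {y. \<exists>x v. y = end_seq x v}" "y' \<in> {y. \<exists>x v. y = end_seq x v}"
  then obtain x v x' v' where y: "y = end_seq x v" "y' = end_seq x' v'" by blast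
  show "y + y' \<in> {y. \<exists>x v. y = end_seq x v}" unfolding y end_seq_lincomb(2)[symmetric] by blast
  show "(\<lambda>k. c * y k) \<in> {y. \<exists>x v. y = end_seq x v}" unfolding y end_seq_lincomb(1)[symmetric] by blast
qed

lemma span_end_seq:
  assumes "u \<in> cseq.span D" "\<And>y. y \<in> D \<Longrightarrow> \<exists>x v. y = end_seq x v"
  shows "\<exists>x v. u = end_seq x v"
  using cseq.span_minimal[OF _ subspace_end_seqs, of D] assms by blast

text \<open>If \<open>y\<close> satisfies the weak eigenvalue equation against all test sequences in the domain of the
  boundary condition, its residual lives at \<open>1\<close> and \<open>N\<close> only, and is removed by adding an element of the
  common kernel of both forms on the domain.\<close>

lemma weak_solution_correct:
  assumes y: "y \<in> seqs N" "bc_row1 N \<omega> a z y = 0" "bc_row2 N \<omega> z b y = 0"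
    and weak: "\<And>x. x \<in> seqs N \<Longrightarrow> bc_row1 N \<omega> a z x = 0 \<Longrightarrow> bc_row2 N \<omega> z b x = 0 \<Longrightarrow> B y x = \<mu> * G y x"
  obtains r where "\<And>n. n \<in> {1..N} \<Longrightarrow> r n = 0" "y + r \<in> sol_space N prob \<mu>"
proof -
  let ?c = "residual \<omega> \<mu> y"
  have f0: "complex_of_real (f_of \<omega> 0) \<noteq> 0" "complex_of_real (f_of \<omega> N) \<noteq> 0" using f_nonzero by auto
  have res: "(\<Sum>n=1..N. ?c n * cnj (x n)) = 0"
    if "x \<in> seqs N" "bc_row1 N \<omega> a z x = 0" "bc_row2 N \<omega> z b x = 0" for x
    using green_identity[of N \<omega> a z b y x \<mu>] weak[OF that] y by simp
  \<comment> \<open>The unit sequence at n vanishes at 0, 1, N and N + 1, hence satisfies the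
    boundary condition.\<close>
  have inner: "?c n = 0" if n: "1 < n" "n < N" for n
  proof -
    have "(\<Sum>k=1..N. ?c k * cnj (unit_seq n k)) = 0"
      using n by (intro res) (auto simp: seqs_def unit_seq_def bc_row1_def bc_row2_def tail_flux_def fdiff_def)
    also have "(\<Sum>k=1..N. ?c k * cnj (unit_seq n k)) = ?c n"
      using n by (simp add: unit_seq_def if_distrib cong: if_cong)
    finally show ?thesis .
  qed
  \<comment> \<open>\<open>x\<close> and \<open>v\<close> are the end value and the flux of a test
    sequence, chosen freely; the boundary rows then force its entries at 1 and N.\<close>
  have ends: "?c 1 * cnj ((of_real (a + f_of \<omega> 0) * x + cnj z * v) / of_real (f_of \<omega> 0)) +
      ?c N * cnj (z * x + of_real b * v) = 0" for x v
  proof -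
    define t where "t = (\<lambda>k. if k = 0 then x
      else if k = 1 then (of_real (a + f_of \<omega> 0) * x + cnj z * v) / of_real (f_of \<omega> 0)
      else if k = N then z * x + of_real b * v
      else if k = N + 1 then z * x + of_real b * v + v / of_real (f_of \<omega> N) else 0)"
    have t: "t 0 = x" "t 1 = (of_real (a + f_of \<omega> 0) * x + cnj z * v) / of_real (f_of \<omega> 0)"
      "t N = z * x + of_real b * v" "t (N + 1) = z * x + of_real b * v + v / of_real (f_of \<omega> N)"
      using N by (auto simp: t_def)
    have tf: "tail_flux N \<omega> t = v" using t f0 by (simp add: tail_flux_def fdiff_def)
    have "(\<Sum>k=1..N. ?c k * cnj (t k)) = 0"
    proof (rule res)
      show "t \<in> seqs N" by (auto simp: t_def seqs_def)
      show "bc_row1 N \<omega> a z t = 0" unfolding bc_row1_def tf fdiff_def using t f0 by (simp add: field_simps)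
      show "bc_row2 N \<omega> z b t = 0" unfolding bc_row2_def tf using t by simp
    qed
    also have "(\<Sum>k=1..N. ?c k * cnj (t k)) = (\<Sum>k\<in>{1,N}. ?c k * cnj (t k))"
      using N inner by (intro sum.mono_neutral_right) (auto simp: nat_less_le)
    finally show ?thesis using N t by simp
  qed
  \<comment> \<open>The residual of \<open>r\<close> at 1 and N cancels that of \<open>y\<close>.
    Its coordinates solve the homogeneous 2 x 2 system: this is \<open>ends\<close> at (1, 0) and
    (0, 1), since the matrix is Hermitian.\<close>
  define r where "r = end_seq (?c 1 / of_real (f_of \<omega> 0)) (?c N)"
  have rows: "of_real (a + f_of \<omega> 0) * (?c 1 / of_real (f_of \<omega> 0)) + cnj z * ?c N = 0"
    "z * (?c 1 / of_real (f_of \<omega> 0)) + of_real b * ?c N = 0"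
    using ends[of 1 0] ends[of 0 1] by (simp_all add: mult_ac)
  have r_rows: "bc_row1 N \<omega> a z r = 0" "bc_row2 N \<omega> z b r = 0" and r_seqs: "r \<in> seqs N"
    unfolding r_def bc_row_end_seq using rows by simp_all
  have r: "r 0 = ?c 1 / of_real (f_of \<omega> 0)" "\<And>n. n \<in> {1..N} \<Longrightarrow> r n = 0"
    "r (Suc N) = ?c N / of_real (f_of \<omega> N)"
    by (auto simp: r_def end_seq_def)
  have zero: "residual \<omega> \<mu> (y + r) n = 0" if n: "n \<in> {1..N}" for n
  proof -
    consider "n = 1" | "n = N" "n \<noteq> 1" | "1 < n" "n < N" using n by fastforce
    then have "residual \<omega> \<mu> r n = - ?c n"
    proof cases
      case 1
      then show ?thesis using N f0 r(1) r(2)[of "Suc 0"] r(2)[of "Suc (Suc 0)"]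
        by (simp add: residual_def bdiff_def fdiff_def)
    next
      case 2
      then show ?thesis using N f0 r(3) r(2)[of N] r(2)[of "N - 1"]
        by (simp add: residual_def bdiff_def fdiff_def)
    next
      case 3
      then have "r n = 0" "r (n - 1) = 0" "r (Suc n) = 0" by (auto intro!: r(2))
      then have "residual \<omega> \<mu> r n = 0" using 3 by (simp add: residual_def bdiff_def fdiff_def)
      then show ?thesis using inner[OF 3] by simp
    qed
    then show ?thesis by (simp add: residual_add)
  qed
  have "y + r \<in> sol_space N prob \<mu>"
    using zero y r_rows cseq.subspace_add[OF subspace_seqs y(1) r_seqs]
    by (simp add: sol_space_chart bc_row_add)
  then show ?thesis using that r(2) by blast
qed

text \<open>The boundary condition has codimension at most two: \<open>unit_seq 1\<close> changes
  only the first row, and \<open>unit_seq N + unit_seq (N+1)\<close>, whose flux is 0, only the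
  second.\<close>

lemma seqs_boundary_decomposition:
  assumes "x \<in> seqs N"
  obtains u where "u \<in> seqs N" "bc_row1 N \<omega> a z u = 0" "bc_row2 N \<omega> z b u = 0"
    "x \<in> cseq.span (insert u {unit_seq 1, unit_seq N + unit_seq (N+1)})"
proof -
  let ?e = "unit_seq 1"
  define g where "g = unit_seq N + unit_seq (N+1)"
  define c where "c = bc_row1 N \<omega> a z x / of_real (f_of \<omega> 0)"
  define d where "d = bc_row2 N \<omega> z b x"
  define u where "u = x + ((\<lambda>k. c * ?e k) + (\<lambda>k. d * g k))"
  have e: "bc_row1 N \<omega> a z ?e = - of_real (f_of \<omega> 0)" "bc_row2 N \<omega> z b ?e = 0"
    "bc_row1 N \<omega> a z g = 0" "bc_row2 N \<omega> z b g = -1"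
    using N by (auto simp: g_def bc_row1_def bc_row2_def unit_seq_def tail_flux_def fdiff_def)
  have eg: "?e \<in> seqs N" "g \<in> seqs N" using N by (auto simp: g_def seqs_def unit_seq_def)
  have u: "u \<in> seqs N" unfolding u_def
    by (intro cseq.subspace_add[OF subspace_seqs] cseq.subspace_scale[OF subspace_seqs] assms eg)
  have "bc_row1 N \<omega> a z u = 0" "bc_row2 N \<omega> z b u = 0"
    unfolding u_def bc_row_add bc_row_scale e using f_nonzero[of 0] by (simp_all add: c_def d_def)
  moreover have "x \<in> cseq.span (insert u {?e, g})"
  proof -
    have "x = u + ((\<lambda>k. (- c) * ?e k) + (\<lambda>k. (- d) * g k))" by (auto simp: u_def fun_eq_iff)
    then show ?thesis
      by (metis cseq.span_add cseq.span_base cseq.span_scale insertI1 insertI2)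
  qed
  ultimately show ?thesis using that u unfolding g_def by blast
qed

text \<open>Completeness: on the \<open>G\<close>-orthogonal complement of all eigenvectors inside the domain, a minimizer of
  the Rayleigh quotient would yield a further eigenvector, so this complement lies in the kernel of \<open>G\<close>.\<close>

lemma eigenbasis_complete:
  assumes S: "finite S" "S \<subseteq> seqs N" "seq.orthog G S" "\<And>y. y \<in> S \<Longrightarrow> Re (G y y) > 0"
    "\<And>y x. y \<in> S \<Longrightarrow> B y x = of_real (rayleigh y) * G y x"
    "\<And>\<mu>. sol_space N prob \<mu> \<subseteq> cseq.span S"
    and D: "finite D" "\<And>x v. of_real (a + f_of \<omega> 0) * x + cnj z * v = 0 \<Longrightarrow>
      z * x + of_real b * v = 0 \<Longrightarrow> end_seq x v \<in> cseq.span D"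
  shows "N \<le> card S + card D"
proof -
  \<comment> \<open>\<open>?Z\<close> is the domain of the boundary condition and \<open>?Z'\<close>
    the complement of the eigenvectors in it. Below, \<open>A\<close> carries the part of
    \<open>?Z'\<close> on which \<open>gform\<close> is definite and \<open>C\<close> its
    radical.\<close>
  let ?Z = "{x \<in> seqs N. bc_row1 N \<omega> a z x = 0 \<and> bc_row2 N \<omega> z b x = 0}"
  let ?Z' = "{x \<in> ?Z. \<forall>s\<in>S. G x s = 0}"
  have subZ: "cseq.subspace ?Z"
    using subspace_seqs[of N] unfolding cseq.subspace_def
    by (auto simp: bc_row_add bc_row_scale) (simp_all add: bc_row1_def bc_row2_def tail_flux_def fdiff_def)
  have subZ': "cseq.subspace ?Z'"
    using subZ unfolding cseq.subspace_def
    by (auto simp: seq.herm_add[OF gform_hermitian] seq.herm_scale[OF gform_hermitian]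
        seq.herm_zero[OF gform_hermitian])
  have SZ: "S \<subseteq> ?Z"
  proof
    fix s assume s: "s \<in> S"
    then have "s \<in> sol_space N prob (of_real (rayleigh s))" using S(2,5) by (auto simp: sol_space_form)
    then show "s \<in> ?Z" by (simp add: sol_space_chart)
  qed
  have Snz: "G s s \<noteq> 0" if "s \<in> S" for s using S(4)[OF that] by auto
  have fin: "finite (unit_seq ` {..N+1})" by simp
  have sub: "?Z' \<subseteq> cseq.span (unit_seq ` {..N+1})" unfolding unit_seqs_basis(1)[symmetric] by blast
  obtain A C where AC0: "finite A" "finite C" "?Z' = cseq.span (A \<union> C)"
      "cseq.independent (A \<union> C)" "A \<inter> C = {}" "seq.orthog G A" "\<forall>a\<in>A. G a a \<noteq> 0"
      "\<forall>c\<in>C. \<forall>v\<in>?Z'. G c v = 0"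
    by (rule seq.orthogonal_decomposition[OF gform_hermitian[of N \<omega>] subZ' fin sub])
  note AC = AC0(1-6) AC0(7)[rule_format] AC0(8)[THEN bspec, THEN bspec]
  have ACZ: "A \<subseteq> ?Z'" "C \<subseteq> ?Z'" using AC(3) cseq.span_superset[of "A \<union> C"] by blast+
  have spA: "cseq.span A \<subseteq> ?Z'" using ACZ(1) by (intro cseq.span_minimal subZ')
  have C: "c n = 0" if "c \<in> C" "n \<in> {1..N}" for c n
    using gform_zeroD[OF AC(8)] that ACZ(2) by blast
  have Cend: "c \<in> cseq.span D" "\<exists>x v. c = end_seq x v" if "c \<in> C" for c
  proof -
    have eq: "c = end_seq (c 0) (tail_flux N \<omega> c)" using that C ACZ(2) by (intro gform_kernel_eq) auto
    then show "\<exists>x v. c = end_seq x v" by blast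
    have "bc_row1 N \<omega> a z c = 0" "bc_row2 N \<omega> z b c = 0" using that ACZ(2) by auto
    then show "c \<in> cseq.span D" using D(2) eq bc_row_end_seq by metis
  qed
  have split: "\<exists>u t. x = u + t \<and> u \<in> cseq.span S \<and> t \<in> ?Z'" if x: "x \<in> ?Z" for x
  proof -
    obtain u where u: "u \<in> cseq.span S" "\<And>s. s \<in> S \<Longrightarrow> G (x - u) s = 0"
      using seq.orthog_project[OF gform_hermitian S(1,3) Snz] by blast
    have "u \<in> ?Z" using u(1) cseq.span_minimal[OF SZ subZ] by blast
    then have "x - u \<in> ?Z'" using u(2) cseq.subspace_diff[OF subZ x] by simp
    then show ?thesis using u(1) by (intro exI[of _ u] exI[of _ "x - u"]) auto
  qed
  have "A = {}"
  proof (rule ccontr)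
    assume "A \<noteq> {}"
    then obtain y \<mu> where y: "y \<in> cseq.span A" "y \<noteq> 0"
        "\<And>x. x \<in> cseq.span A \<Longrightarrow> B y x = of_real \<mu> * G y x"
      using seq.rayleigh_minimizer[OF bform_hermitian gform_hermitian AC(1,6)] gform_pos AC(7) by metis
    have yZ: "y \<in> ?Z'" using y(1) spA by blast
    define K where "K x t = B x t - of_real \<mu> * G x t" for x t
    have K: "seq.hermitian K"
      using seq.hermitian_diff_scale[OF bform_hermitian gform_hermitian] by (simp add: K_def[abs_def])
    \<comment> \<open>These sets span the domain. On \<open>S\<close> the claim is orthogonality to
      eigenvectors, on \<open>A\<close> it is minimality. On \<open>C\<close> both forms vanish, as
      \<open>C\<close> lies in the kernel plane and \<open>y\<close> meets the boundary
      condition.\<close>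
    have "K x y = 0" if "x \<in> A \<union> C \<union> S" for x
    proof -
      have "K y x = 0"
      proof (cases "x \<in> S")
        case True
        have "G x y = 0" using yZ True seq.herm_eq_0_commute[OF gform_hermitian] by blast
        then have "K x y = 0" using S(5)[OF True] by (simp add: K_def)
        then show ?thesis using seq.herm_eq_0_commute[OF K] by blast
      next
        case False
        show ?thesis
        proof (cases "x \<in> A")
          case True
          then show ?thesis using y(3) by (simp add: K_def cseq.span_base)
        next
          case F: False
          then have x: "x \<in> C" using that False by blast
          then obtain x0 v where "x = end_seq x0 v" using Cend by blast
          then have "B y x = 0" using yZ bform_end_seq_right[of y x0 v] by simp
          moreover have "G y x = 0" using C[OF x] by (intro gform_zero)
          ultimately show ?thesis by (simp add: K_def)
        qed
      qed
      then show ?thesis using seq.herm_eq_0_commute[OF K] by blast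
    qed
    then have Kspan: "K x y = 0" if "x \<in> cseq.span (A \<union> C \<union> S)" for x
      using seq.herm_span_zero[OF K _ that] by blast
    have weak: "B y x = of_real \<mu> * G y x" if x: "x \<in> ?Z" for x
    proof -
      obtain u t where ut: "x = u + t" "u \<in> cseq.span S" "t \<in> cseq.span (A \<union> C)"
        using split[OF x] AC(3) by blast
      have "x \<in> cseq.span (A \<union> C \<union> S)"
        using ut cseq.span_mono[of S "A \<union> C \<union> S"] cseq.span_mono[of "A \<union> C" "A \<union> C \<union> S"]
        by (auto intro: cseq.span_add)
      then have "K y x = 0" using Kspan seq.herm_eq_0_commute[OF K] by blast
      then show ?thesis by (simp add: K_def)
    qed
    obtain r where r: "\<And>n. n \<in> {1..N} \<Longrightarrow> r n = 0" "y + r \<in> sol_space N prob (of_real \<mu>)"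
      using weak_solution_correct[of y "of_real \<mu>"] yZ weak by blast
    \<comment> \<open>\<open>y\<close> is orthogonal to \<open>S\<close> and \<open>r\<close> is
      invisible to \<open>gform\<close>, so \<open>y\<close> would be isotropic although
      \<open>gform\<close> is positive definite on the span of \<open>A\<close>.\<close>
    have "y + r \<in> cseq.span S" using r(2) S(6) by blast
    then have "G (y + r) y = 0"
      by (rule seq.herm_span_zero[OF gform_hermitian, rotated])
        (use yZ seq.herm_eq_0_commute[OF gform_hermitian] in blast)
    then have "G y y = 0" using gform_zero(1)[OF r(1)] by (simp add: seq.herm_add[OF gform_hermitian])
    moreover have "Re (G y y) > 0"
      using seq.orthog_pos_span[OF gform_hermitian AC(1,6) gform_pos[OF AC(7)] y(1,2)] .
    ultimately show False by simp
  qed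
  then have Z'D: "?Z' \<subseteq> cseq.span D"
    using AC(3) Cend(1) cseq.span_minimal[of C "cseq.span D"] cseq.subspace_span by auto
  let ?T = "S \<union> D \<union> {unit_seq 1, unit_seq N + unit_seq (N+1)}"
  have Zspan: "?Z \<subseteq> cseq.span (S \<union> D)"
  proof
    fix x assume "x \<in> ?Z"
    then obtain u t where "x = u + t" "u \<in> cseq.span S" "t \<in> cseq.span D" using split Z'D by blast
    then show "x \<in> cseq.span (S \<union> D)"
      using cseq.span_mono[of S "S \<union> D"] cseq.span_mono[of D "S \<union> D"] by (auto intro: cseq.span_add)
  qed
  have "seqs N \<subseteq> cseq.span ?T"
  proof
    fix x assume "x \<in> seqs N"
    then obtain u where u: "u \<in> ?Z" "x \<in> cseq.span (insert u {unit_seq 1, unit_seq N + unit_seq (N+1)})"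
      using seqs_boundary_decomposition by blast
    have "insert u {unit_seq 1, unit_seq N + unit_seq (N+1)} \<subseteq> cseq.span ?T"
      using u(1) Zspan cseq.span_mono[of "S \<union> D" ?T] cseq.span_superset[of ?T] by blast
    then show "x \<in> cseq.span ?T" using u(2) cseq.span_minimal cseq.subspace_span by blast
  qed
  then have "N + 2 \<le> card ?T"
    using cseq.independent_span_bound[of ?T "unit_seq ` {..N+1}"] unit_seqs_basis S(1) D(1)
      cseq.span_superset[of "unit_seq ` {..N+1}"] by auto
  also have "\<dots> \<le> card S + card D + 2"
    by (intro order_trans[OF card_Un_le] add_mono card_Un_le) (simp add: card_insert_if)
  finally show ?thesis by simp
qed

end


section \<open>Inertia\<close>

definition quad :: "real \<Rightarrow> complex \<Rightarrow> real \<Rightarrow> complex \<Rightarrow> complex \<Rightarrow> real" where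
  "quad s z b x v = Re ((of_real s * x + cnj z * v) * cnj x + (z * x + of_real b * v) * cnj v)"

text \<open>The largest dimension of a subspace on which the quadratic form with rows \<open>(s, cnj z)\<close>, \<open>(z, b)\<close>
  and determinant \<open>d\<close> is nonpositive, and the dimension of its kernel.\<close>

definition nonpos_index :: "real \<Rightarrow> real \<Rightarrow> real \<Rightarrow> nat" where
  "nonpos_index s b d = (if d > 0 then (if s > 0 then 0 else 2) else if d < 0 then 1
     else if s > 0 \<or> b > 0 then 1 else 2)"

definition nullity :: "real \<Rightarrow> real \<Rightarrow> real \<Rightarrow> nat" where
  "nullity s b d = (if d \<noteq> 0 then 0 else if s = 0 \<and> b = 0 then 2 else 1)"

text \<open>A zero eigenvalue of the matrix is nonpositive for it and for its negative, so the
  nullity is counted twice.\<close>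

lemma nonpos_index_add_uminus:
  assumes "d = s * b - (cmod z)\<^sup>2"
  shows "nonpos_index s b d + nonpos_index (- s) (- b) d = 2 + nullity s b d"
proof -
  have "(cmod z)\<^sup>2 \<ge> 0" by simp
  then have "d > 0 \<Longrightarrow> s \<noteq> 0" "d = 0 \<Longrightarrow> s * b \<ge> 0" using assms by auto
  then show ?thesis
    by (cases d "0::real" rule: linorder_cases) (auto simp: nonpos_index_def nullity_def zero_le_mult_iff)
qed

lemma quad_uminus: "quad (- s) (- z) (- b) x v = - quad s z b x v"
  by (simp add: quad_def algebra_simps)

lemma quad_complete_square:
  "s * quad s z b x v = (cmod (of_real s * x + cnj z * v))\<^sup>2 + (s * b - (cmod z)\<^sup>2) * (cmod v)\<^sup>2"
  unfolding quad_def cmod_power2 by (simp add: power2_eq_square algebra_simps)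

lemma quad_nonpos:
  assumes "s \<le> 0" "b \<le> 0" "s * b - (cmod z)\<^sup>2 \<ge> 0"
  shows "quad s z b x v \<le> 0"
proof (cases "s = 0")
  case True
  then have "z = 0" using assms(3) by simp
  with True have "quad s z b x v = b * (cmod v)\<^sup>2"
    unfolding quad_def cmod_power2 by (simp add: power2_eq_square algebra_simps)
  then show ?thesis using assms(2) by (simp add: mult_nonpos_nonneg)
next
  case False
  have "s * quad s z b x v \<ge> 0"
    unfolding quad_complete_square using assms(3) by simp
  then show ?thesis using False assms(1) by (simp add: zero_le_mult_iff)
qed

definition kform :: "nat \<Rightarrow> equation \<Rightarrow> real \<Rightarrow> complex \<Rightarrow> real \<Rightarrow> real \<Rightarrow>
    (nat \<Rightarrow> complex) \<Rightarrow> (nat \<Rightarrow> complex) \<Rightarrow> complex" where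
  "kform N \<omega> a z b \<tau> y x = bform N \<omega> a z b y x - of_real \<tau> * gform N \<omega> y x"

lemma kform_hermitian: "seq.hermitian (kform N \<omega> a z b \<tau>)"
  using seq.hermitian_diff_scale[OF bform_hermitian gform_hermitian] by (simp add: kform_def[abs_def])

context sl_problem
begin

abbreviation "K \<equiv> kform N \<omega> a z b"

lemma bform_end_seq_self: "Re (B (end_seq x v) (end_seq x v)) = quad (a + f_of \<omega> 0) z b x v"
  unfolding bform_end_seq_right bc_row_end_seq quad_def ..

lemma nonpos_subspace_exists:
  assumes d: "d = s * c - (cmod t)\<^sup>2"
  obtains D where "finite D" "cseq.independent D" "card D = nonpos_index s c d"
    "\<forall>u\<in>cseq.span D. \<exists>x v. u = end_seq x v \<and> quad s t c x v \<le> 0"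
proof -
  have t0: "(cmod t)\<^sup>2 \<ge> 0" by simp
  consider "nonpos_index s c d = 0" | "nonpos_index s c d = 1" "d \<le> 0" | "nonpos_index s c d = 2" "s \<le> 0" "c \<le> 0" "d \<ge> 0"
  proof -
    have "s \<le> 0 \<and> c \<le> 0" if "d > 0" "\<not> s > 0"
    proof -
      have "s * c > 0" using that d t0 by linarith
      then show ?thesis using that(2) by (simp add: zero_less_mult_iff)
    qed
    then show ?thesis using that by (fastforce simp: nonpos_index_def split: if_splits)
  qed
  then show ?thesis
  proof cases
    case 1
    show ?thesis
    proof (rule that[of "{}"])
      show "\<forall>u\<in>cseq.span {}. \<exists>x v. u = end_seq x v \<and> quad s t c x v \<le> 0"
        unfolding cseq.span_empty by (auto intro!: exI[of _ 0] simp: quad_def end_seq_zero)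
    qed (use 1 cseq.independent_empty in auto)
  next
    case 2
    obtain x v where xv: "(x, v) \<noteq> (0, 0)" "quad s t c x v \<le> 0"
    proof (cases "s \<le> 0")
      case True
      then show ?thesis using that[of 1 0] by (simp add: quad_def)
    next
      case False
      \<comment> \<open>The vector (- cnj t, s) annihilates the completed square, leaving the
        determinant term alone.\<close>
      have "s * quad s t c (- cnj t) (of_real s) = d * s\<^sup>2"
        unfolding quad_complete_square using False d by simp
      then have "s * quad s t c (- cnj t) (of_real s) \<le> 0" using 2 by (simp add: mult_nonpos_nonneg)
      then show ?thesis using that[of "- cnj t" "of_real s"] False by (simp add: mult_le_0_iff)
    qed
    have scale: "quad s t c (k * x) (k * v) = (cmod k)\<^sup>2 * quad s t c x v" for k
      unfolding quad_def cmod_power2 by (simp add: power2_eq_square algebra_simps)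
    show ?thesis
    proof (rule that[of "{end_seq x v}"])
      show "cseq.independent {end_seq x v}" using xv(1) by (auto simp: end_seq_nonzero)
      show "\<forall>u\<in>cseq.span {end_seq x v}. \<exists>x v. u = end_seq x v \<and> quad s t c x v \<le> 0"
      proof
        fix u assume "u \<in> cseq.span {end_seq x v}"
        then obtain k where "u = end_seq (k * x) (k * v)"
          by (auto simp: cseq.span_singleton end_seq_lincomb(1))
        moreover have "quad s t c (k * x) (k * v) \<le> 0"
          unfolding scale using xv(2) by (simp add: mult_nonneg_nonpos)
        ultimately show "\<exists>x v. u = end_seq x v \<and> quad s t c x v \<le> 0" by blast
      qed
    qed (use 2 in auto)
  next
    case 3
    show ?thesis
    proof (rule that[of "{end_seq 1 0, end_seq 0 1}"])
      show "\<forall>u\<in>cseq.span {end_seq 1 0, end_seq 0 1}. \<exists>x v. u = end_seq x v \<and> quad s t c x v \<le> 0"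
        using span_end_seq[of _ "{end_seq 1 0, end_seq 0 1}"] quad_nonpos[of s c t] 3 d by blast
    qed (use 3 independent_pair in auto)
  qed
qed

lemma common_kernel_span:
  obtains D where "finite D" "card D = nullity (a + f_of \<omega> 0) b ((a + f_of \<omega> 0) * b - (cmod z)\<^sup>2)"
    "\<And>x v. of_real (a + f_of \<omega> 0) * x + cnj z * v = 0 \<Longrightarrow>
      z * x + of_real b * v = 0 \<Longrightarrow> end_seq x v \<in> cseq.span D"
proof -
  define s where "s = a + f_of \<omega> 0"
  define d where "d = s * b - (cmod z)\<^sup>2"
  have zz: "z * cnj z = of_real ((cmod z)\<^sup>2)" by (simp add: complex_norm_square del: of_real_power)
  \<comment> \<open>Multiplying the system by the adjugate matrix yields d times the vector.\<close>
  have elim: "of_real d * x = 0 \<and> of_real d * v = 0"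
    if "of_real s * x + cnj z * v = 0" "z * x + of_real b * v = 0" for x v :: complex
  proof -
    have "of_real d * x = of_real b * (of_real s * x + cnj z * v) - cnj z * (z * x + of_real b * v)"
      using zz by (simp add: d_def algebra_simps del: of_real_power)
    moreover have "of_real d * v = of_real s * (z * x + of_real b * v) - z * (of_real s * x + cnj z * v)"
      using zz by (simp add: d_def algebra_simps del: of_real_power)
    ultimately show ?thesis using that by simp
  qed
  consider "nullity s b d = 0" "d \<noteq> 0" | "nullity s b d = 1" "s \<noteq> 0" | "nullity s b d = 1" "s = 0" "b \<noteq> 0" "d = 0" | "nullity s b d = 2"
    by (cases "d = 0"; cases "s = 0"; cases "b = 0"; simp add: nullity_def)
  then show ?thesis
  proof cases
    case 1
    show ?thesis
    proof (rule that[of "{}"])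
      fix x v assume "of_real (a + f_of \<omega> 0) * x + cnj z * v = 0" "z * x + of_real b * v = 0"
      then have "of_real d * x = 0 \<and> of_real d * v = 0" using elim by (simp add: s_def)
      then show "end_seq x v \<in> cseq.span {}" using 1 by (simp add: end_seq_zero)
    qed (use 1 in \<open>auto simp: s_def d_def\<close>)
  next
    case 2
    show ?thesis
    proof (rule that[of "{end_seq (- cnj z / of_real s) 1}"])
      fix x v assume "of_real (a + f_of \<omega> 0) * x + cnj z * v = 0"
      then have "of_real s * x = - cnj z * v" by (simp add: s_def eq_neg_iff_add_eq_0)
      then have "x = v * (- cnj z / of_real s)" using 2 by (simp add: field_simps)
      then have "end_seq x v = (\<lambda>k. v * end_seq (- cnj z / of_real s) 1 k)"
        by (simp add: end_seq_lincomb(1)[symmetric])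
      then show "end_seq x v \<in> cseq.span {end_seq (- cnj z / of_real s) 1}"
        by (auto simp: cseq.span_singleton)
    qed (use 2 in \<open>auto simp: s_def d_def\<close>)
  next
    case 3
    have z: "z = 0" using 3 by (simp add: d_def)
    show ?thesis
    proof (rule that[of "{end_seq 1 0}"])
      fix x v assume "z * x + of_real b * v = 0"
      then have "v = 0" using z 3 by simp
      then have "end_seq x v = (\<lambda>k. x * end_seq 1 0 k)"
        by (simp add: end_seq_lincomb(1)[symmetric])
      then show "end_seq x v \<in> cseq.span {end_seq 1 0}"
        by (auto simp: cseq.span_singleton)
    qed (use 3 in \<open>auto simp: s_def d_def\<close>)
  next
    case 4
    show ?thesis
      by (rule that[of "{end_seq 1 0, end_seq 0 1}"])
        (use 4 end_seq_span independent_pair(2) in \<open>auto simp: s_def d_def\<close>)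
  qed
qed

abbreviation "s0 \<equiv> a + f_of \<omega> 0"
abbreviation "d0 \<equiv> s0 * b - (cmod z)\<^sup>2"

text \<open>The sign \<open>\<sigma>\<close> treats the eigenvalues below and above \<open>\<tau>\<close> simultaneously.\<close>

lemma inertia_bound:
  assumes \<sigma>: "\<sigma> = 1 \<or> \<sigma> = -1"
    and P: "finite P" "P \<subseteq> seqs N" "cseq.independent P"
      "\<And>u. u \<in> cseq.span P \<Longrightarrow> u \<noteq> 0 \<Longrightarrow> \<sigma> * Re (K \<tau> u u) > 0"
  shows "size (filter_mset (\<lambda>x. \<sigma> * x \<le> \<sigma> * \<tau>) (mset (eig_list N prob)))
    + nonpos_index (\<sigma> * s0) (\<sigma> * b) d0 + card P \<le> N + 2"
proof -
  obtain S where S: "finite S" "S \<subseteq> seqs N" "seq.orthog G S" "\<And>y. y \<in> S \<Longrightarrow> Re (G y y) > 0"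
    "\<And>y x. y \<in> S \<Longrightarrow> B y x = of_real (rayleigh y) * G y x"
    "mset (eig_list N prob) = image_mset rayleigh (mset_set S)"
    using eigenbasis by metis
  \<comment> \<open>\<open>A\<close> and the subspace \<open>D\<close> of the kernel plane will span
    a space on which \<open>\<sigma> * Re (K \<tau> u u)\<close> is nonpositive. Their mixed terms
    are multiples of \<open>gform\<close>, which vanishes against \<open>D\<close>.\<close>
  define A where "A = {y \<in> S. \<sigma> * rayleigh y \<le> \<sigma> * \<tau>}"
  have A: "finite A" "A \<subseteq> S" using S(1) by (auto simp: A_def)
  have cardA: "size (filter_mset (\<lambda>x. \<sigma> * x \<le> \<sigma> * \<tau>) (mset (eig_list N prob))) = card A"
    unfolding S(6) filter_mset_image_mset A_def using S(1) by simp
  have "d0 = (\<sigma> * s0) * (\<sigma> * b) - (cmod (of_real \<sigma> * z))\<^sup>2"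
    using \<sigma> by (elim disjE) (simp_all add: norm_mult algebra_simps)
  then obtain D where D: "finite D" "cseq.independent D" "card D = nonpos_index (\<sigma> * s0) (\<sigma> * b) d0"
      "\<forall>u\<in>cseq.span D. \<exists>x v. u = end_seq x v \<and> quad (\<sigma> * s0) (of_real \<sigma> * z) (\<sigma> * b) x v \<le> 0"
    by (rule nonpos_subspace_exists)
  have Dnonpos: "\<sigma> * Re (B u u) \<le> 0" and Dend: "\<exists>x v. u = end_seq x v" if u: "u \<in> cseq.span D" for u
  proof -
    obtain x v where xv: "u = end_seq x v" "quad (\<sigma> * s0) (of_real \<sigma> * z) (\<sigma> * b) x v \<le> 0"
      using D(4) u by blast
    then show "\<exists>x v. u = end_seq x v" by blast
    have "quad (\<sigma> * s0) (of_real \<sigma> * z) (\<sigma> * b) x v = \<sigma> * quad s0 z b x v"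
      using \<sigma> quad_uminus[of s0 z b x v] by auto
    then show "\<sigma> * Re (B u u) \<le> 0" using xv bform_end_seq_self[of x v] by simp
  qed
  have Gend: "G (end_seq x v) u = 0" for x v u by (rule gform_zero) simp
  have orth: "seq.orthog G A" "\<And>y. y \<in> A \<Longrightarrow> G y y \<noteq> 0"
    using S(3) S(4) A(2) by (force simp: seq.orthog_def)+
  have GD: "G d y = 0" if "y \<in> A" "d \<in> D" for y d
    using Dend[OF cseq.span_base[OF that(2)]] Gend by auto
  note AD = seq.orthog_independent_Un[OF gform_hermitian A(1) orth D(1,2) GD]
  have orthog_K: "seq.orthog (K \<tau>) A"
    using orth(1) S(5) A(2) by (auto simp: seq.orthog_def kform_def)
  have nonpos: "\<sigma> * Re (K \<tau> u u) \<le> 0" if "u \<in> cseq.span (A \<union> D)" for u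
  proof -
    obtain p e where pe: "u = p + e" "p \<in> cseq.span A" "e \<in> cseq.span D"
      using \<open>u \<in> cseq.span (A \<union> D)\<close> unfolding cseq.span_Un by blast
    obtain x v where e: "e = end_seq x v" using Dend[OF pe(3)] by blast
    have "K \<tau> y e = 0" if "y \<in> A" for y
      using S(5)[of y e] A(2) that Gend[of x v y] seq.herm_eq_0_commute[OF gform_hermitian]
      by (auto simp: kform_def e)
    then have pe0: "K \<tau> p e = 0" by (rule seq.herm_span_zero[OF kform_hermitian _ pe(2)])
    then have ep0: "K \<tau> e p = 0" using seq.herm_eq_0_commute[OF kform_hermitian] by blast
    have "\<sigma> * Re (K \<tau> p p) \<le> 0"
    proof -
      obtain c where c: "p = (\<Sum>i\<in>A. (\<lambda>k. c i * i k))" using pe(2) cseq.span_finite[OF A(1)] by auto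
      have "\<sigma> * ((cmod (c i))\<^sup>2 * Re (K \<tau> i i)) \<le> 0" if "i \<in> A" for i
      proof -
        have "Re (K \<tau> i i) = (rayleigh i - \<tau>) * Re (G i i)"
          using S(5)[of i i] that A(2) by (auto simp: kform_def algebra_simps)
        then have "\<sigma> * ((cmod (c i))\<^sup>2 * Re (K \<tau> i i)) = (\<sigma> * rayleigh i - \<sigma> * \<tau>) * ((cmod (c i))\<^sup>2 * Re (G i i))"
          by (simp only:) (simp add: algebra_simps)
        moreover have "\<sigma> * rayleigh i - \<sigma> * \<tau> \<le> 0" "Re (G i i) \<ge> 0"
          using that gform_nonneg by (auto simp: A_def)
        ultimately show ?thesis by (simp only:) (intro mult_nonpos_nonneg mult_nonneg_nonneg; simp)
      qed
      then have "(\<Sum>i\<in>A. \<sigma> * ((cmod (c i))\<^sup>2 * Re (K \<tau> i i))) \<le> 0" by (rule sum_nonpos)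
      then show ?thesis
        unfolding c seq.orthog_square[OF kform_hermitian A(1) orthog_K] sum_distrib_left .
    qed
    moreover have "\<sigma> * Re (K \<tau> e e) \<le> 0"
      using Dnonpos[OF pe(3)] Gend[of x v e] by (simp add: kform_def e)
    ultimately show ?thesis
      using pe0 ep0 unfolding pe(1)
      by (simp add: seq.herm_add[OF kform_hermitian] seq.herm_add_right[OF kform_hermitian] distrib_left)
  qed
  have "card (A \<union> D) + card P \<le> card (unit_seq ` {..N+1})"
  proof (rule seq.definite_disjoint_card[where K = "\<lambda>x y. of_real \<sigma> * K \<tau> x y"])
    have "D \<subseteq> seqs N" using Dend cseq.span_base by force
    then show "A \<union> D \<subseteq> cseq.span (unit_seq ` {..N+1})" "P \<subseteq> cseq.span (unit_seq ` {..N+1})"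
      unfolding unit_seqs_basis(1)[symmetric] using A(2) S(2) P(2) by blast+
  qed (use A D P AD nonpos in simp_all)
  then show ?thesis
    unfolding cardA unit_seqs_basis(3) using card_Un_disjoint[OF A(1) D(1) AD(2)] D(3) by simp
qed

lemma num_eigs_lower: "N \<le> num_eigs N prob + nullity s0 b d0"
proof -
  obtain S where S: "finite S" "S \<subseteq> seqs N" "seq.orthog G S" "\<And>y. y \<in> S \<Longrightarrow> Re (G y y) > 0"
    "\<And>y x. y \<in> S \<Longrightarrow> B y x = of_real (rayleigh y) * G y x" "\<And>\<mu>. sol_space N prob \<mu> \<subseteq> cseq.span S"
    "mset (eig_list N prob) = image_mset rayleigh (mset_set S)"
    using eigenbasis by metis
  obtain D where D: "finite D" "card D = nullity s0 b d0"
    "\<And>x v. of_real s0 * x + cnj z * v = 0 \<Longrightarrow> z * x + of_real b * v = 0 \<Longrightarrow> end_seq x v \<in> cseq.span D"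
    using common_kernel_span by blast
  have "num_eigs N prob = size (mset (eig_list N prob))" by (simp add: num_eigs_def)
  also have "\<dots> = card S" unfolding S(7) by simp
  finally have "num_eigs N prob = card S" .
  moreover have "N \<le> card S + card D"
    by (rule eigenbasis_complete[OF S(1-3) S(4) S(5) S(6) D(1) D(3)])
  ultimately show ?thesis using D(2) by linarith
qed

text \<open>Phrased by definiteness on spans, not by orthogonality: definiteness survives small
  changes of the form, so the same two sets serve for all nearby problems.\<close>

definition definite_split :: "real \<Rightarrow> (nat \<Rightarrow> complex) set \<Rightarrow> (nat \<Rightarrow> complex) set \<Rightarrow> bool" where
  "definite_split \<tau> P Q \<longleftrightarrow> finite P \<and> finite Q \<and> P \<subseteq> seqs N \<and> Q \<subseteq> seqs N \<and>
     cseq.independent P \<and> cseq.independent Q \<and>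
     (\<forall>u\<in>cseq.span P. u \<noteq> 0 \<longrightarrow> Re (K \<tau> u u) > 0) \<and>
     (\<forall>u\<in>cseq.span Q. u \<noteq> 0 \<longrightarrow> - Re (K \<tau> u u) > 0) \<and> card P + card Q = N + 2"

text \<open>The inertia bounds for both signs count \<open>\<tau>\<close> twice if it occurs. They
  add up to (number of eigenvalues) + (occurrences of \<open>\<tau>\<close>) + nullity <= N, and
  \<open>num_eigs_lower\<close> turns every estimate into an equality.\<close>

lemma definite_split_count:
  assumes "definite_split \<tau> P Q"
  shows "\<tau> \<notin> set (eig_list N prob)"
    "length (filter (\<lambda>x. x < \<tau>) (eig_list N prob)) + nonpos_index s0 b d0 + card P = N + 2"
    "num_eigs N prob + nullity s0 b d0 = N"
proof -
  let ?M = "mset (eig_list N prob)"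
  have 1: "size (filter_mset (\<lambda>x. x \<le> \<tau>) ?M) + nonpos_index s0 b d0 + card P \<le> N + 2"
    using inertia_bound[of 1 P \<tau>] assms by (simp add: definite_split_def)
  have 2: "size (filter_mset (\<lambda>x. \<tau> \<le> x) ?M) + nonpos_index (- s0) (- b) d0 + card Q \<le> N + 2"
    using inertia_bound[of "-1" Q \<tau>] assms by (simp add: definite_split_def)
  have 3: "card P + card Q = N + 2" using assms by (simp add: definite_split_def)
  have 4: "nonpos_index s0 b d0 + nonpos_index (- s0) (- b) d0 = 2 + nullity s0 b d0"
    by (rule nonpos_index_add_uminus[OF refl])
  have c: "size (filter_mset (\<lambda>x. x \<le> \<tau>) M) = size (filter_mset (\<lambda>x. x < \<tau>) M) + count M \<tau>"
     "size (filter_mset (\<lambda>x. x < \<tau>) M) + size (filter_mset (\<lambda>x. \<tau> \<le> x) M) = size M" for M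
    by (induction M) auto
  have 5: "num_eigs N prob = size ?M" by (simp add: num_eigs_def)
  have "count ?M \<tau> = 0 \<and> size (filter_mset (\<lambda>x. x < \<tau>) ?M) + nonpos_index s0 b d0 + card P = N + 2
    \<and> num_eigs N prob + nullity s0 b d0 = N"
    using 1 2 3 4 5 c[of ?M] num_eigs_lower by linarith
  then show "\<tau> \<notin> set (eig_list N prob)"
    "length (filter (\<lambda>x. x < \<tau>) (eig_list N prob)) + nonpos_index s0 b d0 + card P = N + 2"
    "num_eigs N prob + nullity s0 b d0 = N"
    by (auto simp: count_eq_zero_iff size_mset[symmetric] mset_filter[symmetric] simp del: size_mset mset_filter)
qed

text \<open>Away from the eigenvalues the pencil is nondegenerate on all N + 2 dimensions, so an
  orthogonal basis has no isotropic member and splits by sign.\<close>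

lemma kform_orthogonal_basis:
  assumes \<tau>: "\<tau> \<notin> set (eig_list N prob)"
  obtains P Q where "finite P" "finite Q" "P \<subseteq> seqs N" "Q \<subseteq> seqs N"
    "seq.orthog (K \<tau>) P" "seq.orthog (K \<tau>) Q"
    "\<forall>x\<in>P. Re (K \<tau> x x) > 0" "\<forall>x\<in>Q. Re (K \<tau> x x) < 0"
    "card P + card Q = N + 2"
proof -
  obtain S where S: "finite S" "S \<subseteq> seqs N" "seq.orthog G S" "\<And>y. y \<in> S \<Longrightarrow> Re (G y y) > 0"
    "\<And>y x. y \<in> S \<Longrightarrow> B y x = of_real (rayleigh y) * G y x" "\<And>\<mu>. sol_space N prob \<mu> \<subseteq> cseq.span S"
    "mset (eig_list N prob) = image_mset rayleigh (mset_set S)"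
    using eigenbasis by metis
  have "set (eig_list N prob) = rayleigh ` S"
    by (metis S(1,7) finite_set_mset_mset_set set_image_mset set_mset_mset)
  then have ray_neq: "rayleigh s \<noteq> \<tau>" if "s \<in> S" for s using \<tau> that by blast
  \<comment> \<open>A radical vector would be an eigenvector for \<open>\<tau>\<close>, hence in the
    span of \<open>S\<close>, yet it is orthogonal to \<open>S\<close>, whose members have other
    eigenvalues.\<close>
  have nondeg: "v = 0" if v: "v \<in> seqs N" "\<And>x. x \<in> seqs N \<Longrightarrow> K \<tau> v x = 0" for v
  proof (rule ccontr)
    assume "v \<noteq> 0"
    have sol: "v \<in> sol_space N prob (of_real \<tau>)" using v by (intro sol_spaceI) (auto simp: kform_def)
    have "G v s = 0" if "s \<in> S" for s
    proof -
      have "s \<in> sol_space N prob (of_real (rayleigh s))" using that S(2,5) by (auto simp: sol_space_form)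
      moreover have "s \<noteq> 0" using S(4)[OF that] by (auto simp: seq.herm_zero[OF gform_hermitian])
      moreover have "complex_of_real \<tau> \<noteq> of_real (rayleigh s)" using ray_neq[OF that] by simp
      ultimately show ?thesis using eigenvectors_orthogonal[OF sol \<open>v \<noteq> 0\<close>] by blast
    qed
    moreover have "v \<in> cseq.span S" using sol S(6) by blast
    moreover have "G s s \<noteq> 0" if "s \<in> S" for s using S(4)[OF that] by auto
    ultimately have "v = 0" using seq.orthog_span_eq_0[OF gform_hermitian S(1,3)] by blast
    then show False using \<open>v \<noteq> 0\<close> by simp
  qed
  have fin: "finite (unit_seq ` {..N+1})" by simp
  have sub: "seqs N \<subseteq> cseq.span (unit_seq ` {..N+1})" using unit_seqs_basis(1) by blast
  obtain A where A0: "finite A" "seqs N = cseq.span A" "cseq.independent A" "seq.orthog (K \<tau>) A"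
    "\<forall>x\<in>A. K \<tau> x x \<noteq> 0"
    by (rule seq.orthogonal_basis[OF kform_hermitian[of N \<omega> a z b \<tau>] subspace_seqs fin sub nondeg])
  note A = A0(1-4) A0(5)[rule_format]
  have "card A = cseq.dim (seqs N)" using cseq.dim_span_eq_card_independent[OF A(3)] A(2) by simp
  also have "\<dots> = card (unit_seq ` {..N+1})"
    unfolding unit_seqs_basis(1) by (rule cseq.dim_span_eq_card_independent[OF unit_seqs_basis(2)])
  finally have "card A = N + 2" by (simp only: unit_seqs_basis(3))
  have nz: "Re (K \<tau> x x) \<noteq> 0" if "x \<in> A" for x
    using A(5)[OF that] seq.herm_self_real[OF kform_hermitian, of N \<omega> a z b \<tau> x] by auto
  let ?P = "{x \<in> A. Re (K \<tau> x x) > 0}" and ?Q = "{x \<in> A. Re (K \<tau> x x) < 0}"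
  have "?P \<union> ?Q = A" "?P \<inter> ?Q = {}" using nz by (auto simp: less_le)
  then have "card ?P + card ?Q = N + 2"
    using A(1) \<open>card A = N + 2\<close> card_Un_disjoint[of ?P ?Q] by simp
  moreover have "A \<subseteq> seqs N" unfolding A(2) by (rule cseq.span_superset)
  then have "?P \<subseteq> seqs N" "?Q \<subseteq> seqs N" by auto
  moreover have "seq.orthog (K \<tau>) ?P" "seq.orthog (K \<tau>) ?Q"
    using A(4) unfolding seq.orthog_def by simp_all
  ultimately show ?thesis using A(1) by (intro that[of ?P ?Q]) simp_all
qed

lemma definite_splitI:
  assumes P: "finite P" and Q: "finite Q" and sub: "P \<subseteq> seqs N" "Q \<subseteq> seqs N"
    and orth: "seq.orthog (K \<tau>) P" "seq.orthog (K \<tau>) Q"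
    and pos: "\<forall>x\<in>P. Re (K \<tau> x x) > 0" and neg: "\<forall>x\<in>Q. Re (K \<tau> x x) < 0"
    and card: "card P + card Q = N + 2"
  shows "definite_split \<tau> P Q"
proof -
  have "cseq.independent P"
    by (rule seq.orthog_independent[OF kform_hermitian P orth(1)]) (use pos in force)
  moreover have "cseq.independent Q"
    by (rule seq.orthog_independent[OF kform_hermitian Q orth(2)]) (use neg in force)
  moreover have "Re (K \<tau> u u) > 0" if "u \<in> cseq.span P" "u \<noteq> 0" for u
    by (rule seq.orthog_pos_span[OF kform_hermitian P orth(1) _ that]) (use pos in blast)
  moreover have "Re (- K \<tau> u u) > 0" if "u \<in> cseq.span Q" "u \<noteq> 0" for u
    by (rule seq.orthog_pos_span[OF seq.hermitian_uminus[OF kform_hermitian] Q _ _ that])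
      (use orth(2) neg in \<open>auto simp: seq.orthog_def\<close>)
  ultimately show ?thesis using P Q sub card by (simp add: definite_split_def)
qed

end


section \<open>The topology of the chart\<close>

text \<open>The \<open>2 \<times> 2\<close> minors are multiplied by \<open>det T\<close> under \<open>M \<mapsto> T ** M\<close>, so their quotients are
  functions on the set of classes (Pluecker coordinates). On the chart they return the parameters.\<close>

definition minor :: "4 \<Rightarrow> 4 \<Rightarrow> complex^4^2 \<Rightarrow> complex" where
  "minor i j M = M $ 1 $ i * M $ 2 $ j - M $ 1 $ j * M $ 2 $ i"

definition minor_ratio :: "4 \<Rightarrow> 4 \<Rightarrow> (complex^4^2) set \<Rightarrow> complex" where
  "minor_ratio i j \<A> = (let M = SOME M. M \<in> \<A> in minor i j M / minor 2 3 M)"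

lemma minor_mult: "minor i j (T ** M) = det T * minor i j M"
  by (simp add: minor_def matrix_matrix_mult_def sum_2 det_2 algebra_simps)

lemma minor_ratio_bc_class: "minor_ratio i j (bc_class M) = minor i j M / minor 2 3 M"
proof -
  have "(SOME M'. M' \<in> bc_class M) \<in> bc_class M" by (rule someI[of _ M]) (rule bc_class_self)
  then obtain T where T: "(SOME M'. M' \<in> bc_class M) = T ** M" "invertible T" by (auto simp: bc_class_def)
  then have "det T \<noteq> 0" using invertible_det_nz by blast
  then show ?thesis by (simp add: minor_ratio_def T(1) minor_mult)
qed

lemma minor_chart [simp]:
  "minor 2 3 (chart_mat a z b) = 1" "minor 1 3 (chart_mat a z b) = - of_real a"
  "minor 2 1 (chart_mat a z b) = - z" "minor 2 4 (chart_mat a z b) = - of_real b"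
  by (simp_all add: minor_def)

definition chart_a :: "(complex^4^2) set \<Rightarrow> real" where "chart_a \<A> = - Re (minor_ratio 1 3 \<A>)"
definition chart_z :: "(complex^4^2) set \<Rightarrow> complex" where "chart_z \<A> = - minor_ratio 2 1 \<A>"
definition chart_b :: "(complex^4^2) set \<Rightarrow> real" where "chart_b \<A> = - Re (minor_ratio 2 4 \<A>)"

lemma chart_coordinates [simp]:
  "chart_a (bc_class (chart_mat a z b)) = a"
  "chart_z (bc_class (chart_mat a z b)) = z"
  "chart_b (bc_class (chart_mat a z b)) = b"
  by (simp_all add: chart_a_def chart_z_def chart_b_def minor_ratio_bc_class)

lemma chart_mat_rank2: "chart_mat a z b \<in> rank2"
proof -
  let ?r = "\<lambda>i. row i (chart_mat a z b)"
  have nth: "?r i $ j = chart_mat a z b $ i $ j" for i j by (simp add: row_def)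
  have ne: "?r 1 \<noteq> ?r 2" using nth[of 1 2] nth[of 2 2] by auto
  have "?r 1 \<notin> vec.span {?r 2}"
  proof
    assume "?r 1 \<in> vec.span {?r 2}"
    then obtain k where "?r 1 = k *s ?r 2" by (auto simp: vec.span_singleton)
    then have "?r 1 $ 2 = k * ?r 2 $ 2" by simp
    then show False by (simp add: nth)
  qed
  moreover have "?r 2 \<noteq> 0" using nth[of 2 3] by auto
  ultimately have "vec.independent {?r 1, ?r 2}" using ne by (simp add: vec.independent_insert)
  moreover have "rows (chart_mat a z b) = {?r 1, ?r 2}"
    unfolding rows_def by auto (metis exhaust_2)+
  ultimately show ?thesis
    using ne by (simp add: rank2_def row_rank_def_gen vec.dim_eq_card_independent)
qed

lemma bc_class_chart_BC: "bc_class (chart_mat a z b) \<in> BC"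
proof -
  have "Ablock (chart_mat a z b) ** Jmat ** ctranspose (Ablock (chart_mat a z b)) =
    Bblock (chart_mat a z b) ** Jmat ** ctranspose (Bblock (chart_mat a z b))"
    by (simp add: vec_eq_iff forall_2 matrix_matrix_mult_def sum_2 Ablock_def Bblock_def Jmat_def
        ctranspose_def map_matrix_def transpose_def vector_2)
  then show ?thesis unfolding BC_def using chart_mat_rank2 by blast
qed

lemma continuous_on_minor: "continuous_on S (minor i j)"
  unfolding minor_def[abs_def] by (intro continuous_intros)

text \<open>The set \<open>?R\<close> of matrices is saturated, because nonvanishing of
  \<open>minor 2 3\<close> and the ratio are invariant under invertible left factors. Its image is
  therefore open in the quotient.\<close>

lemma open_minor_ratio:
  assumes V: "open V" and M0: "M0 \<in> rank2" "minor 2 3 M0 \<noteq> 0" "minor_ratio i j (bc_class M0) \<in> V"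
    "bc_class M0 \<in> BC"
  obtains U where "openin bc_top U" "bc_class M0 \<in> U" "\<And>\<A>. \<A> \<in> U \<Longrightarrow> minor_ratio i j \<A> \<in> V"
proof -
  let ?W = "{M. minor 2 3 M \<noteq> 0}"
  let ?R = "{M \<in> rank2. minor 2 3 M \<noteq> 0 \<and> minor i j M / minor 2 3 M \<in> V}"
  have W: "open ?W"
    using open_Collect_neq[OF continuous_on_minor continuous_on_const] .
  have "open (?W \<inter> (\<lambda>M. minor i j M / minor 2 3 M) -` V)"
    by (intro continuous_open_preimage W V continuous_on_divide continuous_on_minor) auto
  then have "openin (top_of_set rank2) (rank2 \<inter> (?W \<inter> (\<lambda>M. minor i j M / minor 2 3 M) -` V))"
    by (rule openin_open_Int)
  moreover have "rank2 \<inter> (?W \<inter> (\<lambda>M. minor i j M / minor 2 3 M) -` V) = ?R" by auto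
  moreover have "{M \<in> rank2. bc_class M \<in> bc_class ` ?R} = ?R"
  proof -
    have "M \<in> ?R" if M: "M \<in> rank2" and M': "M' \<in> ?R" "bc_class M = bc_class M'" for M M'
    proof -
      have "M \<in> bc_class M'" using M'(2) bc_class_self by blast
      then obtain T where T: "M = T ** M'" "invertible T" by (auto simp: bc_class_def)
      then show ?thesis using M M'(1) invertible_det_nz[of T] by (simp add: minor_mult)
    qed
    then show ?thesis by blast
  qed
  ultimately have "openin quot_top (bc_class ` ?R)"
    unfolding openin_quot_top by auto
  then have "openin bc_top (bc_class ` ?R \<inter> BC)"
    unfolding bc_top_def openin_subtopology by blast
  moreover have "bc_class M0 \<in> bc_class ` ?R \<inter> BC"
    using M0 by (auto simp: minor_ratio_bc_class)
  moreover have "minor_ratio i j \<A> \<in> V" if "\<A> \<in> bc_class ` ?R \<inter> BC" for \<A>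
    using that by (auto simp: minor_ratio_bc_class)
  ultimately show ?thesis using that by blast
qed

lemma tendsto_atin_withinI:
  assumes "\<And>V. open V \<Longrightarrow> l \<in> V \<Longrightarrow> \<exists>U. openin X U \<and> p \<in> U \<and> (\<forall>x\<in>U. h x \<in> V)"
  shows "(h \<longlongrightarrow> l) (atin_within X p S)"
proof (rule topological_tendstoI)
  fix V assume "open V" "l \<in> V"
  then show "\<forall>\<^sub>F x in atin_within X p S. h x \<in> V"
    using assms[of V] by (auto simp: eventually_atin_within)
qed

lemma tendsto_minor_ratio:
  assumes "\<omega> \<in> Omega N"
  shows "((\<lambda>p. minor_ratio i j (snd p)) \<longlongrightarrow> minor_ratio i j (bc_class (chart_mat a z b)))
    (atin_within (prob_top N) (\<omega>, bc_class (chart_mat a z b)) S)"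
proof (rule tendsto_atin_withinI)
  fix V :: "complex set" assume "open V" "minor_ratio i j (bc_class (chart_mat a z b)) \<in> V"
  then obtain U where U: "openin bc_top U" "bc_class (chart_mat a z b) \<in> U" "\<And>\<A>. \<A> \<in> U \<Longrightarrow> minor_ratio i j \<A> \<in> V"
    using open_minor_ratio[of V "chart_mat a z b" i j] chart_mat_rank2 bc_class_chart_BC by auto
  have "openin (prob_top N) (Omega N \<times> U)"
    unfolding prob_top_def using U(1) by (simp add: openin_prod_Times_iff)
  then show "\<exists>W. openin (prob_top N) W \<and> (\<omega>, bc_class (chart_mat a z b)) \<in> W \<and> (\<forall>p\<in>W. minor_ratio i j (snd p) \<in> V)"
    using U assms by (intro exI[of _ "Omega N \<times> U"]) auto
qed

lemma tendsto_equation: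
  fixes g :: "equation \<Rightarrow> real"
  assumes g: "continuous_on UNIV g" and p: "\<omega> \<in> Omega N" "\<A> \<in> BC"
  shows "((\<lambda>p. g (fst p)) \<longlongrightarrow> g \<omega>) (atin_within (prob_top N) (\<omega>, \<A>) S)"
proof (rule tendsto_atin_withinI)
  fix V assume V: "open V" "g \<omega> \<in> V"
  have "openin (top_of_set (Omega N)) (Omega N \<inter> g -` V)"
    using open_vimage[OF V(1) g] by (rule openin_open_Int)
  then have "openin (prob_top N) ((Omega N \<inter> g -` V) \<times> BC)"
    unfolding prob_top_def openin_prod_Times_iff using openin_topspace[of bc_top] by simp
  then show "\<exists>U. openin (prob_top N) U \<and> (\<omega>, \<A>) \<in> U \<and> (\<forall>x\<in>U. g (fst x) \<in> V)"
    using V p by (intro exI[of _ "(Omega N \<inter> g -` V) \<times> BC"]) auto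
qed

lemma continuous_equation_coords:
  "continuous_on UNIV (\<lambda>\<omega>::equation. fst \<omega> n)"
  "continuous_on UNIV (\<lambda>\<omega>::equation. q_of \<omega> n)"
  "continuous_on UNIV (\<lambda>\<omega>::equation. w_of \<omega> n)"
proof -
  have c: "continuous_on UNIV (\<lambda>g::nat \<Rightarrow> real. g n)" by (rule continuous_on_product_coordinates)
  show "continuous_on UNIV (\<lambda>\<omega>::equation. fst \<omega> n)"
    by (rule continuous_on_compose2[OF c continuous_on_fst[OF continuous_on_id]]) simp
  show "continuous_on UNIV (\<lambda>\<omega>::equation. q_of \<omega> n)" unfolding q_of_def
    by (rule continuous_on_compose2[OF c continuous_on_fst[OF continuous_on_snd[OF continuous_on_id]]]) simp
  show "continuous_on UNIV (\<lambda>\<omega>::equation. w_of \<omega> n)" unfolding w_of_def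
    by (rule continuous_on_compose2[OF c continuous_on_snd[OF continuous_on_snd[OF continuous_on_id]]]) simp
qed

lemma tendsto_coordinates:
  fixes a b :: real and z :: complex and S :: "problem set"
  assumes \<omega>: "\<omega> \<in> Omega N"
  defines "F \<equiv> atin_within (prob_top N) (\<omega>, bc_class (chart_mat a z b)) S"
  shows "n \<le> N \<Longrightarrow> ((\<lambda>p. f_of (fst p) n) \<longlongrightarrow> f_of \<omega> n) F"
    "((\<lambda>p. q_of (fst p) n) \<longlongrightarrow> q_of \<omega> n) F"
    "((\<lambda>p. w_of (fst p) n) \<longlongrightarrow> w_of \<omega> n) F"
    "((\<lambda>p. chart_a (snd p)) \<longlongrightarrow> a) F"
    "((\<lambda>p. chart_z (snd p)) \<longlongrightarrow> z) F"
    "((\<lambda>p. chart_b (snd p)) \<longlongrightarrow> b) F"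
proof -
  note eq = tendsto_equation[OF _ \<omega> bc_class_chart_BC, of _ a z b S, folded F_def]
  note mr = tendsto_minor_ratio[OF \<omega>, of _ _ a z b S, folded F_def]
  show "((\<lambda>p. f_of (fst p) n) \<longlongrightarrow> f_of \<omega> n) F" if "n \<le> N"
  proof -
    have "fst \<omega> n \<noteq> 0" using \<omega> that by (auto simp: Omega_def)
    then show ?thesis unfolding f_of_def by (intro tendsto_divide tendsto_const eq continuous_equation_coords)
  qed
  show "((\<lambda>p. q_of (fst p) n) \<longlongrightarrow> q_of \<omega> n) F" "((\<lambda>p. w_of (fst p) n) \<longlongrightarrow> w_of \<omega> n) F"
    by (intro eq continuous_equation_coords)+
  show "((\<lambda>p. chart_a (snd p)) \<longlongrightarrow> a) F"
    using tendsto_minus[OF tendsto_Re[OF mr[of 1 3]]] by (simp add: chart_a_def minor_ratio_bc_class)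
  show "((\<lambda>p. chart_z (snd p)) \<longlongrightarrow> z) F"
    using tendsto_minus[OF mr[of 2 1]] by (simp add: chart_z_def minor_ratio_bc_class)
  show "((\<lambda>p. chart_b (snd p)) \<longlongrightarrow> b) F"
    using tendsto_minus[OF tendsto_Re[OF mr[of 2 4]]] by (simp add: chart_b_def minor_ratio_bc_class)
qed

lemma continuous_on_chart_mat:
  fixes \<alpha> \<beta> :: "real \<Rightarrow> real"
  assumes "continuous_on UNIV \<alpha>" "continuous_on UNIV \<beta>"
  shows "continuous_on UNIV (\<lambda>t. chart_mat (\<alpha> t) z (\<beta> t))"
proof -
  have "continuous_on UNIV (\<lambda>t. chart_mat (\<alpha> t) z (\<beta> t) $ i $ j)" for i j
    using exhaust_2[of i] exhaust_4[of j]
    by (elim disjE; hypsubst; simp only: chart_mat_nth; intro continuous_intros assms)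
  then have "continuous_on UNIV (\<lambda>t. \<chi> i j. chart_mat (\<alpha> t) z (\<beta> t) $ i $ j)"
    by (intro continuous_on_vec_lambda)
  then show ?thesis by simp
qed

text \<open>Limits along a trivial filter say nothing, so a discontinuity needs points of
  \<open>S\<close> arbitrarily near \<open>p\<close>. The path provides them with the equation and
  \<open>z\<close> fixed.\<close>

lemma path_not_trivial:
  fixes \<alpha> \<beta> :: "real \<Rightarrow> real"
  assumes \<omega>: "\<omega> \<in> Omega N" and c: "continuous_on UNIV \<alpha>" "continuous_on UNIV \<beta>"
    and S: "\<And>t. t > 0 \<Longrightarrow> (\<omega>, bc_class (chart_mat (\<alpha> t) z (\<beta> t))) \<in> S"
    and p: "p = (\<omega>, bc_class (chart_mat (\<alpha> 0) z (\<beta> 0)))" "p \<notin> S"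
  shows "atin_within (prob_top N) p S \<noteq> bot"
proof
  assume "atin_within (prob_top N) p S = bot"
  then have "\<forall>\<^sub>F x in atin_within (prob_top N) p S. False" by simp
  moreover have "p \<in> topspace (prob_top N)" using \<omega> p(1) bc_class_chart_BC by simp
  ultimately obtain U where U: "openin (prob_top N) U" "p \<in> U" "\<forall>x\<in>U. x \<in> S \<longrightarrow> x = p"
    unfolding eventually_atin_within by blast
  let ?g = "\<lambda>t. (\<omega>, bc_class (chart_mat (\<alpha> t) z (\<beta> t)))"
  have "continuous_map euclideanreal (top_of_set rank2) (\<lambda>t. chart_mat (\<alpha> t) z (\<beta> t))"
    using continuous_on_chart_mat[OF c] chart_mat_rank2 by (auto simp: continuous_map_in_subtopology)
  then have "continuous_map euclideanreal quot_top (bc_class \<circ> (\<lambda>t. chart_mat (\<alpha> t) z (\<beta> t)))"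
    by (rule continuous_map_compose) (rule quotient_imp_continuous_map[OF quotient_map_bc_class])
  then have "continuous_map euclideanreal bc_top (\<lambda>t. bc_class (chart_mat (\<alpha> t) z (\<beta> t)))"
    unfolding bc_top_def continuous_map_in_subtopology by (auto simp: bc_class_chart_BC o_def)
  moreover have "continuous_map euclideanreal (top_of_set (Omega N)) (\<lambda>t. \<omega>)"
    using \<omega> by simp
  ultimately have "continuous_map euclideanreal (prob_top N) ?g"
    unfolding prob_top_def by (intro continuous_map_pairedI)
  then have "openin euclideanreal {t \<in> topspace euclideanreal. ?g t \<in> U}"
    using U(1) by (rule openin_continuous_map_preimage)
  then have "open {t. ?g t \<in> U}" by simp
  moreover have "0 \<in> {t. ?g t \<in> U}" using U(2) p(1) by simp
  ultimately obtain e where e: "e > 0" "ball 0 e \<subseteq> {t. ?g t \<in> U}"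
    unfolding open_contains_ball by blast
  have "e/2 \<in> ball 0 e" using e(1) by simp
  then have "?g (e/2) \<in> U" using e(2) by blast
  then have "?g (e/2) = p" using U(3) S e(1) by simp
  then show False using S[of "e/2"] e(1) p(2) by simp
qed


section \<open>Limits of eigenvalues\<close>

definition chart_problems :: "nat \<Rightarrow> problem set" where
  "chart_problems N = Omega N \<times> O23"

definition prob_s :: "problem \<Rightarrow> real" where "prob_s p = chart_a (snd p) + f_of (fst p) 0"
definition prob_b :: "problem \<Rightarrow> real" where "prob_b p = chart_b (snd p)"
definition prob_d :: "problem \<Rightarrow> real" where
  "prob_d p = prob_s p * prob_b p - (cmod (chart_z (snd p)))\<^sup>2"
definition prob_index :: "problem \<Rightarrow> nat" where
  "prob_index p = nonpos_index (prob_s p) (prob_b p) (prob_d p)"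
definition prob_nullity :: "problem \<Rightarrow> nat" where
  "prob_nullity p = nullity (prob_s p) (prob_b p) (prob_d p)"

lemma chart_problems_cases:
  assumes "p \<in> chart_problems N"
  obtains \<omega> a z b where "\<omega> \<in> Omega N" "p = (\<omega>, bc_class (chart_mat a z b))"
  using assms by (auto simp: chart_problems_def O23_def)

lemma prob_chart [simp]:
  "prob_s (\<omega>, bc_class (chart_mat a z b)) = a + f_of \<omega> 0"
  "prob_b (\<omega>, bc_class (chart_mat a z b)) = b"
  "prob_d (\<omega>, bc_class (chart_mat a z b)) = (a + f_of \<omega> 0) * b - (cmod z)\<^sup>2"
  by (simp_all add: prob_s_def prob_b_def prob_d_def)

lemma chart_in_chart_problems:
  "(\<omega>, bc_class (chart_mat a z b)) \<in> chart_problems N \<longleftrightarrow> \<omega> \<in> Omega N"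
  by (auto simp: chart_problems_def O23_def)

lemma stratum_iff: "p \<in> stratum N Q \<longleftrightarrow> p \<in> chart_problems N \<and> Q (prob_s p) (prob_b p) (prob_d p)"
proof
  assume "p \<in> stratum N Q"
  then obtain \<omega> a z b where "p = (\<omega>, bc_class (chart_mat a z b))" "\<omega> \<in> Omega N"
    "Q (a + f_of \<omega> 0) b ((a + f_of \<omega> 0) * b - (cmod z)\<^sup>2)"
    unfolding stratum_def by blast
  then show "p \<in> chart_problems N \<and> Q (prob_s p) (prob_b p) (prob_d p)"
    by (simp add: chart_in_chart_problems)
next
  assume p: "p \<in> chart_problems N \<and> Q (prob_s p) (prob_b p) (prob_d p)"
  then obtain \<omega> a z b where "\<omega> \<in> Omega N" "p = (\<omega>, bc_class (chart_mat a z b))"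
    using chart_problems_cases by blast
  moreover from this have "Q (a + f_of \<omega> 0) b ((a + f_of \<omega> 0) * b - (cmod z)\<^sup>2)" using p by simp
  ultimately show "p \<in> stratum N Q" unfolding stratum_def by blast
qed

definition eig_count :: "nat \<Rightarrow> real \<Rightarrow> problem \<Rightarrow> nat" where
  "eig_count N \<tau> p = length (filter (\<lambda>x. x < \<tau>) (eig_list N p))"

lemma eig_count_le: "eig_count N \<tau> p \<le> num_eigs N p"
  by (simp add: eig_count_def num_eigs_def)

lemma sorted_nth_less_iff:
  fixes xs :: "real list"
  assumes "sorted xs" "n < length xs"
  shows "xs ! n < t \<longleftrightarrow> n < length (filter (\<lambda>x. x < t) xs)"
  using assms
proof (induction xs arbitrary: n)
  case (Cons x xs)
  show ?case
  proof (cases "x < t")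
    case True
    then show ?thesis using Cons by (cases n) auto
  next
    case False
    then have "filter (\<lambda>x. x < t) (x # xs) = []" using Cons.prems(1) by (auto simp: filter_empty_conv)
    moreover have "\<not> (x # xs) ! n < t"
      using False Cons.prems by (cases n) (auto simp: nth_Cons' dest!: nth_mem)
    ultimately show ?thesis by simp
  qed
qed simp

text \<open>Translates positions in the eigenvalue list into counts, the quantities whose
  perturbation is controlled.\<close>

lemma lam_less_iff:
  assumes "n < num_eigs N p"
  shows "lam N n p < t \<longleftrightarrow> n < eig_count N t p"
  unfolding lam_def eig_count_def using assms
  by (intro sorted_nth_less_iff) (auto simp: num_eigs_def eig_list_def)

lemma tendsto_kform:
  assumes F: "F = atin_within (prob_top N) (\<omega>, bc_class (chart_mat a z b)) S" and \<omega>: "\<omega> \<in> Omega N"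
  shows "((\<lambda>p. kform N (fst p) (chart_a (snd p)) (chart_z (snd p)) (chart_b (snd p)) \<tau> x y)
    \<longlongrightarrow> kform N \<omega> a z b \<tau> x y) F"
proof -
  note lims = tendsto_coordinates[OF \<omega>, where a = a and z = z and b = b and S = S, folded F]
  show ?thesis
    unfolding kform_def bform_def gform_def tail_flux_def
    by (intro tendsto_intros lims) auto
qed

lemma eventually_atin_within_mem: "\<forall>\<^sub>F p in atin_within X p0 S. p \<in> S"
  unfolding eventually_atin_within using openin_topspace by fastforce

text \<open>Both sides equal N + 2 minus the size of one and the same \<open>P\<close>: the
  splitting found at \<open>p0\<close> stays definite for all \<open>p\<close> nearby, even where
  the number of eigenvalues differs.\<close>

lemma eig_count_stable:
  assumes N: "2 \<le> N" and p0: "p0 \<in> chart_problems N" and \<tau>: "\<tau> \<notin> set (eig_list N p0)"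
    and S: "S \<subseteq> chart_problems N"
  shows "\<forall>\<^sub>F p in atin_within (prob_top N) p0 S. eig_count N \<tau> p + prob_index p = eig_count N \<tau> p0 + prob_index p0"
proof -
  obtain \<omega> a z b where p: "\<omega> \<in> Omega N" "p0 = (\<omega>, bc_class (chart_mat a z b))"
    using p0 chart_problems_cases by blast
  interpret sl: sl_problem N \<omega> a z b using N p(1) by unfold_locales
  let ?F = "atin_within (prob_top N) p0 S"
  let ?K = "\<lambda>p. kform N (fst p) (chart_a (snd p)) (chart_z (snd p)) (chart_b (snd p)) \<tau>"
  obtain P Q where PQ: "finite P" "finite Q" "P \<subseteq> seqs N" "Q \<subseteq> seqs N"
    "seq.orthog (sl.K \<tau>) P" "seq.orthog (sl.K \<tau>) Q"
    "\<forall>x\<in>P. Re (sl.K \<tau> x x) > 0" "\<forall>x\<in>Q. Re (sl.K \<tau> x x) < 0"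
    "card P + card Q = N + 2"
    using sl.kform_orthogonal_basis \<tau> p(2) by metis
  have negQ: "seq.orthog (\<lambda>x y. - sl.K \<tau> x y) Q" "\<And>x. x \<in> Q \<Longrightarrow> Re (- sl.K \<tau> x x) > 0"
    using PQ(6,8) by (auto simp: seq.orthog_def)
  have posP: "\<And>x. x \<in> P \<Longrightarrow> Re (sl.K \<tau> x x) > 0" using PQ(7) by blast
  note split = sl.definite_splitI[OF PQ]
  then have indep: "cseq.independent P" "cseq.independent Q" by (simp_all add: sl.definite_split_def)
  have count0: "eig_count N \<tau> p0 + prob_index p0 + card P = N + 2"
    using sl.definite_split_count(2)[OF split] by (simp add: eig_count_def prob_index_def p(2))
  have evP: "\<forall>\<^sub>F p in ?F. \<forall>v\<in>cseq.span P. v \<noteq> 0 \<longrightarrow> Re (?K p v v) > 0"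
    by (rule seq.positive_definite_stable[OF kform_hermitian PQ(1,5) posP kform_hermitian])
      (auto intro: tendsto_kform[OF _ p(1)] simp: p(2))
  have evQ: "\<forall>\<^sub>F p in ?F. \<forall>v\<in>cseq.span Q. v \<noteq> 0 \<longrightarrow> Re (- ?K p v v) > 0"
    by (rule seq.positive_definite_stable[OF seq.hermitian_uminus[OF kform_hermitian] PQ(2) negQ
          seq.hermitian_uminus[OF kform_hermitian]])
      (auto intro!: tendsto_minus tendsto_kform[OF _ p(1)] simp: p(2))
  show ?thesis
    using evP evQ eventually_atin_within_mem
  proof eventually_elim
    fix p assume P: "\<forall>v\<in>cseq.span P. v \<noteq> 0 \<longrightarrow> Re (?K p v v) > 0"
      and Q: "\<forall>v\<in>cseq.span Q. v \<noteq> 0 \<longrightarrow> Re (- ?K p v v) > 0" and pS: "p \<in> S"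
    obtain \<omega>' a' z' b' where p': "\<omega>' \<in> Omega N" "p = (\<omega>', bc_class (chart_mat a' z' b'))"
      using subsetD[OF S pS] by (rule chart_problems_cases)
    interpret sl': sl_problem N \<omega>' a' z' b' using N p'(1) by unfold_locales
    have "sl'.definite_split \<tau> P Q"
      unfolding sl'.definite_split_def using PQ indep P Q by (auto simp: p'(2))
    from sl'.definite_split_count(2)[OF this]
    have "eig_count N \<tau> p + prob_index p + card P = N + 2"
      by (simp add: eig_count_def prob_index_def p'(2))
    then show "eig_count N \<tau> p + prob_index p = eig_count N \<tau> p0 + prob_index p0" using count0 by simp
  qed
qed

lemma finite_avoid:
  fixes l u :: real
  assumes "finite A" "l < u"
  obtains t where "l < t" "t < u" "t \<notin> A"
  using assms infinite_Ioo[of l u] by (metis finite_subset greaterThanLessThan_iff subsetI)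

lemma num_eigs_nullity:
  assumes N: "2 \<le> N" and p: "p \<in> chart_problems N"
  shows "num_eigs N p + prob_nullity p = N" "finite (eigenvalues N p)"
proof -
  obtain \<omega> a z b where p: "\<omega> \<in> Omega N" "p = (\<omega>, bc_class (chart_mat a z b))"
    using p chart_problems_cases by blast
  interpret sl: sl_problem N \<omega> a z b using N p(1) by unfold_locales
  obtain \<tau> :: real where \<tau>: "\<tau> \<notin> set (eig_list N p)" using finite_avoid[of "set (eig_list N p)" 0 1] by auto
  obtain P Q where PQ: "finite P" "finite Q" "P \<subseteq> seqs N" "Q \<subseteq> seqs N"
    "seq.orthog (sl.K \<tau>) P" "seq.orthog (sl.K \<tau>) Q"
    "\<forall>x\<in>P. Re (sl.K \<tau> x x) > 0" "\<forall>x\<in>Q. Re (sl.K \<tau> x x) < 0"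
    "card P + card Q = N + 2"
    using sl.kform_orthogonal_basis \<tau> p(2) by metis
  from sl.definite_split_count(3)[OF sl.definite_splitI[OF PQ]] show "num_eigs N p + prob_nullity p = N"
    by (simp add: prob_nullity_def p(2))
  show "finite (eigenvalues N p)" using sl.finite_eigenvalues by (simp add: p(2))
qed

text \<open>By the index relation, more than \<open>n\<close> eigenvalues of \<open>p\<close> lie
  below a threshold iff more than \<open>m\<close> of \<open>p0\<close> do. Thresholds between
  \<open>c\<close> and the limit, off the spectrum of \<open>p0\<close>, give both
  estimates.\<close>

lemma lam_limit:
  assumes N: "2 \<le> N" and p0: "p0 \<in> chart_problems N" and S: "S \<subseteq> chart_problems N"
    and ev: "\<forall>\<^sub>F p in atin_within (prob_top N) p0 S. n < num_eigs N p \<and> prob_index p + n = prob_index p0 + m"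
    and m: "m < num_eigs N p0"
  shows "(lam N n \<longlongrightarrow> lam N m p0) (atin_within (prob_top N) p0 S)"
proof (rule order_tendstoI)
  fix c assume c: "c < lam N m p0"
  obtain t where t: "c < t" "t < lam N m p0" "t \<notin> set (eig_list N p0)"
    using finite_avoid[of "set (eig_list N p0)", OF _ c] by auto
  have le: "eig_count N t p0 \<le> m" using t(2) lam_less_iff[OF m, of t] by (meson not_less order.asym)
  show "\<forall>\<^sub>F p in atin_within (prob_top N) p0 S. c < lam N n p"
    using ev eig_count_stable[OF N p0 t(3) S]
  proof eventually_elim
    case (elim p)
    then have "\<not> n < eig_count N t p" using le by linarith
    then show ?case using lam_less_iff[of n N p t] elim t(1) by simp
  qed
next
  fix c assume c: "lam N m p0 < c"
  obtain t where t: "lam N m p0 < t" "t < c" "t \<notin> set (eig_list N p0)"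
    using finite_avoid[of "set (eig_list N p0)", OF _ c] by auto
  have less: "m < eig_count N t p0" using t(1) lam_less_iff[OF m] by blast
  show "\<forall>\<^sub>F p in atin_within (prob_top N) p0 S. lam N n p < c"
    using ev eig_count_stable[OF N p0 t(3) S]
  proof eventually_elim
    case (elim p)
    then have "n < eig_count N t p" using less by linarith
    then show ?case using lam_less_iff[of n N p t] elim t(2) by simp
  qed
qed

text \<open>Below any threshold, however low, the count at nearby \<open>p\<close> is at least the
  drop of the index.\<close>

lemma lam_at_bot:
  assumes N: "2 \<le> N" and p0: "p0 \<in> chart_problems N" and S: "S \<subseteq> chart_problems N"
    and less: "\<And>p. p \<in> S \<Longrightarrow> n < num_eigs N p \<and> prob_index p + n < prob_index p0"
  shows "filterlim (lam N n) at_bot (atin_within (prob_top N) p0 S)"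
  unfolding filterlim_at_bot
proof
  fix c :: real
  obtain t where t: "c - 1 < t" "t < c" "t \<notin> set (eig_list N p0)"
    using finite_avoid[of "set (eig_list N p0)" "c - 1" c] by auto
  show "\<forall>\<^sub>F p in atin_within (prob_top N) p0 S. lam N n p \<le> c"
    using eventually_atin_within_mem eig_count_stable[OF N p0 t(3) S]
  proof eventually_elim
    case (elim p)
    then have "n < eig_count N t p" using less[of p] by linarith
    then show ?case using lam_less_iff[of n N p t] less[of p] elim t(2) by simp
  qed
qed

text \<open>The count of \<open>p0\<close> never exceeds its total number of eigenvalues. This caps
  the count at nearby \<open>p\<close> by \<open>n\<close> for every threshold, however
  high.\<close>

lemma lam_at_top:
  assumes N: "2 \<le> N" and p0: "p0 \<in> chart_problems N" and S: "S \<subseteq> chart_problems N"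
    and less: "\<And>p. p \<in> S \<Longrightarrow> n < num_eigs N p \<and> prob_index p0 + num_eigs N p0 \<le> prob_index p + n"
  shows "filterlim (lam N n) at_top (atin_within (prob_top N) p0 S)"
  unfolding filterlim_at_top
proof
  fix c :: real
  obtain t where t: "c < t" "t < c + 1" "t \<notin> set (eig_list N p0)"
    using finite_avoid[of "set (eig_list N p0)" c "c + 1"] by auto
  show "\<forall>\<^sub>F p in atin_within (prob_top N) p0 S. c \<le> lam N n p"
    using eventually_atin_within_mem eig_count_stable[OF N p0 t(3) S]
  proof eventually_elim
    case (elim p)
    then have "\<not> n < eig_count N t p" using less[of p] eig_count_le[of N t p0] by linarith
    then show ?case using lam_less_iff[of n N p t] less[of p] elim t(1) by simp
  qed
qed

lemma lam_continuous_on_index: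
  assumes N: "2 \<le> N" and S: "S \<subseteq> chart_problems N"
    and const: "\<And>p. p \<in> S \<Longrightarrow> n < num_eigs N p \<and> prob_index p = c"
  shows "lam_continuous_on N n S"
  unfolding lam_continuous_on_def lam_continuous_at_def
proof (intro ballI conjI)
  fix p assume p: "p \<in> S"
  show "p \<in> S" "n < num_eigs N p" using p const by auto
  let ?S = "{p' \<in> S. n < num_eigs N p'}"
  show "(lam N n \<longlongrightarrow> lam N n p) (atin_within (prob_top N) p ?S)"
  proof (rule lam_limit[OF N])
    show "\<forall>\<^sub>F p' in atin_within (prob_top N) p ?S. n < num_eigs N p' \<and> prob_index p' + n = prob_index p + n"
      using eventually_atin_within_mem[of ?S "prob_top N" p] by eventually_elim (use const p in auto)
  qed (use p S const in auto)
qed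

lemma atin_within_mono: "S \<subseteq> T \<Longrightarrow> atin_within X p S \<le> atin_within X p T"
  unfolding le_filter_def eventually_atin_within by blast

text \<open>Along \<open>S\<close> the eigenvalue tends to minus infinity if n = 0 and to
  \<open>lam N (n - 1) p0\<close> otherwise. Continuity could survive only if the latter equals
  \<open>lam N n p0\<close>, the excluded repetition. Where \<open>p0\<close> has too few
  eigenvalues the claim holds by definition.\<close>

lemma not_lam_continuous_at:
  assumes N: "2 \<le> N" and p0: "p0 \<in> chart_problems N" and S: "S \<subseteq> chart_problems N"
    and jump: "\<And>p. p \<in> S \<Longrightarrow> n < num_eigs N p \<and> prob_index p + 1 = prob_index p0"
    and nontriv: "atin_within (prob_top N) p0 S \<noteq> bot"
    and nr: "\<not> repeats_preceding N n p0"
  shows "\<not> lam_continuous_at N n (chart_problems N) p0"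
proof
  assume "lam_continuous_at N n (chart_problems N) p0"
  then have n: "n < num_eigs N p0"
    and lim: "(lam N n \<longlongrightarrow> lam N n p0) (atin_within (prob_top N) p0 {p' \<in> chart_problems N. n < num_eigs N p'})"
    by (auto simp: lam_continuous_at_def)
  have "S \<subseteq> {p' \<in> chart_problems N. n < num_eigs N p'}" using S jump by blast
  from tendsto_mono[OF atin_within_mono[OF this] lim]
  have lim': "(lam N n \<longlongrightarrow> lam N n p0) (atin_within (prob_top N) p0 S)" .
  show False
  proof (cases "n = 0")
    case True
    have "filterlim (lam N n) at_bot (atin_within (prob_top N) p0 S)"
      using jump True by (intro lam_at_bot[OF N p0 S]) fastforce
    then show False
      using not_tendsto_and_filterlim_at_infinity[OF nontriv lim'] filterlim_at_bot_imp_at_infinity by blast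
  next
    case False
    have "(lam N n \<longlongrightarrow> lam N (n - 1) p0) (atin_within (prob_top N) p0 S)"
    proof (rule lam_limit[OF N p0 S])
      show "\<forall>\<^sub>F p in atin_within (prob_top N) p0 S. n < num_eigs N p \<and> prob_index p + n = prob_index p0 + (n - 1)"
        using eventually_atin_within_mem[of S "prob_top N" p0] by eventually_elim (use jump False in fastforce)
    qed (use n in simp)
    then have "lam N (n - 1) p0 = lam N n p0" using tendsto_unique[OF nontriv _ lim'] by blast
    then show False using nr n False by (simp add: repeats_preceding_def)
  qed
qed

text \<open>For nonzero d the index depends only on the sign of d and, if d > 0, on that of s, which
  is then nonzero because s b >= d.\<close>

lemma prob_index_locally_constant:
  assumes p0: "p0 \<in> chart_problems N" and d: "prob_d p0 \<noteq> 0"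
  shows "\<forall>\<^sub>F p in atin_within (prob_top N) p0 S. prob_index p = prob_index p0"
proof -
  obtain \<omega> a z b where p: "\<omega> \<in> Omega N" "p0 = (\<omega>, bc_class (chart_mat a z b))"
    using p0 chart_problems_cases by blast
  let ?F = "atin_within (prob_top N) p0 S"
  note lims = tendsto_coordinates[OF p(1), where a = a and z = z and b = b and S = S, folded p(2)]
  have s: "(prob_s \<longlongrightarrow> prob_s p0) ?F" unfolding p(2) prob_chart prob_s_def
    using tendsto_add[OF lims(4) lims(1)[of 0]] by (simp add: p(2))
  have b: "(prob_b \<longlongrightarrow> prob_b p0) ?F" using lims(6) by (simp add: prob_b_def[abs_def] p(2))
  have "((\<lambda>p. prob_s p * prob_b p - (cmod (chart_z (snd p)))\<^sup>2) \<longlongrightarrow> prob_s p0 * prob_b p0 - (cmod z)\<^sup>2) ?F"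
    by (intro tendsto_intros s b lims)
  then have dlim: "(prob_d \<longlongrightarrow> prob_d p0) ?F" by (simp add: prob_d_def[abs_def] p(2))
  show ?thesis
  proof (cases "prob_d p0 < 0")
    case True
    show ?thesis using order_tendstoD(2)[OF dlim True]
      by eventually_elim (use True in \<open>auto simp: prob_index_def nonpos_index_def\<close>)
  next
    case False
    then have pos: "prob_d p0 > 0" using d by simp
    then have "prob_s p0 \<noteq> 0" by (auto simp: prob_d_def)
    then have "\<forall>\<^sub>F p in ?F. (prob_s p > 0 \<longleftrightarrow> prob_s p0 > 0)"
    proof (cases "prob_s p0 > 0")
      case True
      show ?thesis using order_tendstoD(1)[OF s True] by eventually_elim (use True in auto)
    next
      case False
      then have "prob_s p0 < 0" using \<open>prob_s p0 \<noteq> 0\<close> by simp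
      from order_tendstoD(2)[OF s this] show ?thesis by eventually_elim (use False in auto)
    qed
    with order_tendstoD(1)[OF dlim pos] show ?thesis
      by eventually_elim (use pos in \<open>auto simp: prob_index_def nonpos_index_def\<close>)
  qed
qed

section \<open>Location of the strata in the chart\<close>

lemma bc_class_mult:
  assumes "invertible T"
  shows "bc_class (T ** M) = bc_class M"
proof -
  have sub: "bc_class (T ** M) \<subseteq> bc_class M" if "invertible T" for T and M :: "complex^4^2"
    unfolding bc_class_def
  proof clarify
    fix S :: "complex^2^2" assume "invertible S"
    then have "S ** (T ** M) = (S ** T) ** M \<and> invertible (S ** T)"
      using that by (simp add: matrix_mul_assoc invertible_mult)
    then show "\<exists>S'. S ** (T ** M) = S' ** M \<and> invertible S'" by blast
  qed
  obtain T' where T': "T' ** T = mat 1" "invertible T'"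
    using assms unfolding invertible_def by metis
  have "T' ** (T ** M) = M" by (simp add: matrix_mul_assoc T'(1))
  then show ?thesis using sub[OF assms, of M] sub[OF T'(2), of "T ** M"] by simp
qed

text \<open>Left multiplication by diag(- f_0, -1) moves the representative into the chart, to the
  point where the 2 x 2 matrix is zero.\<close>

lemma P5_class:
  assumes "\<omega> \<in> Omega N"
  shows "bc_class (vector [vector [1, of_real (1 / f_of \<omega> 0), 0, 0], vector [0, 0, 1, 0]])
    = bc_class (chart_mat (- f_of \<omega> 0) 0 0)"
proof -
  let ?M = "vector [vector [1, of_real (1 / f_of \<omega> 0), 0, 0], vector [0, 0, 1, 0]] :: complex^4^2"
  let ?T = "vector [vector [- of_real (f_of \<omega> 0), 0], vector [0, -1]] :: complex^2^2"
  have f: "f_of \<omega> 0 \<noteq> 0" using assms by (auto simp: Omega_def f_of_def)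
  have "chart_mat (- f_of \<omega> 0) 0 0 = ?T ** ?M"
    using f by (simp add: vec_eq_iff forall_2 forall_4 matrix_matrix_mult_def sum_2 vector_def)
  moreover have "invertible ?T" using f by (simp add: invertible_det_nz det_2 vector_2)
  ultimately show ?thesis using bc_class_mult by metis
qed

lemma P5_iff:
  assumes "p \<in> chart_problems N"
  shows "p \<in> P5 N \<longleftrightarrow> prob_s p = 0 \<and> prob_b p = 0 \<and> prob_d p = 0"
proof -
  obtain \<omega> a z b where p: "\<omega> \<in> Omega N" "p = (\<omega>, bc_class (chart_mat a z b))"
    using assms by (rule chart_problems_cases)
  have "p \<in> P5 N \<longleftrightarrow> bc_class (chart_mat a z b) = bc_class (chart_mat (- f_of \<omega> 0) 0 0)"
    unfolding p(2) P5_def using p(1) P5_class[OF p(1)] bc_class_chart_BC by auto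
  also have "\<dots> \<longleftrightarrow> a = - f_of \<omega> 0 \<and> z = 0 \<and> b = 0" by (metis chart_coordinates)
  also have "\<dots> \<longleftrightarrow> prob_s p = 0 \<and> prob_b p = 0 \<and> prob_d p = 0" by (auto simp: p(2))
  finally show ?thesis .
qed

lemma P5_subset: "P5 N \<subseteq> chart_problems N"
proof
  fix p assume p: "p \<in> P5 N"
  then have "fst p \<in> Omega N" "snd p = bc_class (chart_mat (- f_of (fst p) 0) 0 0)"
    using P5_class[of "fst p" N] by (auto simp: P5_def)
  then show "p \<in> chart_problems N" by (metis chart_in_chart_problems prod.collapse)
qed

lemma P5_E:
  assumes "p \<in> P5 N"
  shows "p \<in> chart_problems N" "prob_s p = 0" "prob_b p = 0" "prob_d p = 0"
  using assms P5_iff P5_subset by blast+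

lemmas strata_defs = P23_def P23_minus_def P23r_def P23l_def P23r_plus_def P23l_plus_def

lemma strata_subset:
  "P23 N \<subseteq> chart_problems N" "P23_minus N \<subseteq> chart_problems N" "P23r N \<subseteq> chart_problems N"
  "P23l N \<subseteq> chart_problems N" "P23r_plus N \<subseteq> chart_problems N" "P23l_plus N \<subseteq> chart_problems N"
  by (auto simp: strata_defs stratum_iff)

text \<open>On d = 0 the product s b is the squared modulus of z, so s and b cannot have opposite
  signs.\<close>

lemma P23_cases:
  assumes "p \<in> P23 N"
  shows "p \<in> P5 N \<or> p \<in> P23r N \<or> p \<in> P23l N"
proof -
  have p: "p \<in> chart_problems N" "prob_d p = 0" using assms by (auto simp: strata_defs stratum_iff)
  then have "prob_s p * prob_b p \<ge> 0" by (simp add: prob_d_def)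
  then show ?thesis using p by (auto simp: strata_defs stratum_iff zero_le_mult_iff)
qed

lemma strata_disjoint_P23:
  "P23_minus N \<inter> P23 N = {}" "P23r_plus N \<inter> P23 N = {}" "P23l_plus N \<inter> P23 N = {}"
  "P5 N \<subseteq> P23 N" "P23r N \<subseteq> P23 N" "P23l N \<subseteq> P23 N"
  using P5_E by (auto simp: strata_defs stratum_iff)

section \<open>Indices on the strata, and the resulting limits\<close>

context
  fixes N :: nat assumes N: "2 \<le> N"
begin

text \<open>The table from which the asymptotics at d = 0 are read: the difference of indices is the
  shift of the eigenvalue number, and the difference of totals decides what leaves through plus
  infinity.\<close>

lemma strata_index:
  "p \<in> P23_minus N \<Longrightarrow> prob_index p = 1 \<and> num_eigs N p = N"
  "p \<in> P23r N \<Longrightarrow> prob_index p = 1 \<and> num_eigs N p = N - 1"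
  "p \<in> P23l N \<Longrightarrow> prob_index p = 2 \<and> num_eigs N p = N - 1"
  "p \<in> P23r_plus N \<Longrightarrow> prob_index p = 0 \<and> num_eigs N p = N"
  "p \<in> P23l_plus N \<Longrightarrow> prob_index p = 2 \<and> num_eigs N p = N"
  "p \<in> P5 N \<Longrightarrow> prob_index p = 2 \<and> num_eigs N p = N - 2"
proof -
  have sq: "prob_d p > 0 \<Longrightarrow> prob_s p \<noteq> 0" by (auto simp: prob_d_def)
  have nn: "num_eigs N p = N - prob_nullity p" if "p \<in> chart_problems N"
    using num_eigs_nullity(1)[OF N that] by simp
  note defs = strata_defs stratum_iff prob_index_def prob_nullity_def nonpos_index_def nullity_def
  show "p \<in> P23_minus N \<Longrightarrow> prob_index p = 1 \<and> num_eigs N p = N"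
    "p \<in> P23r_plus N \<Longrightarrow> prob_index p = 0 \<and> num_eigs N p = N"
    "p \<in> P23l_plus N \<Longrightarrow> prob_index p = 2 \<and> num_eigs N p = N"
    using nn sq by (auto simp: defs)
  show "p \<in> P23r N \<Longrightarrow> prob_index p = 1 \<and> num_eigs N p = N - 1"
    "p \<in> P23l N \<Longrightarrow> prob_index p = 2 \<and> num_eigs N p = N - 1"
    using nn P5_iff[of p N] by (auto simp: defs)
  show "p \<in> P5 N \<Longrightarrow> prob_index p = 2 \<and> num_eigs N p = N - 2"
    using nn P5_E[of p N] by (auto simp: defs)
qed

lemma strata_limit:
  assumes "p0 \<in> chart_problems N" "S \<subseteq> chart_problems N" "m < num_eigs N p0"
    and "\<And>p. p \<in> S \<Longrightarrow> n < num_eigs N p \<and> prob_index p + n = prob_index p0 + m"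
  shows "(lam N n \<longlongrightarrow> lam N m p0) (atin_within (prob_top N) p0 S)"
proof (rule lam_limit[OF N assms(1,2) _ assms(3)])
  show "\<forall>\<^sub>F p in atin_within (prob_top N) p0 S. n < num_eigs N p \<and> prob_index p + n = prob_index p0 + m"
    using eventually_atin_within_mem[of S "prob_top N" p0] by eventually_elim (rule assms(4))
qed

lemma nontrivial_approach:
  "p0 \<in> P23r N \<Longrightarrow> atin_within (prob_top N) p0 (P23r_plus N) \<noteq> bot"
  "p0 \<in> P23l N \<union> P5 N \<Longrightarrow> atin_within (prob_top N) p0 (P23_minus N) \<noteq> bot"
proof -
  assume p0: "p0 \<in> P23r N"
  then obtain \<omega> a z b where p: "\<omega> \<in> Omega N" "p0 = (\<omega>, bc_class (chart_mat a z b))"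
    using strata_subset(3) chart_problems_cases by blast
  have s: "(a + f_of \<omega> 0) * b - (cmod z)\<^sup>2 = 0" "a + f_of \<omega> 0 \<ge> 0" "b \<ge> 0"
    using p0 by (auto simp: strata_defs stratum_iff p(2))
  have notin: "p0 \<notin> P23r_plus N" using p0 strata_disjoint_P23 by blast
  show "atin_within (prob_top N) p0 (P23r_plus N) \<noteq> bot"
  proof (rule path_not_trivial[OF p(1), of "\<lambda>t. a + t" "\<lambda>t. b + t" z])
    fix t :: real assume t: "t > 0"
    \<comment> \<open>Raising both diagonal entries by t adds t times the trace plus the square of t
      to d.\<close>
    have "(a + t + f_of \<omega> 0) * (b + t) - (cmod z)\<^sup>2 = t * (a + f_of \<omega> 0) + t * b + t * t"
      using s(1) by (simp add: algebra_simps)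
    moreover have "t * (a + f_of \<omega> 0) \<ge> 0" "t * b \<ge> 0" "t * t > 0" using s t by simp_all
    ultimately have "(a + t + f_of \<omega> 0) * (b + t) - (cmod z)\<^sup>2 > 0" by linarith
    then show "(\<omega>, bc_class (chart_mat (a + t) z (b + t))) \<in> P23r_plus N"
      using s t p(1) by (simp add: P23r_plus_def stratum_iff chart_in_chart_problems)
  qed (use p notin in \<open>auto intro!: continuous_intros\<close>)
next
  assume p0: "p0 \<in> P23l N \<union> P5 N"
  then obtain \<omega> a z b where p: "\<omega> \<in> Omega N" "p0 = (\<omega>, bc_class (chart_mat a z b))"
    using strata_subset(4) P5_subset chart_problems_cases by blast
  have s: "(a + f_of \<omega> 0) * b - (cmod z)\<^sup>2 = 0" "a + f_of \<omega> 0 \<le> 0" "b \<le> 0"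
    using p0 P5_E[of p0 N] by (auto simp: strata_defs stratum_iff p(2))
  \<comment> \<open>If one of s, b is negative, raising the other by t makes d a negative multiple
    of t. If both vanish, so does z, and moving them in opposite directions makes d minus the square
    of t.\<close>
  obtain \<alpha> \<beta> :: real where ab: "\<And>t. t > 0 \<Longrightarrow> (a + \<alpha> * t + f_of \<omega> 0) * (b + \<beta> * t) - (cmod z)\<^sup>2 < 0"
  proof -
    consider "b < 0" | "a + f_of \<omega> 0 < 0" | "a + f_of \<omega> 0 = 0" "b = 0" using s by linarith
    then show ?thesis
    proof cases
      case 1
      have "(a + 1 * t + f_of \<omega> 0) * (b + 0 * t) - (cmod z)\<^sup>2 < 0" if "t > 0" for t
      proof -
        have "(a + 1 * t + f_of \<omega> 0) * (b + 0 * t) - (cmod z)\<^sup>2 = t * b" using s(1) by (simp add: algebra_simps)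
        then show ?thesis using 1 that by (simp add: mult_pos_neg)
      qed
      then show ?thesis using that by blast
    next
      case 2
      have "(a + 0 * t + f_of \<omega> 0) * (b + 1 * t) - (cmod z)\<^sup>2 < 0" if "t > 0" for t
      proof -
        have "(a + 0 * t + f_of \<omega> 0) * (b + 1 * t) - (cmod z)\<^sup>2 = t * (a + f_of \<omega> 0)"
          using s(1) by (simp add: algebra_simps)
        then show ?thesis using 2 that by (simp only:) (rule mult_pos_neg)
      qed
      then show ?thesis using that by blast
    next
      case 3
      have "(a + 1 * t + f_of \<omega> 0) * (b + (- 1) * t) - (cmod z)\<^sup>2 < 0" if "t > 0" for t
      proof -
        have "a + 1 * t + f_of \<omega> 0 = t" using 3(1) by simp
        then show ?thesis using s(1) 3 that by simp
      qed
      then show ?thesis using that by blast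
    qed
  qed
  have notin: "p0 \<notin> P23_minus N" using p0 strata_disjoint_P23 by blast
  show "atin_within (prob_top N) p0 (P23_minus N) \<noteq> bot"
  proof (rule path_not_trivial[OF p(1), of "\<lambda>t. a + \<alpha> * t" "\<lambda>t. b + \<beta> * t" z])
    show "(\<omega>, bc_class (chart_mat (a + \<alpha> * t) z (b + \<beta> * t))) \<in> P23_minus N" if "t > 0" for t
      using ab[OF that] p(1) by (simp add: P23_minus_def stratum_iff chart_in_chart_problems)
  qed (use p notin in \<open>auto intro!: continuous_intros\<close>)
qed

lemma continuous_off_P23:
  assumes "n < N"
  shows "lam_continuous_on N n (chart_problems N - P23 N)"
  unfolding lam_continuous_on_def lam_continuous_at_def
proof (intro ballI conjI)
  fix p assume p: "p \<in> chart_problems N - P23 N"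
  let ?S = "{p' \<in> chart_problems N - P23 N. n < num_eigs N p'}"
  have num: "num_eigs N q = N" if "q \<in> chart_problems N - P23 N" for q
    using num_eigs_nullity(1)[OF N, of q] that by (simp add: P23_def stratum_iff prob_nullity_def nullity_def)
  show "p \<in> chart_problems N - P23 N" "n < num_eigs N p" using p num[OF p] assms by auto
  have d: "prob_d p \<noteq> 0" using p by (simp add: P23_def stratum_iff)
  show "(lam N n \<longlongrightarrow> lam N n p) (atin_within (prob_top N) p ?S)"
  proof (rule lam_limit[OF N])
    have "p \<in> chart_problems N" using p by blast
    from eventually_conj[OF eventually_atin_within_mem prob_index_locally_constant[OF this d]]
    show "\<forall>\<^sub>F p' in atin_within (prob_top N) p ?S. n < num_eigs N p' \<and> prob_index p' + n = prob_index p + n"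
      by (rule eventually_mono) auto
  qed (use p num[OF p] assms in auto)
qed

text \<open>Each point of d = 0 is approached by a stratum with all N eigenvalues and an index
  smaller by exactly one: \<open>P23r_plus\<close> (0 against 1) or \<open>P23_minus\<close> (1
  against 2).\<close>

lemma discontinuous_on_P23:
  assumes p0: "p0 \<in> P23 N" and n: "n < N" and nr: "\<not> repeats_preceding N n p0"
  shows "\<not> lam_continuous_at N n (chart_problems N) p0"
proof -
  have p: "p0 \<in> chart_problems N" using p0 strata_subset by blast
  show ?thesis
  proof (cases "p0 \<in> P23r N")
    case True
    show ?thesis
      by (rule not_lam_continuous_at[OF N p strata_subset(5) _ nontrivial_approach(1)[OF True] nr])
        (use strata_index(2)[OF True] n in \<open>auto dest!: strata_index\<close>)
  next
    case False
    then have q: "p0 \<in> P23l N \<union> P5 N" using P23_cases[OF p0] by blast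
    then have i0: "prob_index p0 = 2" using strata_index by blast
    show ?thesis
      by (rule not_lam_continuous_at[OF N p strata_subset(2) _ nontrivial_approach(2)[OF q] nr])
        (use i0 n in \<open>auto dest!: strata_index\<close>)
  qed
qed

end

theorem theorem5p4:
  fixes N :: nat
  assumes "2 \<le> N"
  shows
    "(\<forall>p \<in> P5 N. has_exactly_eigs N p (N - 2)) \<and>
     (\<forall>p \<in> P23 N - P5 N. has_exactly_eigs N p (N - 1)) \<and>
     (\<forall>p \<in> (Omega N \<times> O23) - P23 N. has_exactly_eigs N p N) \<and>

     (\<forall>n<N. lam_continuous_on N n ((Omega N \<times> O23) - P23 N)) \<and>

     (\<forall>p0 \<in> P23 N. \<forall>n<N. \<not> repeats_preceding N n p0 \<longrightarrow>
        \<not> lam_continuous_at N n (Omega N \<times> O23) p0) \<and>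

     (\<forall>p0 \<in> P23r N.
        (\<forall>n. n + 2 \<le> N \<longrightarrow>
           (lam N n \<longlongrightarrow> lam N n p0) (atin_within (prob_top N) p0 (P23_minus N \<union> P23r N))) \<and>
        filterlim (lam N (N - 1)) at_top (atin_within (prob_top N) p0 (P23_minus N)) \<and>
        filterlim (lam N 0) at_bot (atin_within (prob_top N) p0 (P23r_plus N)) \<and>
        (\<forall>n. 1 \<le> n \<and> n \<le> N - 1 \<longrightarrow>
           (lam N n \<longlongrightarrow> lam N (n - 1) p0) (atin_within (prob_top N) p0 (P23r_plus N)))) \<and>

     (\<forall>p0 \<in> P23l N.
        filterlim (lam N 0) at_bot (atin_within (prob_top N) p0 (P23_minus N)) \<and>
        (\<forall>n. 1 \<le> n \<and> n \<le> N - 1 \<longrightarrow>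
           (lam N n \<longlongrightarrow> lam N (n - 1) p0) (atin_within (prob_top N) p0 (P23_minus N))) \<and>
        (\<forall>n. n + 2 \<le> N \<longrightarrow>
           (lam N n \<longlongrightarrow> lam N n p0) (atin_within (prob_top N) p0 (P23l_plus N \<union> P23l N))) \<and>
        filterlim (lam N (N - 1)) at_top (atin_within (prob_top N) p0 (P23l_plus N))) \<and>

     (\<forall>p0 \<in> P5 N.
        filterlim (lam N 0) at_bot
          (atin_within (prob_top N) p0 (P23r_plus N \<union> P23r N \<union> P23_minus N)) \<and>
        filterlim (lam N 1) at_bot (atin_within (prob_top N) p0 (P23r_plus N)) \<and>
        (\<forall>n. n + 3 \<le> N \<longrightarrow>
           (lam N n \<longlongrightarrow> lam N n p0)
             (atin_within (prob_top N) p0 (P23l_plus N \<union> P23l N \<union> P5 N))) \<and>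
        (\<forall>n. 1 \<le> n \<and> n \<le> N - 2 \<longrightarrow>
           (lam N n \<longlongrightarrow> lam N (n - 1) p0)
             (atin_within (prob_top N) p0 (P23r N \<union> P23_minus N))) \<and>
        (\<forall>n. 2 \<le> n \<and> n \<le> N - 1 \<longrightarrow>
           (lam N n \<longlongrightarrow> lam N (n - 2) p0) (atin_within (prob_top N) p0 (P23r_plus N))) \<and>
        filterlim (lam N (N - 2)) at_top
          (atin_within (prob_top N) p0 (P23l_plus N \<union> P23l N)) \<and>
        filterlim (lam N (N - 1)) at_top
          (atin_within (prob_top N) p0 (P23l_plus N \<union> P23_minus N))) \<and>

     (\<forall>n. n + 3 \<le> N \<longrightarrow>
        lam_continuous_on N n (P23_minus N \<union> P23r N) \<and>
        lam_continuous_on N n (P23l_plus N \<union> P23l N \<union> P5 N)) \<and>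
     lam_continuous_on N (N - 2) (P23_minus N \<union> P23r N) \<and>
     lam_continuous_on N (N - 2) (P23l_plus N \<union> P23l N)"
proof -
  note N = assms
  note idx = strata_index[OF N]
  note sub = strata_subset P5_subset
  have fin: "p \<in> chart_problems N \<Longrightarrow> finite (eigenvalues N p)" for p by (rule num_eigs_nullity(2)[OF N])
  have chart: "Omega N \<times> O23 = chart_problems N" by (simp add: chart_problems_def)
  show ?thesis
    unfolding chart
  proof (intro conjI ballI allI impI)
    show "has_exactly_eigs N p (N - 2)" if "p \<in> P5 N" for p
      using idx(6)[OF that] fin[OF subsetD[OF sub(7) that]] by (simp add: has_exactly_eigs_def)
    show "has_exactly_eigs N p (N - 1)" if "p \<in> P23 N - P5 N" for p
    proof -
      have "num_eigs N p = N - 1" using that P23_cases[of p N] idx(2,3)[of p] by blast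
      moreover have "finite (eigenvalues N p)" using that sub(1) by (intro fin) blast
      ultimately show ?thesis by (simp add: has_exactly_eigs_def)
    qed
    show "has_exactly_eigs N p N" if "p \<in> chart_problems N - P23 N" for p
      using that fin num_eigs_nullity(1)[OF N, of p]
      by (simp add: has_exactly_eigs_def P23_def stratum_iff prob_nullity_def nullity_def)
    show "lam_continuous_on N n (chart_problems N - P23 N)" if "n < N" for n
      using continuous_off_P23[OF N that] .
    show "\<not> lam_continuous_at N n (chart_problems N) p0"
      if "p0 \<in> P23 N" "n < N" "\<not> repeats_preceding N n p0" for p0 n
      using discontinuous_on_P23[OF N that] .
  next
    fix p0 assume p0: "p0 \<in> P23r N"
    note i0 = idx(2)[OF p0]
    have p: "p0 \<in> chart_problems N" using p0 sub by blast
    show "(lam N n \<longlongrightarrow> lam N n p0) (atin_within (prob_top N) p0 (P23_minus N \<union> P23r N))" if "n + 2 \<le> N" for n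
      by (rule strata_limit[OF N p])
        (use sub in blast, use i0 that N in force, use i0 that N in \<open>auto dest!: idx\<close>)
    \<comment> \<open>The index is 1 on both sides, but N eigenvalues face N - 1: the surplus one
      leaves through plus infinity.\<close>
    show "filterlim (lam N (N - 1)) at_top (atin_within (prob_top N) p0 (P23_minus N))"
      by (rule lam_at_top[OF N p]) (use sub in blast, use i0 N in \<open>auto dest!: idx\<close>)
    show "filterlim (lam N 0) at_bot (atin_within (prob_top N) p0 (P23r_plus N))"
      by (rule lam_at_bot[OF N p]) (use sub in blast, use i0 N in \<open>auto dest!: idx\<close>)
    show "(lam N n \<longlongrightarrow> lam N (n - 1) p0) (atin_within (prob_top N) p0 (P23r_plus N))" if "1 \<le> n \<and> n \<le> N - 1" for n
      by (rule strata_limit[OF N p])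
        (use sub in blast, use i0 that N in force, use i0 that N in \<open>auto dest!: idx\<close>)
  next
    fix p0 assume p0: "p0 \<in> P23l N"
    note i0 = idx(3)[OF p0]
    have p: "p0 \<in> chart_problems N" using p0 sub by blast
    show "filterlim (lam N 0) at_bot (atin_within (prob_top N) p0 (P23_minus N))"
      by (rule lam_at_bot[OF N p]) (use sub in blast, use i0 N in \<open>auto dest!: idx\<close>)
    show "(lam N n \<longlongrightarrow> lam N (n - 1) p0) (atin_within (prob_top N) p0 (P23_minus N))" if "1 \<le> n \<and> n \<le> N - 1" for n
      by (rule strata_limit[OF N p])
        (use sub in blast, use i0 that N in force, use i0 that N in \<open>auto dest!: idx\<close>)
    show "(lam N n \<longlongrightarrow> lam N n p0) (atin_within (prob_top N) p0 (P23l_plus N \<union> P23l N))" if "n + 2 \<le> N" for n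
      by (rule strata_limit[OF N p])
        (use sub in blast, use i0 that N in force, use i0 that N in \<open>auto dest!: idx\<close>)
    show "filterlim (lam N (N - 1)) at_top (atin_within (prob_top N) p0 (P23l_plus N))"
      by (rule lam_at_top[OF N p]) (use sub in blast, use i0 N in \<open>auto dest!: idx\<close>)
  next
    fix p0 assume p0: "p0 \<in> P5 N"
    note i0 = idx(6)[OF p0]
    have p: "p0 \<in> chart_problems N" using p0 sub by blast
    show "filterlim (lam N 0) at_bot (atin_within (prob_top N) p0 (P23r_plus N \<union> P23r N \<union> P23_minus N))"
      by (rule lam_at_bot[OF N p]) (use sub in blast, use i0 N in \<open>auto dest!: idx\<close>)
    \<comment> \<open>The index drops from 2 to 0, so two eigenvalues are lost to minus
      infinity.\<close>
    show "filterlim (lam N 1) at_bot (atin_within (prob_top N) p0 (P23r_plus N))"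
      by (rule lam_at_bot[OF N p]) (use sub in blast, use i0 N in \<open>auto dest!: idx\<close>)
    show "(lam N n \<longlongrightarrow> lam N n p0) (atin_within (prob_top N) p0 (P23l_plus N \<union> P23l N \<union> P5 N))" if "n + 3 \<le> N" for n
      by (rule strata_limit[OF N p])
        (use sub in blast, use i0 that N in force, use i0 that N in \<open>auto dest!: idx\<close>)
    show "(lam N n \<longlongrightarrow> lam N (n - 1) p0) (atin_within (prob_top N) p0 (P23r N \<union> P23_minus N))" if "1 \<le> n \<and> n \<le> N - 2" for n
      by (rule strata_limit[OF N p])
        (use sub in blast, use i0 that N in force, use i0 that N in \<open>auto dest!: idx\<close>)
    show "(lam N n \<longlongrightarrow> lam N (n - 2) p0) (atin_within (prob_top N) p0 (P23r_plus N))" if "2 \<le> n \<and> n \<le> N - 1" for n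
      by (rule strata_limit[OF N p])
        (use sub in blast, use i0 that N in force, use i0 that N in \<open>auto dest!: idx\<close>)
    show "filterlim (lam N (N - 2)) at_top (atin_within (prob_top N) p0 (P23l_plus N \<union> P23l N))"
      by (rule lam_at_top[OF N p]) (use sub in blast, use i0 N in \<open>auto dest!: idx\<close>)
    show "filterlim (lam N (N - 1)) at_top (atin_within (prob_top N) p0 (P23l_plus N \<union> P23_minus N))"
      by (rule lam_at_top[OF N p]) (use sub in blast, use i0 N in \<open>auto dest!: idx\<close>)
  next
    show "lam_continuous_on N n (P23_minus N \<union> P23r N)" if "n + 3 \<le> N" for n
      by (rule lam_continuous_on_index[OF N, where c = 1]) (use sub in blast, use that N in \<open>auto dest!: idx\<close>)
    show "lam_continuous_on N n (P23l_plus N \<union> P23l N \<union> P5 N)" if "n + 3 \<le> N" for n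
      by (rule lam_continuous_on_index[OF N, where c = 2]) (use sub in blast, use that N in \<open>auto dest!: idx\<close>)
    show "lam_continuous_on N (N - 2) (P23_minus N \<union> P23r N)"
      by (rule lam_continuous_on_index[OF N, where c = 1]) (use sub in blast, use N in \<open>auto dest!: idx\<close>)
    show "lam_continuous_on N (N - 2) (P23l_plus N \<union> P23l N)"
      by (rule lam_continuous_on_index[OF N, where c = 2]) (use sub in blast, use N in \<open>auto dest!: idx\<close>)
  qed
qed

end
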